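(* Let $H$, $\mu$, $\alpha$, $(a_n)$, $L$, $(M_n)$, $\{X_{nj}\}$ and $S_n=\sum_{j=1}^n X_{nj}$ be as in the context (soft truncation regime). Define $$b_n:=\begin{cases}\inf\{x:P(\|H\|>x)\le n^{-1}\},&\alpha<2,\\ \sqrt{n^{1+\gamma}},&\alpha=2,\\ \sqrt{n\log n},&\alpha>2,\end{cases}$$ where, when $\alpha=2$, $\gamma>0$ is the number in the context for which $M_n/\sqrt{n^{1+\gamma}}\to\infty$. If $(\lambda_n)$ is any sequence of positive numbers satisfying $b_n\ll\lambda_n\ll M_n$, then, as $n\to\infty$, $$\frac{P(\lambda_n^{-1}S_n\in\cdot)}{nP(\|H\|>\lambda_n)}\ \stackrel{v}{\longrightarrow}\ \frac{\mu(\cdot)}{\mu(B_1^c)}\qquad\text{on }\overline{\mathbb R^d}\setminus\{0\}.$$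
   Context: Notation: $\|\cdot\|$ is the Euclidean norm on $\mathbb R^d$; $B_r:=\{x\in\mathbb R^d:\|x\|\le r\}$ for $r\ge0$, and complements of such balls are denoted $B_r^c$; $u_n\ll v_n$ (equivalently $v_n\gg u_n$) means $u_n/v_n\to0$. $\overline{\mathbb R^d}$ is the compact set obtained by adding to $\mathbb R^d$ a sphere of infinite radius centered at the origin; $\stackrel{v}{\longrightarrow}$ denotes vague convergence of Radon measures on the indicated space (on $\overline{\mathbb R^d}\setminus\{0\}$, relatively compact sets are those bounded away from $0$). Setup: $H$ is an $\mathbb R^d$-valued random vector for which there are a non-null Radon measure $\mu$ on $\mathbb R^d\setminus\{0\}$, extended by $\mu(\overline{\mathbb R^d}\setminus\mathbb R^d)=0$, and a sequence $a_n\to\infty$ with $nP(a_n^{-1}H\in\cdot)\stackrel{v}{\longrightarrow}\mu(\cdot)$ on $\overline{\mathbb R^d}\setminus\{0\}$. Then there is $\alpha>0$ with $\mu(cA)=c^{-\alpha}\mu(A)$ for all $c>0$ and Borel $A$, and $P(\|H\|>\cdot)$ is regularly varying with index $-\alpha$. If $\alpha=1$, $H$ is assumed to have a symmetric distribution; if $\alpha>1$, $E(H)=0$. $H_1,H_2,\ldots$ are i.i.d. copies of $H$; $L,L_1,L_2,\ldots$ are i.i.d. $[0,\infty)$-valued random variables independent of $(H,H_1,H_2,\ldots)$; $(M_n)$ is a sequence of positive numbers with $M_n\to\infty$; and for $1\le j\le n$ $$X_{nj}:=H_j\mathbf 1(\|H_j\|\le M_n)+\frac{H_j}{\|H_j\|}(M_n+L_j)\mathbf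 1(\|H_j\|>M_n).$$ Soft truncation regime (standing assumptions): $\lim_{n\to\infty}nP(\|H\|>M_n)=0$; moreover, if $\alpha=2$, $\lim_n M_n/\sqrt{n^{1+\gamma}}=\infty$ for some $\gamma>0$ (fixed); and if $\alpha>2$, $\lim_n M_n/\sqrt{n\log M_n}=\infty$. *)

theory Defs
  imports "HOL-Probability.Probability"
begin

text \<open>
  The compactification of \<open>\<real>\<^sup>d\<close> by a sphere of infinite radius is modelled as the closed unit ball:
  \<open>ext_embed\<close> maps \<open>\<real>\<^sup>d\<close> homeomorphically onto the open unit ball, preserving directions and
  fixing the origin, and the unit sphere plays the role of the sphere at infinity.
\<close>

definition ext_embed :: "'a::euclidean_space \<Rightarrow> 'a" where
  "ext_embed x = x /\<^sub>R (1 + norm x)"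

definition ext_punctured :: "'a::euclidean_space set" where
  "ext_punctured = cball 0 1 - {0}"

text \<open>
  A Borel measure on \<open>\<real>\<^sup>d\<close>, regarded as a measure on the compactification that does not charge
  the sphere at infinity.
\<close>

definition ext_measure :: "'a::euclidean_space measure \<Rightarrow> 'a measure" where
  "ext_measure \<nu> = distr \<nu> borel ext_embed"

text \<open>
  The sets \<open>S\<close> of interest are locally compact subsets of a Euclidean space, where a Borel
  measure that is finite on compact sets is automatically regular.
\<close>

definition radon_on :: "'b::topological_space set \<Rightarrow> 'b measure \<Rightarrow> bool" where
  "radon_on S \<nu> \<longleftrightarrow> sets \<nu> = sets borel \<and> (\<forall>K. compact K \<and> K \<subseteq> S \<longrightarrow> emeasure \<nu> K < \<infinity>)"

text \<open>
  Vague convergence on \<open>S\<close>, tested against the continuous functions on \<open>S\<close> with compact support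
  in \<open>S\<close>. It is meant for measures that are Radon on \<open>S\<close>, so that all the integrals are
  genuine; only the parts of the measures on \<open>S\<close> matter.
\<close>

definition vague_conv_on ::
  "'b::topological_space set \<Rightarrow> (nat \<Rightarrow> 'b measure) \<Rightarrow> 'b measure \<Rightarrow> bool" where
  "vague_conv_on S \<nu>s \<nu> \<longleftrightarrow>
     (\<forall>f :: 'b \<Rightarrow> real.
        continuous_on S f \<and> (\<exists>K. compact K \<and> K \<subseteq> S \<and> (\<forall>x\<in>S - K. f x = 0)) \<longrightarrow>
        (\<lambda>n. set_lebesgue_integral (\<nu>s n) S f) \<longlonglongrightarrow> set_lebesgue_integral \<nu> S f)"

text \<open>
  Independence of two random elements \<open>Y\<close> and \<open>Z\<close>; the library's \<open>indep_var\<close> requires both to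
  take values in the same type.
\<close>

definition indep_pair ::
  "'w measure \<Rightarrow> 'b measure \<Rightarrow> ('w \<Rightarrow> 'b) \<Rightarrow> 'c measure \<Rightarrow> ('w \<Rightarrow> 'c) \<Rightarrow> bool" where
  "indep_pair P N1 Y N2 Z \<longleftrightarrow>
     Y \<in> measurable P N1 \<and> Z \<in> measurable P N2 \<and>
     prob_space.indep_set P
       {Y -` A \<inter> space P | A. A \<in> sets N1} {Z -` B \<inter> space P | B. B \<in> sets N2}"

definition norm_tail :: "'w measure \<Rightarrow> ('w \<Rightarrow> 'a::euclidean_space) \<Rightarrow> real \<Rightarrow> real" where
  "norm_tail P H x = measure P {\<omega> \<in> space P. norm (H \<omega>) > x}"

definition soft_trunc :: "real \<Rightarrow> real \<Rightarrow> 'a::euclidean_space \<Rightarrow> 'a" where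
  "soft_trunc m l h = (if norm h \<le> m then h else ((m + l) / norm h) *\<^sub>R h)"

text \<open>
  The numbers \<open>b\<^sub>n\<close>. They only enter asymptotically; the infimum is that of a nonempty set
  bounded below for every \<open>n \<ge> 2\<close>.
\<close>

definition b_scale ::
  "'w measure \<Rightarrow> ('w \<Rightarrow> 'a::euclidean_space) \<Rightarrow> real \<Rightarrow> real \<Rightarrow> nat \<Rightarrow> real" where
  "b_scale P H \<alpha> \<gamma> n =
     (if \<alpha> < 2 then Inf {x. norm_tail P H x \<le> 1 / real n}
      else if \<alpha> = 2 then sqrt (real n powr (1 + \<gamma>))
      else sqrt (real n * ln (real n)))"

definition seq_ll :: "(nat \<Rightarrow> real) \<Rightarrow> (nat \<Rightarrow> real) \<Rightarrow> bool" where
  "seq_ll u v \<longleftrightarrow> (\<lambda>n. u n / v n) \<longlonglongrightarrow> 0"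

end

theory Submission
  imports Defs
begin

text \<open>
  Write \<open>F x = P(\<parallel>H\<parallel> > x)\<close>, let \<open>c\<close> be the mass of \<open>\<mu>\<close> outside the closed unit ball, and let
  \<open>p\<^sub>n = n F(\<lambda>\<^sub>n)\<close>, which tends to 0. The theorem is an instance of the principle of one big
  jump: the only way in which \<open>S\<^sub>n\<close> can reach the scale \<open>\<lambda>\<^sub>n\<close> with a probability of order \<open>p\<^sub>n\<close>
  is that exactly one summand is of size \<open>\<lambda>\<^sub>n\<close>, and that summand then carries the whole sum.

  Truncation does not interfere. Some \<open>\<parallel>H\<^sub>j\<parallel>\<close> with \<open>j \<le> n\<close> exceeds \<open>M\<^sub>n\<close> with probability at
  most \<open>n F(M\<^sub>n)\<close>, and this is \<open>o(p\<^sub>n)\<close> because \<open>F\<close> is regularly varying and \<open>\<lambda>\<^sub>n\<close> is negligible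
  with respect to \<open>M\<^sub>n\<close>. Off that event \<open>S\<^sub>n = H\<^sub>1 + \<dots> + H\<^sub>n\<close> (\<open>truncation_effect\<close>,
  \<open>tail_ratio_tendsto_0\<close>).

  For the sum \<open>H\<^sub>1 + \<dots> + H\<^sub>n\<close> there are three ingredients.

  \<^item> Vague convergence along the sequence \<open>a\<^sub>n\<close> upgrades to vague convergence of
    \<open>P(H / x \<in> \<cdot>) / F x\<close> to \<open>\<mu> / c\<close> as the real number \<open>x\<close> tends to infinity
    (\<open>vague_along_reals\<close>). In particular \<open>F\<close> is regularly varying with index \<open>-\<alpha>\<close>, and
    elementary dyadic arguments give the bounds of Karamata and Potter for truncated moments and
    for \<open>F\<close>.

  \<^item> A test function vanishes near the origin and is uniformly continuous in the metric of the
    compactification. Comparing its value at \<open>(H\<^sub>1 + \<dots> + H\<^sub>n) / \<lambda>\<^sub>n\<close> with the sum of its values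
    at the points \<open>H\<^sub>j / \<lambda>\<^sub>n\<close> produces an error from a small displacement, which is a small
    multiple of \<open>p\<^sub>n\<close>, an error from two large summands, which is \<open>O(p\<^sub>n\<^sup>2)\<close>, and the
    probability that the summands of norm at most \<open>\<eta> \<lambda>\<^sub>n\<close> add up to something larger than
    \<open>\<epsilon> \<lambda>\<^sub>n\<close> (\<open>one_big_jump_bound\<close>, \<open>one_big_jump\<close>).

  \<^item> This last probability is \<open>o(p\<^sub>n)\<close> as soon as \<open>\<eta>\<close> is small compared with \<open>\<epsilon>\<close>
    (\<open>cut_sum_deviation\<close>). This is where the size of \<open>\<lambda>\<^sub>n\<close> enters: an exponential Markov
    inequality with parameter proportional to \<open>ln (1 / p\<^sub>n) / \<lambda>\<^sub>n\<close> bounds it by a multiple of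
    \<open>p\<^sub>n\<^sup>2\<close>, provided that mean, variance and a higher moment of the truncated summands are
    small enough (\<open>admissible_scale\<close>). That \<open>b\<^sub>n\<close> is negligible with respect to \<open>\<lambda>\<^sub>n\<close> guarantees
    this in each of the regimes \<open>\<alpha> < 2\<close>, \<open>\<alpha> = 2\<close> and \<open>\<alpha> > 2\<close> (\<open>admissible_scale_of_b_scale\<close>).
\<close>

section \<open>Test functions on the punctured compactification\<close>

lemma ext_embed_0 [simp]: "ext_embed 0 = 0"
  by (simp add: ext_embed_def)

lemma norm_ext_embed: "norm (ext_embed x) = norm x / (1 + norm x)"
proof -
  have "\<bar>1 + norm x\<bar> = 1 + norm x" using norm_ge_zero[of x] by linarith
  then show ?thesis by (simp add: ext_embed_def divide_inverse)
qed

lemma ext_embed_in_ext_punctured_iff: "ext_embed x \<in> ext_punctured \<longleftrightarrow> x \<noteq> 0"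
proof -
  have "1 + norm x \<noteq> 0" by (smt (verit) norm_ge_zero)
  moreover have "norm (ext_embed x) \<le> 1" by (simp add: norm_ext_embed add_pos_nonneg)
  ultimately show ?thesis by (auto simp: ext_punctured_def ext_embed_def)
qed

lemma dist_ext_embed_le: "dist (ext_embed x) (ext_embed y) \<le> 2 * dist x y"
proof -
  define u v where "u = 1 + norm x" and "v = 1 + norm y"
  have p: "u \<ge> 1" "v \<ge> 1" by (auto simp: u_def v_def)
  have "ext_embed x - ext_embed y = (v *\<^sub>R (x - y) + (norm y - norm x) *\<^sub>R y) /\<^sub>R (u * v)"
  proof -
    have "(u * v) *\<^sub>R (ext_embed x - ext_embed y) = v *\<^sub>R x - u *\<^sub>R y"
      using p by (simp add: ext_embed_def u_def[symmetric] v_def[symmetric] algebra_simps)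
    also have "\<dots> = v *\<^sub>R (x - y) + (norm y - norm x) *\<^sub>R y"
      by (simp add: u_def v_def algebra_simps)
    finally have "(v *\<^sub>R (x - y) + (norm y - norm x) *\<^sub>R y) /\<^sub>R (u * v) =
        ((u * v) *\<^sub>R (ext_embed x - ext_embed y)) /\<^sub>R (u * v)" by simp
    also have "\<dots> = ext_embed x - ext_embed y"
      using p by (subst scaleR_scaleR) (simp add: left_inverse del: inverse_mult_distrib)
    finally show ?thesis by simp
  qed
  then have "norm (ext_embed x - ext_embed y) = norm (v *\<^sub>R (x - y) + (norm y - norm x) *\<^sub>R y) / (u * v)"
    using p by (simp add: divide_inverse abs_mult mult.commute)
  also have "norm (v *\<^sub>R (x - y) + (norm y - norm x) *\<^sub>R y) \<le> v * norm (x - y) + norm (x - y) * v"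
  proof -
    have "norm (v *\<^sub>R (x - y)) = v * norm (x - y)" using p by simp
    moreover have "norm ((norm y - norm x) *\<^sub>R y) \<le> norm (x - y) * v"
      unfolding norm_scaleR by (intro mult_mono) (auto simp: v_def norm_triangle_ineq3 abs_minus_commute)
    ultimately show ?thesis by (smt (verit) norm_triangle_ineq)
  qed
  also have "(v * norm (x - y) + norm (x - y) * v) / (u * v) = 2 * norm (x - y) / u"
    using p by (simp add: field_simps)
  also have "\<dots> \<le> 2 * norm (x - y)" using p by (simp add: divide_simps mult_le_cancel_left1)
  finally show ?thesis using p by (simp add: dist_norm divide_right_mono)
qed

text \<open>
  Uniformity in \<open>x\<close> is the point: rescaling by a factor close to 1 is a uniformly small
  displacement of the compactification, although it moves distant points of the space itself
  arbitrarily far.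
\<close>

lemma dist_ext_embed_scaleR_le:
  assumes "s \<ge> 0"
  shows "dist (ext_embed (s *\<^sub>R x)) (ext_embed x) \<le> \<bar>s - 1\<bar>"
proof -
  define u v where "u = 1 + s * norm x" and "v = 1 + norm x"
  have p: "u \<ge> 1" "v \<ge> 1" using assms by (auto simp: u_def v_def)
  have e: "ext_embed (s *\<^sub>R x) = (s / u) *\<^sub>R x" "ext_embed x = (1 / v) *\<^sub>R x"
    using assms by (auto simp: ext_embed_def u_def v_def divide_inverse mult.commute)
  have "s / u - 1 / v = (s - 1) / (u * v)" using p
    by (simp add: field_simps) (simp add: u_def v_def algebra_simps)
  then have "dist (ext_embed (s *\<^sub>R x)) (ext_embed x) = \<bar>s - 1\<bar> / (u * v) * norm x"
    using p by (simp add: dist_norm e scaleR_left_diff_distrib [symmetric])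
  also have "\<dots> = \<bar>s - 1\<bar> * (norm x / (u * v))" by simp
  also have "norm x / (u * v) \<le> 1"
  proof -
    have "norm x \<le> v" by (simp add: v_def)
    also have "v \<le> u * v" using p by (simp add: mult_le_cancel_right1)
    finally show ?thesis using p by (simp add: divide_simps)
  qed
  then have "\<bar>s - 1\<bar> * (norm x / (u * v)) \<le> \<bar>s - 1\<bar>"
    using mult_left_le[of "norm x / (u * v)" "\<bar>s - 1\<bar>"] by simp
  finally show ?thesis .
qed

lemma continuous_ext_embed: "continuous_on A ext_embed"
proof -
  have "1 + norm x \<noteq> 0" for x :: 'a by (smt (verit) norm_ge_zero)
  then show ?thesis unfolding ext_embed_def[abs_def] by (intro continuous_intros) auto
qed

lemma measurable_ext_embed [measurable]: "ext_embed \<in> borel_measurable borel"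
  by (intro borel_measurable_continuous_onI continuous_ext_embed)

lemma sets_ext_punctured [measurable]: "ext_punctured \<in> sets borel"
  by (simp add: ext_punctured_def)

text \<open>
  These are the functions that \<open>vague_conv_on ext_punctured\<close> tests against.
\<close>

definition vague_test :: "('a::euclidean_space \<Rightarrow> real) \<Rightarrow> bool" where
  "vague_test f \<longleftrightarrow> continuous_on ext_punctured f \<and>
     (\<exists>K. compact K \<and> K \<subseteq> ext_punctured \<and> (\<forall>x\<in>ext_punctured - K. f x = 0))"

text \<open>
  The indicator only fixes the value at the origin, where a test function is arbitrary.
\<close>

definition pull_test :: "('a::euclidean_space \<Rightarrow> real) \<Rightarrow> 'a \<Rightarrow> real" where
  "pull_test f x = indicator ext_punctured (ext_embed x) *\<^sub>R f (ext_embed x)"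

lemma measurable_pull_test:
  assumes "vague_test f"
  shows "pull_test f \<in> borel_measurable borel"
proof -
  have "(\<lambda>z. indicator ext_punctured z *\<^sub>R f z) \<in> borel_measurable borel"
    using assms by (intro borel_measurable_continuous_on_indicator) (auto simp: vague_test_def)
  then show ?thesis unfolding pull_test_def[abs_def] by measurable
qed

lemma integral_scale_measure:
  fixes f :: "'b \<Rightarrow> real"
  assumes "r \<ge> 0"
  shows "integral\<^sup>L (scale_measure (ennreal r) N) f = r * integral\<^sup>L N f"
proof (cases "f \<in> borel_measurable N")
  case True
  have "scale_measure (ennreal r) N = density N (\<lambda>_. ennreal r)"
    by (rule measure_eqI) (auto simp: emeasure_density nn_integral_cmult_indicator)
  then show ?thesis using assms True
    by (subst \<open>scale_measure _ _ = _\<close>) (subst integral_density, auto)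
next
  case False
  then have "\<not> integrable N f" "\<not> integrable (scale_measure (ennreal r) N) f"
    using measurable_cong_sets[OF sets_scale_measure refl, of "ennreal r" N borel]
    by (auto dest: borel_measurable_integrable)
  then show ?thesis by (simp add: not_integrable_integral_eq)
qed

lemma set_integral_ext_measure:
  assumes "vague_test f" "sets N = sets borel" "r \<ge> 0"
  shows "set_lebesgue_integral (ext_measure (scale_measure (ennreal r) N)) ext_punctured f
    = r * integral\<^sup>L N (pull_test f)"
proof -
  have m: "ext_embed \<in> measurable (scale_measure (ennreal r) N) borel"
    using assms(2) by (subst measurable_cong_sets[OF sets_scale_measure refl])
      (subst measurable_cong_sets[OF assms(2) refl], simp)
  have f: "(\<lambda>z. indicator ext_punctured z *\<^sub>R f z) \<in> borel_measurable borel"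
    using assms by (intro borel_measurable_continuous_on_indicator) (auto simp: vague_test_def)
  show ?thesis unfolding set_lebesgue_integral_def ext_measure_def
    by (subst integral_distr[OF m f])
       (subst integral_scale_measure[OF assms(3)], simp add: pull_test_def[abs_def])
qed

text \<open>
  The measures \<open>ext_measure \<nu>\<close> do not charge the sphere at infinity, so vague convergence can be
  handled with pulled back test functions alone.
\<close>

lemma vague_conv_on_ext_iff:
  assumes "\<And>n. sets (N n) = sets borel" "\<And>n. r n \<ge> 0" "sets N0 = sets borel" "r0 \<ge> 0"
  shows "vague_conv_on ext_punctured (\<lambda>n. ext_measure (scale_measure (ennreal (r n)) (N n)))
      (ext_measure (scale_measure (ennreal r0) N0)) \<longleftrightarrow>
    (\<forall>f. vague_test f \<longrightarrow>
       (\<lambda>n. r n * integral\<^sup>L (N n) (pull_test f)) \<longlonglongrightarrow> r0 * integral\<^sup>L N0 (pull_test f))"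
  unfolding vague_conv_on_def vague_test_def[symmetric]
  by (auto simp: set_integral_ext_measure assms)

text \<open>
  Extended by 0 at the origin, a test function is continuous on the compact unit ball, hence
  bounded and uniformly continuous there; its support stays away from the origin. These three
  properties are all that the limit theorem uses about test functions.
\<close>

lemma vague_test_properties:
  assumes "vague_test (f :: 'a::euclidean_space \<Rightarrow> real)"
  obtains K \<delta> where "K > 0" "\<delta> > 0" "\<And>x. \<bar>pull_test f x\<bar> \<le> K"
    "\<And>x. norm x \<le> \<delta> \<Longrightarrow> pull_test f x = 0"
    "\<And>e. e > 0 \<Longrightarrow> \<exists>d>0. \<forall>x y. dist (ext_embed x) (ext_embed y) \<le> d \<longrightarrow>
        \<bar>pull_test f x - pull_test f y\<bar> \<le> e"
proof -
  obtain C where C: "compact C" "C \<subseteq> ext_punctured" "\<And>x. x \<in> ext_punctured - C \<Longrightarrow> f x = 0"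
    and cont: "continuous_on ext_punctured f"
    using assms by (auto simp: vague_test_def)
  define f0 where "f0 z = (if z \<in> ext_punctured then f z else 0)" for z
  have pull: "pull_test f x = f0 (ext_embed x)" for x
    by (simp add: pull_test_def f0_def)
  have cont0: "continuous_on (cball 0 1) f0"
  proof -
    have "continuous_on (cball 0 1 - {0}) f0"
      using cont by (subst continuous_on_cong[OF refl, of _ _ f])
        (auto simp: f0_def ext_punctured_def)
    moreover have "continuous_on (cball 0 1 - C) f0"
      using C(3) by (subst continuous_on_cong[OF refl, of _ _ "\<lambda>_. 0"]) (auto simp: f0_def)
    moreover have "cball 0 1 = (cball 0 1 - {0}) \<union> (cball (0::'a) 1 - C)"
      using C(2) by (auto simp: ext_punctured_def)
    moreover have "openin (top_of_set (cball 0 1)) (cball 0 1 - {0::'a})"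
      by (metis Diff_Diff_Int Diff_subset closed_singleton Int_commute open_Compl openin_open_Int Diff_eq)
    moreover have "openin (top_of_set (cball 0 1)) (cball 0 1 - C)"
      by (metis C(1) compact_imp_closed open_Compl openin_open_Int Diff_eq)
    ultimately show ?thesis
      by (metis continuous_on_Un_local_open)
  qed
  have in_cball: "ext_embed x \<in> cball 0 1" for x :: 'a
    by (simp add: norm_ext_embed add_pos_nonneg)
  have unif: "uniformly_continuous_on (cball 0 1) f0"
    by (intro compact_uniformly_continuous cont0) auto
  obtain K where K: "K > 0" "\<And>z. z \<in> cball 0 1 \<Longrightarrow> norm (f0 z) \<le> K"
    using compact_imp_bounded[OF compact_continuous_image[OF cont0]]
    by (auto simp: bounded_pos)
  have "open (- C)" "0 \<in> - C" using C by (auto simp: compact_imp_closed ext_punctured_def)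
  then obtain \<delta> where \<delta>: "\<delta> > 0" "cball 0 \<delta> \<subseteq> - C"
    by (meson open_contains_cball)
  have zero: "pull_test f x = 0" if "norm x \<le> \<delta>" for x
  proof -
    have "norm (ext_embed x) \<le> norm x"
      using divide_left_mono[of 1 "1 + norm x" "norm x"] by (simp add: norm_ext_embed add_pos_nonneg)
    then have "ext_embed x \<in> cball 0 \<delta>" using that by simp
    then have "ext_embed x \<notin> C" using \<delta>(2) by blast
    then show ?thesis using C(3) by (auto simp: pull f0_def)
  qed
  show thesis
  proof (rule that[of K \<delta>])
    show "\<exists>d>0. \<forall>x y. dist (ext_embed x) (ext_embed y) \<le> d \<longrightarrow>
        \<bar>pull_test f x - pull_test f y\<bar> \<le> e" if e: "e > 0" for e
    proof -
      obtain d where d: "d > 0" "\<And>x x'. x\<in>cball 0 1 \<Longrightarrow> x'\<in>cball 0 1 \<Longrightarrow> dist x' x < d \<Longrightarrow> dist (f0 x') (f0 x) < e"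
        using unif e unfolding uniformly_continuous_on_def by metis
      show ?thesis
      proof (intro exI[of _ "d/2"] conjI allI impI)
        fix x y :: 'a assume "dist (ext_embed x) (ext_embed y) \<le> d / 2"
        then have "dist (f0 (ext_embed x)) (f0 (ext_embed y)) < e"
          using d in_cball by (intro d(2)) auto
        then show "\<bar>pull_test f x - pull_test f y\<bar> \<le> e" by (simp add: pull dist_real_def)
      qed (use d in simp)
    qed
  qed (use K \<delta> zero in_cball in \<open>auto simp: pull\<close>)
qed

text \<open>
  Radial cutoff functions sandwich the indicators of complements of balls and turn vague
  convergence into convergence of tails.
\<close>

lemma radial_cutoff_exists:
  assumes "0 < t" "t < t'"
  obtains f :: "'a::euclidean_space \<Rightarrow> real" where "vague_test f"
    "\<And>x. norm x > t' \<Longrightarrow> pull_test f x = 1"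
    "\<And>x. norm x \<le> t \<Longrightarrow> pull_test f x = 0"
    "\<And>x. 0 \<le> pull_test f x \<and> pull_test f x \<le> 1"
proof -
  define e where "e r = r / (1 + r)" for r :: real
  have e_mono: "e r \<le> e r' \<longleftrightarrow> r \<le> r'" if "r \<ge> 0" "r' \<ge> 0" for r r'
    using that by (simp add: e_def divide_simps) (auto simp: algebra_simps)
  have e_strict: "e t < e t'" using e_mono[of t' t] assms by linarith
  have et: "e t > 0" using assms by (simp add: e_def)
  define f where "f z = max 0 (min 1 ((norm z - e t) / (e t' - e t)))" for z :: 'a
  have c: "continuous_on A f" for A unfolding f_def[abs_def]
    using e_strict by (intro continuous_intros) auto
  have z: "f z = 0" if "norm z \<le> e t" for z
    using that e_strict by (auto simp: f_def max_def min_def divide_simps)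
  have o: "f z = 1" if "norm z \<ge> e t'" for z
    using that e_strict by (auto simp: f_def max_def min_def divide_simps)
  have "compact (cball 0 1 - ball (0::'a) (e t))"
    by (intro compact_diff) auto
  moreover have "cball 0 1 - ball (0::'a) (e t) \<subseteq> ext_punctured"
    using et by (auto simp: ext_punctured_def)
  moreover have "\<forall>x\<in>ext_punctured - (cball 0 1 - ball (0::'a) (e t)). f x = 0"
    using z by (auto simp: ext_punctured_def)
  ultimately have v: "vague_test f"
    using c unfolding vague_test_def by blast
  have pull: "pull_test f x = (if x = 0 then 0 else f (ext_embed x))" for x
    using ext_embed_in_ext_punctured_iff[of x] by (auto simp: pull_test_def)
  have n: "norm (ext_embed x) = e (norm x)" for x :: 'a
    by (simp add: norm_ext_embed e_def)
  show thesis
  proof (rule that[OF v])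
    show "pull_test f x = 1" if "norm x > t'" for x
      using that assms o[of "ext_embed x"] e_mono[of t' "norm x"] by (auto simp: pull n)
    show "pull_test f x = 0" if "norm x \<le> t" for x
      using that assms z[of "ext_embed x"] e_mono[of "norm x" t] by (auto simp: pull n)
    show "0 \<le> pull_test f x \<and> pull_test f x \<le> 1" for x
      by (auto simp: pull f_def)
  qed
qed

section \<open>Tails of the norm of a random vector\<close>

lemma (in prob_space) norm_tail_eq_cdf:
  assumes [measurable]: "H \<in> borel_measurable M"
  shows "norm_tail M H x = 1 - cdf (distr M borel (\<lambda>\<omega>. norm (H \<omega>))) x"
proof -
  have "cdf (distr M borel (\<lambda>\<omega>. norm (H \<omega>))) x = prob {\<omega> \<in> space M. norm (H \<omega>) \<le> x}"
    unfolding cdf_def by (subst measure_distr) (auto intro!: arg_cong[where f = prob])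
  also have "\<dots> = 1 - norm_tail M H x"
  proof -
    have "{\<omega> \<in> space M. norm (H \<omega>) \<le> x} = space M - {\<omega> \<in> space M. norm (H \<omega>) > x}" by auto
    then show ?thesis unfolding norm_tail_def by (simp add: prob_compl)
  qed
  finally show ?thesis by simp
qed

lemma (in prob_space) norm_tail_tendsto_0:
  assumes "H \<in> borel_measurable M"
  shows "(norm_tail M H \<longlongrightarrow> 0) at_top"
proof -
  interpret R: real_distribution "distr M borel (\<lambda>\<omega>. norm (H \<omega>))"
    using assms by (intro real_distribution_distr) auto
  show ?thesis unfolding norm_tail_eq_cdf[OF assms, abs_def]
    using tendsto_diff[OF tendsto_const R.cdf_lim_at_top_prob, of 1] by simp
qed

lemma (in prob_space) norm_tail_antimono:
  assumes [measurable]: "H \<in> borel_measurable M" and "x \<le> y"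
  shows "norm_tail M H y \<le> norm_tail M H x"
  unfolding norm_tail_def using assms(2) by (intro finite_measure_mono) auto

lemma (in prob_space) norm_tail_eq_expectation:
  assumes [measurable]: "H \<in> borel_measurable M"
  shows "norm_tail M H x = expectation (\<lambda>\<omega>. if norm (H \<omega>) > x then 1 else 0)"
proof -
  have "norm_tail M H x = expectation (indicator {\<omega> \<in> space M. norm (H \<omega>) > x})"
    by (simp add: norm_tail_def)
  also have "\<dots> = expectation (\<lambda>\<omega>. if norm (H \<omega>) > x then 1 else 0)"
    by (intro Bochner_Integration.integral_cong) (auto simp: indicator_def)
  finally show ?thesis .
qed

section \<open>Truncated moments of a regularly varying vector\<close>

text \<open>
  A regularly varying function is controlled through its behaviour under doubling; this
  induction replaces the integral representations that are customary for such functions.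
\<close>

lemma dyadic_induct [consumes 2, case_names base double]:
  fixes x x0 :: real
  assumes "x0 > 0" "x \<ge> x0"
    and base: "\<And>y. x0 \<le> y \<Longrightarrow> y < 2 * x0 \<Longrightarrow> Q y"
    and double: "\<And>y. x0 \<le> y \<Longrightarrow> Q y \<Longrightarrow> Q (2 * y)"
  shows "Q x"
proof -
  have *: "\<forall>x\<ge>x0. x < 2 ^ k * x0 \<longrightarrow> Q x" for k
  proof (induction k)
    case (Suc k)
    show ?case
    proof (intro allI impI)
      fix x assume x: "x \<ge> x0" "x < 2 ^ Suc k * x0"
      show "Q x"
      proof (cases "x < 2 * x0")
        case False
        then have "Q (x / 2)" using Suc x by auto
        then show ?thesis using double[of "x / 2"] False by simp
      qed (use base x in auto)
    qed
  qed auto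
  obtain k where "x / x0 < 2 ^ k" using real_arch_pow[of 2 "x / x0"] by auto
  then have "x < 2 ^ k * x0" using assms(1) by (simp add: field_simps)
  then show ?thesis using * assms(2) by blast
qed

lemma eventually_at_top_ge_pos:
  assumes "\<forall>\<^sub>F x in at_top. Q (x::real)"
  obtains x0 where "x0 > 0" "\<And>x. x \<ge> x0 \<Longrightarrow> Q x"
proof -
  obtain N where "\<forall>x\<ge>N. Q x" using assms by (auto simp: eventually_at_top_linorder)
  then show thesis using that[of "max N 1"] by auto
qed

locale regvar_vector = prob_space P
  for P :: "'w measure" +
  fixes H :: "'w \<Rightarrow> 'a::euclidean_space" and \<alpha> :: real
  assumes H_meas [measurable]: "H \<in> borel_measurable P"
    and alpha_pos: "\<alpha> > 0"
    and tail_pos: "norm_tail P H x > 0"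
    and tail_regvar: "s > 0 \<Longrightarrow>
      ((\<lambda>x. norm_tail P H (s * x) / norm_tail P H x) \<longlongrightarrow> s powr (- \<alpha>)) at_top"
begin

abbreviation F :: "real \<Rightarrow> real" where "F \<equiv> norm_tail P H"

definition low_moment :: "real \<Rightarrow> real \<Rightarrow> real" where
  "low_moment \<beta> x = expectation (\<lambda>\<omega>. if norm (H \<omega>) \<le> x then norm (H \<omega>) powr \<beta> else 0)"

definition high_moment :: "real \<Rightarrow> real \<Rightarrow> real" where
  "high_moment \<beta> x = expectation (\<lambda>\<omega>. if norm (H \<omega>) > x then norm (H \<omega>) powr \<beta> else 0)"

lemmas tail_eq_expectation = norm_tail_eq_expectation[OF H_meas]

lemma integrable_tail: "integrable P (\<lambda>\<omega>. if norm (H \<omega>) > x then c else (0::real))"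
  by (rule integrable_const_bound[of _ "\<bar>c\<bar>"]) auto

lemma integrable_low:
  assumes "\<beta> \<ge> 0"
  shows "integrable P (\<lambda>\<omega>. if norm (H \<omega>) \<le> x then norm (H \<omega>) powr \<beta> else 0)"
  using assms by (intro integrable_const_bound[of _ "x powr \<beta>"]) (auto intro!: powr_mono2)

lemma eventually_double_ge:
  assumes "r < 2 powr (- \<alpha>)"
  shows "\<forall>\<^sub>F x in at_top. r * F x \<le> F (2 * x)"
proof -
  have "((\<lambda>x. F (2 * x) / F x) \<longlongrightarrow> 2 powr (- \<alpha>)) at_top" by (rule tail_regvar) simp
  from order_tendstoD(1)[OF this assms] show ?thesis
    by eventually_elim (use tail_pos in \<open>auto simp: field_simps less_imp_le\<close>)
qed

lemma eventually_double_le: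
  assumes "r > 2 powr (- \<alpha>)"
  shows "\<forall>\<^sub>F x in at_top. F (2 * x) \<le> r * F x"
proof -
  have "((\<lambda>x. F (2 * x) / F x) \<longlongrightarrow> 2 powr (- \<alpha>)) at_top" by (rule tail_regvar) simp
  from order_tendstoD(2)[OF this assms] show ?thesis
    by eventually_elim (use tail_pos in \<open>auto simp: field_simps less_imp_le\<close>)
qed

text \<open>
  For \<open>r = 2 powr (- \<beta>)\<close>, which is below the limit ratio \<open>2 powr (- \<alpha>)\<close>, doubling the argument
  eventually multiplies \<open>F\<close> by at least \<open>r\<close>, while it multiplies \<open>x powr (- \<beta>)\<close> by exactly \<open>r\<close>.
\<close>

lemma tail_lower_bound:
  assumes "\<beta> > \<alpha>"
  shows "\<exists>C>0. \<forall>\<^sub>F x in at_top. C * x powr (- \<beta>) \<le> F x"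
proof -
  have "2 powr (- \<beta>) < 2 powr (- \<alpha>)" using assms by simp
  from eventually_at_top_ge_pos[OF eventually_double_ge[OF this]]
  obtain x0 where x0: "x0 > 0" "\<And>x. x \<ge> x0 \<Longrightarrow> 2 powr (- \<beta>) * F x \<le> F (2 * x)" by blast
  define C where "C = F (2 * x0) * x0 powr \<beta>"
  have "C * x powr (- \<beta>) \<le> F x" if "x \<ge> x0" for x
    using x0(1) that
  proof (induction rule: dyadic_induct)
    case (base y)
    have "y powr (- \<beta>) \<le> x0 powr (- \<beta>)" using base x0 assms alpha_pos by (intro powr_mono2') auto
    then have "C * y powr (- \<beta>) \<le> C * x0 powr (- \<beta>)"
      using tail_pos[of "2 * x0"] by (intro mult_left_mono) (auto simp: C_def)
    also have "\<dots> = F (2 * x0)" using x0 by (simp add: C_def powr_minus)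
    also have "\<dots> \<le> F y" using base by (intro norm_tail_antimono) auto
    finally show ?case .
  next
    case (double y)
    have "C * (2 * y) powr (- \<beta>) = 2 powr (- \<beta>) * (C * y powr (- \<beta>))"
      using double x0 by (simp add: powr_mult)
    also have "\<dots> \<le> 2 powr (- \<beta>) * F y" using double by (intro mult_left_mono) auto
    also have "\<dots> \<le> F (2 * y)" using double x0 by auto
    finally show ?case .
  qed
  moreover have "C > 0" using tail_pos[of "2 * x0"] x0 by (simp add: C_def)
  ultimately show ?thesis by (auto simp: eventually_at_top_linorder)
qed

text \<open>
  Karamata's bound above the critical exponent. Doubling \<open>x\<close> adds at most \<open>(2 * x) powr \<beta> * F x\<close>
  to the left side, while the right side grows by a factor of at least some \<open>q > 1\<close>; the
  inequality therefore reproduces itself once \<open>C * (q - 1) \<ge> 2 powr \<beta>\<close>.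
\<close>

lemma low_moment_bound:
  assumes "\<beta> > \<alpha>"
  shows "\<exists>C\<ge>0. \<forall>\<^sub>F x in at_top. low_moment \<beta> x \<le> C * (x powr \<beta> * F x)"
proof -
  have bpos: "\<beta> > 0" using assms alpha_pos by simp
  define r where "r = 2 powr (- (\<alpha> + \<beta>) / 2)"
  have "r < 2 powr (- \<alpha>)" unfolding r_def using assms by simp
  from eventually_at_top_ge_pos[OF eventually_double_ge[OF this]]
  obtain x0 where x0: "x0 > 0" "\<And>x. x \<ge> x0 \<Longrightarrow> r * F x \<le> F (2 * x)" by blast
  define q where "q = 2 powr \<beta> * r"
  have q1: "q > 1" using assms by (simp add: q_def r_def powr_add[symmetric] field_simps)
  \<comment> \<open>a lower bound for \<open>x powr \<beta> * F x\<close> on the initial dyadic interval\<close>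
  define D where "D = x0 powr \<beta> * F (2 * x0)"
  have D: "D > 0" using x0 tail_pos by (simp add: D_def)
  define C where "C = max (low_moment \<beta> (2 * x0) / D) (2 powr \<beta> / (q - 1))"
  have C: "C \<ge> 0" "low_moment \<beta> (2 * x0) \<le> C * D" "2 powr \<beta> \<le> C * (q - 1)"
  proof -
    have "low_moment \<beta> (2 * x0) / D \<le> C" "2 powr \<beta> / (q - 1) \<le> C" by (auto simp: C_def)
    then show "low_moment \<beta> (2 * x0) \<le> C * D" "2 powr \<beta> \<le> C * (q - 1)"
      using D q1 by (auto simp: field_simps)
    have "0 \<le> 2 powr \<beta> / (q - 1)" using q1 by simp
    then show "C \<ge> 0" unfolding C_def by (rule max.coboundedI2)
  qed
  have "low_moment \<beta> x \<le> C * (x powr \<beta> * F x)" if "x \<ge> x0" for x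
    using x0(1) that
  proof (induction rule: dyadic_induct)
    case (base y)
    have "low_moment \<beta> y \<le> low_moment \<beta> (2 * x0)"
      unfolding low_moment_def using base bpos by (intro integral_mono integrable_low) auto
    also have "\<dots> \<le> C * D" by (rule C)
    also have "D \<le> y powr \<beta> * F y"
      unfolding D_def using base x0 bpos tail_pos[of "2 * x0"]
      by (intro mult_mono powr_mono2 norm_tail_antimono) auto
    finally show ?case using C(1) by (simp add: mult_left_mono)
  next
    case (double y)
    have y: "y > 0" using double x0 by simp
    have "low_moment \<beta> (2 * y) \<le> expectation (\<lambda>\<omega>. (if norm (H \<omega>) \<le> y then norm (H \<omega>) powr \<beta> else 0)
        + (if norm (H \<omega>) > y then (2 * y) powr \<beta> else 0))"
      unfolding low_moment_def using bpos y
      by (intro integral_mono integrable_low Bochner_Integration.integrable_add integrable_tail)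
         (auto intro!: powr_mono2)
    also have "\<dots> = low_moment \<beta> y + (2 * y) powr \<beta> * F y"
    proof -
      have "expectation (\<lambda>\<omega>. if norm (H \<omega>) > y then (2 * y) powr \<beta> else 0)
          = expectation (\<lambda>\<omega>. (2 * y) powr \<beta> * (if norm (H \<omega>) > y then 1 else 0))"
        by (intro Bochner_Integration.integral_cong) auto
      also have "\<dots> = (2 * y) powr \<beta> * F y" by (simp add: tail_eq_expectation)
      finally show ?thesis unfolding low_moment_def using bpos
        by (subst Bochner_Integration.integral_add) (auto intro!: integrable_low integrable_tail)
    qed
    also have "\<dots> \<le> C * (y powr \<beta> * F y) + 2 powr \<beta> * (y powr \<beta> * F y)"
      using double y by (simp add: powr_mult)
    also have "\<dots> = (C + 2 powr \<beta>) * (y powr \<beta> * F y)" by (simp add: algebra_simps)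
    also have "\<dots> \<le> (C * q) * (y powr \<beta> * F y)"
      using C(3) tail_pos[of y] by (intro mult_right_mono) (auto simp: algebra_simps)
    also have "\<dots> = C * ((2 * y) powr \<beta> * (r * F y))"
      using y by (simp add: q_def powr_mult)
    also have "\<dots> \<le> C * ((2 * y) powr \<beta> * F (2 * y))"
      using C(1) x0(2) double by (intro mult_left_mono) auto
    finally show ?case .
  qed
  then show ?thesis using C(1) by (auto simp: eventually_at_top_linorder)
qed

text \<open>
  Karamata's bound below the critical exponent. The bound for the contribution of a dyadic shell
  is smaller than that for the preceding one by a factor \<open>q < 1\<close>. The induction on the number of
  shells avoids the geometric series, and monotone convergence removes the cap \<open>2 ^ k * x\<close>.
\<close>

lemma high_moment_bound:
  assumes "0 \<le> \<beta>" "\<beta> < \<alpha>"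
  shows "\<exists>C\<ge>0. \<forall>\<^sub>F x in at_top.
    integrable P (\<lambda>\<omega>. if norm (H \<omega>) > x then norm (H \<omega>) powr \<beta> else 0) \<and>
    high_moment \<beta> x \<le> C * (x powr \<beta> * F x)"
proof -
  define r where "r = 2 powr (- (\<alpha> + \<beta>) / 2)"
  have "r > 2 powr (- \<alpha>)" unfolding r_def using assms by simp
  from eventually_at_top_ge_pos[OF eventually_double_le[OF this]]
  obtain x0 where x0: "x0 > 0" "\<And>x. x \<ge> x0 \<Longrightarrow> F (2 * x) \<le> r * F x" by blast
  define q where "q = 2 powr \<beta> * r"
  have q1: "q < 1" using assms by (simp add: q_def r_def powr_add[symmetric] powr_less_one field_simps)
  define C where "C = 2 powr \<beta> / (1 - q)"
  have C: "C \<ge> 0" "2 powr \<beta> + C * q = C"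
    using q1 by (auto simp: C_def field_simps)
  \<comment> \<open>the contribution of the first \<open>k\<close> dyadic shells above \<open>x\<close>\<close>
  define f where "f k x \<omega> = (if x < norm (H \<omega>) \<and> norm (H \<omega>) \<le> 2 ^ k * x then norm (H \<omega>) powr \<beta> else 0)"
    for k :: nat and x \<omega>
  have f_meas [measurable]: "f k x \<in> borel_measurable P" for k x
    unfolding f_def by measurable
  have f_int: "integrable P (f k x)" for k x
    using assms(1) by (intro integrable_const_bound[of _ "(2 ^ k * x) powr \<beta>"])
      (auto simp: f_def intro!: powr_mono2)
  have bound: "expectation (f k x) \<le> C * (x powr \<beta> * F x)" if "x \<ge> x0" for k x
    using that
  proof (induction k arbitrary: x)
    case 0
    have "f 0 x = (\<lambda>_. 0)" by (rule ext) (auto simp: f_def)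
    then show ?case using C(1) tail_pos[of x] by simp
  next
    case (Suc k)
    have x: "x > 0" using Suc x0 by simp
    have "expectation (f (Suc k) x) \<le>
        expectation (\<lambda>\<omega>. (if norm (H \<omega>) > x then (2 * x) powr \<beta> else 0) + f k (2 * x) \<omega>)"
      using assms(1) x
      by (intro integral_mono f_int Bochner_Integration.integrable_add integrable_tail)
         (auto simp: f_def mult_ac intro!: powr_mono2)
    also have "\<dots> = (2 * x) powr \<beta> * F x + expectation (f k (2 * x))"
    proof -
      have "expectation (\<lambda>\<omega>. if norm (H \<omega>) > x then (2 * x) powr \<beta> else 0)
          = expectation (\<lambda>\<omega>. (2 * x) powr \<beta> * (if norm (H \<omega>) > x then 1 else 0))"
        by (intro Bochner_Integration.integral_cong) auto
      also have "\<dots> = (2 * x) powr \<beta> * F x" by (simp add: tail_eq_expectation)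
      finally show ?thesis
        by (subst Bochner_Integration.integral_add) (auto intro!: f_int integrable_tail)
    qed
    also have "\<dots> \<le> 2 powr \<beta> * (x powr \<beta> * F x) + C * ((2 * x) powr \<beta> * F (2 * x))"
      using Suc.IH[of "2 * x"] Suc.prems x by (simp add: powr_mult)
    also have "\<dots> \<le> 2 powr \<beta> * (x powr \<beta> * F x) + C * ((2 * x) powr \<beta> * (r * F x))"
      using C(1) x0(2) Suc.prems by (intro add_left_mono mult_left_mono) auto
    also have "\<dots> = (2 powr \<beta> + C * q) * (x powr \<beta> * F x)"
      using x by (simp add: q_def powr_mult algebra_simps)
    finally show ?case using C(2) by simp
  qed
  have "integrable P (\<lambda>\<omega>. if norm (H \<omega>) > x then norm (H \<omega>) powr \<beta> else 0) \<and>
    high_moment \<beta> x \<le> C * (x powr \<beta> * F x)" if x: "x \<ge> x0" for x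
  proof -
    have xpos: "x > 0" using x x0 by simp
    have mono: "f i x \<omega> \<le> f j x \<omega>" if "i \<le> j" for i j \<omega>
    proof -
      have "2 ^ i * x \<le> 2 ^ j * x" using that xpos by (simp add: power_increasing)
      then show ?thesis by (auto simp: f_def)
    qed
    have lim: "(\<lambda>k. f k x \<omega>) \<longlonglongrightarrow> (if norm (H \<omega>) > x then norm (H \<omega>) powr \<beta> else 0)" for \<omega>
    proof -
      obtain k where "norm (H \<omega>) / x < 2 ^ k" using real_arch_pow[of 2] by auto
      then have "norm (H \<omega>) \<le> 2 ^ k * x" using xpos by (simp add: field_simps)
      moreover have "2 ^ k * x \<le> 2 ^ j * x" if "j \<ge> k" for j using that xpos by (simp add: power_increasing)
      ultimately have "f j x \<omega> = (if norm (H \<omega>) > x then norm (H \<omega>) powr \<beta> else 0)" if "j \<ge> k" for j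
        using that by (force simp: f_def)
      then show ?thesis
        by (intro tendsto_eventually eventually_sequentiallyI[of k]) auto
    qed
    have inc: "incseq (\<lambda>k. expectation (f k x))"
      by (intro incseq_SucI integral_mono f_int mono) auto
    obtain l where l: "(\<lambda>k. expectation (f k x)) \<longlonglongrightarrow> l"
      using incseq_convergent[OF inc] bound[OF x] by blast
    have "integrable P (\<lambda>\<omega>. if norm (H \<omega>) > x then norm (H \<omega>) powr \<beta> else 0)"
      by (rule integrable_monotone_convergence[where f = "\<lambda>k. f k x", OF f_int _ AE_I2[OF lim] l])
         (auto intro!: AE_I2 monoI mono)
    moreover have "high_moment \<beta> x = l" unfolding high_moment_def
      by (rule integral_monotone_convergence[where f = "\<lambda>k. f k x", OF f_int _ AE_I2[OF lim] l])
         (auto intro!: AE_I2 monoI mono)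
    moreover have "l \<le> C * (x powr \<beta> * F x)"
      using bound[OF x] by (intro LIMSEQ_le_const2[OF l]) auto
    ultimately show ?thesis by simp
  qed
  then show ?thesis using C(1) by (auto simp: eventually_at_top_linorder)
qed

lemma integrable_moment:
  assumes "0 \<le> \<beta>" "\<beta> < \<alpha>"
  shows "integrable P (\<lambda>\<omega>. norm (H \<omega>) powr \<beta>)"
proof -
  obtain x where x: "integrable P (\<lambda>\<omega>. if norm (H \<omega>) > x then norm (H \<omega>) powr \<beta> else 0)"
    using high_moment_bound[OF assms] by (auto simp: eventually_at_top_linorder)
  have "integrable P (\<lambda>\<omega>. (if norm (H \<omega>) \<le> x then norm (H \<omega>) powr \<beta> else 0) +
      (if norm (H \<omega>) > x then norm (H \<omega>) powr \<beta> else 0))"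
    using assms(1) by (intro Bochner_Integration.integrable_add integrable_low x)
  then show ?thesis by (rule Bochner_Integration.integrable_cong[THEN iffD1, rotated -1]) auto
qed

lemma low_moment_le_moment:
  assumes "0 \<le> \<beta>" "\<beta> < \<alpha>"
  shows "low_moment \<beta> x \<le> expectation (\<lambda>\<omega>. norm (H \<omega>) powr \<beta>)"
  unfolding low_moment_def using assms
  by (intro integral_mono integrable_low integrable_moment) auto

text \<open>
  Used at the critical exponent \<open>\<beta>' = \<alpha>\<close>, where the moment itself may be infinite but its
  truncation grows more slowly than any power.
\<close>

lemma low_moment_interpolate:
  assumes "0 \<le> \<beta>" "\<beta> \<le> \<beta>'" "\<beta> < \<alpha>" "x \<ge> 0"
  shows "low_moment \<beta>' x \<le> x powr (\<beta>' - \<beta>) * expectation (\<lambda>\<omega>. norm (H \<omega>) powr \<beta>)"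
proof -
  have "low_moment \<beta>' x \<le> expectation (\<lambda>\<omega>. x powr (\<beta>' - \<beta>) * norm (H \<omega>) powr \<beta>)"
    unfolding low_moment_def
  proof (intro integral_mono integrable_low integrable_mult_right integrable_moment)
    fix \<omega>
    have "norm (H \<omega>) powr \<beta>' = norm (H \<omega>) powr (\<beta>' - \<beta>) * norm (H \<omega>) powr \<beta>"
      by (simp add: powr_add[symmetric])
    moreover have "norm (H \<omega>) powr (\<beta>' - \<beta>) \<le> x powr (\<beta>' - \<beta>)" if "norm (H \<omega>) \<le> x"
      using that assms by (intro powr_mono2) auto
    ultimately show "(if norm (H \<omega>) \<le> x then norm (H \<omega>) powr \<beta>' else 0) \<le>
        x powr (\<beta>' - \<beta>) * norm (H \<omega>) powr \<beta>" by (auto intro: mult_right_mono)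
  qed (use assms in auto)
  then show ?thesis by simp
qed

lemma tail_markov:
  assumes "0 \<le> \<beta>" "\<beta> < \<alpha>" "x > 0"
  shows "F x \<le> expectation (\<lambda>\<omega>. norm (H \<omega>) powr \<beta>) * x powr (- \<beta>)"
proof -
  have "x powr \<beta> * F x = expectation (\<lambda>\<omega>. x powr \<beta> * (if norm (H \<omega>) > x then 1 else 0))"
    by (simp add: tail_eq_expectation)
  also have "\<dots> \<le> expectation (\<lambda>\<omega>. norm (H \<omega>) powr \<beta>)"
    using assms by (intro integral_mono integrable_moment integrable_mult_right integrable_tail)
      (auto intro!: powr_mono2)
  finally show ?thesis using assms(3) by (simp add: powr_minus field_simps)
qed

end

section \<open>Regular variation from vague convergence\<close>

text \<open>
  The hypothesis on \<open>H\<close> in terms of pulled back test functions. The number \<open>c\<close> is the mass of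
  \<open>\<mu>\<close> outside the unit ball, so that \<open>mu_tail\<close> expresses the homogeneity of \<open>\<mu>\<close> on complements
  of balls.
\<close>

locale vague_regvar = prob_space P
  for P :: "'w measure" +
  fixes H :: "'w \<Rightarrow> 'a::euclidean_space" and \<mu> :: "'a measure" and \<alpha> c :: real
    and a :: "nat \<Rightarrow> real"
  assumes H_meas [measurable]: "H \<in> borel_measurable P"
    and mu_sets [measurable_cong]: "sets \<mu> = sets borel"
    and alpha_pos: "\<alpha> > 0" and c_pos: "c > 0"
    and mu_tail: "t > 0 \<Longrightarrow> emeasure \<mu> {x. norm x > t} = ennreal (c * t powr (- \<alpha>))"
    and a_lim: "filterlim a at_top sequentially"
    and vague: "vague_test f \<Longrightarrow>
      (\<lambda>n. real n * expectation (\<lambda>\<omega>. pull_test f (inverse (a n) *\<^sub>R H \<omega>)))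
        \<longlonglongrightarrow> integral\<^sup>L \<mu> (pull_test f)"
begin

abbreviation F :: "real \<Rightarrow> real" where "F \<equiv> norm_tail P H"

lemma F_nonneg: "F x \<ge> 0" by (simp add: norm_tail_def)

lemmas F_eq_expectation = norm_tail_eq_expectation[OF H_meas]

lemma integrable_pull:
  assumes "vague_test f"
  shows "integrable P (\<lambda>\<omega>. pull_test f (r *\<^sub>R H \<omega>))"
proof -
  obtain K where "\<And>x. \<bar>pull_test f x\<bar> \<le> K"
    by (rule vague_test_properties[OF assms]) auto
  note [measurable] = measurable_pull_test[OF assms]
  from \<open>\<And>x. \<bar>pull_test f x\<bar> \<le> K\<close> show ?thesis by (intro integrable_const_bound[of _ K]) auto
qed

lemma mu_set_integrable:
  assumes "t > 0"
  shows "integrable \<mu> (\<lambda>x. if norm x > t then k else (0::real))"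
    "integral\<^sup>L \<mu> (\<lambda>x. if norm x > t then 1 else (0::real)) = c * t powr (- \<alpha>)"
proof -
  have s: "{x. norm x > t} \<in> sets \<mu>" by (simp add: mu_sets)
  have e: "(\<lambda>x. if norm x > t then k else (0::real)) = (\<lambda>x. k * indicator {x. norm x > t} x)" for k
    by (auto simp: indicator_def)
  show "integrable \<mu> (\<lambda>x. if norm x > t then k else (0::real))"
    unfolding e using s mu_tail[OF assms] by (intro integrable_mult_right integrable_real_indicator) auto
  show "integral\<^sup>L \<mu> (\<lambda>x. if norm x > t then 1 else (0::real)) = c * t powr (- \<alpha>)"
    unfolding e using s mu_tail[OF assms] c_pos sets.sets_into_space[OF s]
    by (simp add: measure_def Int_absorb2)
qed

text \<open>
  Continuity of the tail of \<open>\<mu>\<close> in the radius, in the form in which the sandwich by cutoff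
  functions needs it.
\<close>

lemma powr_between:
  assumes "t > 0"
  shows "l < c * t powr (- \<alpha>) \<Longrightarrow> \<exists>t'>t. l < c * t' powr (- \<alpha>)"
    and "l > c * t powr (- \<alpha>) \<Longrightarrow> \<exists>t'>0. t' < t \<and> l > c * t' powr (- \<alpha>)"
proof -
  have "isCont (\<lambda>t. c * t powr (- \<alpha>)) t" using assms by (intro continuous_intros) auto
  then have lim: "((\<lambda>t. c * t powr (- \<alpha>)) \<longlongrightarrow> c * t powr (- \<alpha>)) (at t)"
    by (simp add: isCont_def)
  {
    assume "l < c * t powr (- \<alpha>)"
    then have "\<forall>\<^sub>F t' in at_right t. l < c * t' powr (- \<alpha>)"
      using order_tendstoD(1)[OF lim] by (auto simp: eventually_at_split)
    then show "\<exists>t'>t. l < c * t' powr (- \<alpha>)"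
      by (metis (no_types, lifting) eventually_at_right_field gt_ex dense)
  next
    assume "l > c * t powr (- \<alpha>)"
    then have "\<forall>\<^sub>F t' in at_left t. l > c * t' powr (- \<alpha>)"
      using order_tendstoD(2)[OF lim] by (auto simp: eventually_at_split)
    then obtain b where b: "b < t" "\<And>y. b < y \<Longrightarrow> y < t \<Longrightarrow> l > c * y powr (- \<alpha>)"
      by (auto simp: eventually_at_left_field)
    obtain y where "max b 0 < y" "y < t" using b(1) assms dense[of "max b 0" t] by auto
    then show "\<exists>t'>0. t' < t \<and> l > c * t' powr (- \<alpha>)" using b(2) by auto
  }
qed

lemma a_pos: "\<forall>\<^sub>F n in sequentially. a n > 0"
  using a_lim by (auto simp: filterlim_at_top_dense)

text \<open>
  The tail of \<open>\<mu>\<close> is continuous in the radius, so indicators of complements of balls can be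
  sandwiched between radial cutoff functions.
\<close>

lemma tail_at_scale:
  assumes "t > 0"
  shows "(\<lambda>n. real n * F (t * a n)) \<longlonglongrightarrow> c * t powr (- \<alpha>)"
proof (rule order_tendstoI)
  fix l assume "l < c * t powr (- \<alpha>)"
  then obtain t' where t': "t' > t" "l < c * t' powr (- \<alpha>)" using powr_between(1) assms by blast
  obtain f :: "'a \<Rightarrow> real" where f: "vague_test f" "\<And>x. norm x > t' \<Longrightarrow> pull_test f x = 1"
    "\<And>x. norm x \<le> t \<Longrightarrow> pull_test f x = 0" "\<And>x. 0 \<le> pull_test f x \<and> pull_test f x \<le> 1"
    using radial_cutoff_exists[OF assms t'(1)] by blast
  note [measurable] = measurable_pull_test[OF f(1)]
  have "c * t' powr (- \<alpha>) = integral\<^sup>L \<mu> (\<lambda>x. if norm x > t' then 1 else (0::real))"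
    using mu_set_integrable t' assms by simp
  also have "\<dots> \<le> integral\<^sup>L \<mu> (pull_test f)"
  proof (intro integral_mono mu_set_integrable)
    show "integrable \<mu> (pull_test f)"
      by (rule Bochner_Integration.integrable_bound[OF mu_set_integrable(1)[OF assms, of 1]])
         (use f in \<open>auto simp: abs_le_iff\<close>)
  qed (use f t' assms in auto)
  finally have "l < integral\<^sup>L \<mu> (pull_test f)" using t' by simp
  from order_tendstoD(1)[OF vague[OF f(1)] this] a_pos
  show "\<forall>\<^sub>F n in sequentially. l < real n * F (t * a n)"
  proof eventually_elim
    case (elim n)
    have "expectation (\<lambda>\<omega>. pull_test f (inverse (a n) *\<^sub>R H \<omega>)) \<le>
        expectation (\<lambda>\<omega>. if norm (H \<omega>) > t * a n then 1 else 0)"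
    proof (intro integral_mono integrable_pull f)
      show "integrable P (\<lambda>\<omega>. if norm (H \<omega>) > t * a n then 1 else (0::real))"
        by (intro integrable_const_bound[of _ 1]) auto
      fix \<omega>
      show "pull_test f (inverse (a n) *\<^sub>R H \<omega>) \<le> (if norm (H \<omega>) > t * a n then 1 else 0)"
        using f(4)[of "inverse (a n) *\<^sub>R H \<omega>"] f(3)[of "inverse (a n) *\<^sub>R H \<omega>"] elim(2)
        by (auto simp: field_simps not_less)
    qed
    then have "real n * expectation (\<lambda>\<omega>. pull_test f (inverse (a n) *\<^sub>R H \<omega>)) \<le> real n * F (t * a n)"
      unfolding F_eq_expectation by (intro mult_left_mono) auto
    then show ?case using elim by simp
  qed
next
  fix l assume "l > c * t powr (- \<alpha>)"
  then obtain t' where t': "t' > 0" "t' < t" "l > c * t' powr (- \<alpha>)" using powr_between(2) assms by blast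
  obtain f :: "'a \<Rightarrow> real" where f: "vague_test f" "\<And>x. norm x > t \<Longrightarrow> pull_test f x = 1"
    "\<And>x. norm x \<le> t' \<Longrightarrow> pull_test f x = 0" "\<And>x. 0 \<le> pull_test f x \<and> pull_test f x \<le> 1"
    using radial_cutoff_exists[OF t'(1,2)] by blast
  note [measurable] = measurable_pull_test[OF f(1)]
  have "integral\<^sup>L \<mu> (pull_test f) \<le> integral\<^sup>L \<mu> (\<lambda>x. if norm x > t' then 1 else (0::real))"
  proof (intro integral_mono mu_set_integrable t')
    show "integrable \<mu> (pull_test f)"
      by (rule Bochner_Integration.integrable_bound[OF mu_set_integrable(1)[OF t'(1), of 1]])
         (use f in \<open>auto simp: abs_le_iff\<close>)
  qed (use f in \<open>auto simp: not_less\<close>)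
  also have "\<dots> = c * t' powr (- \<alpha>)"
    using mu_set_integrable t' assms by simp
  finally have "l > integral\<^sup>L \<mu> (pull_test f)" using t' by simp
  from order_tendstoD(2)[OF vague[OF f(1)] this] a_pos
  show "\<forall>\<^sub>F n in sequentially. real n * F (t * a n) < l"
  proof eventually_elim
    case (elim n)
    have "expectation (\<lambda>\<omega>. if norm (H \<omega>) > t * a n then 1 else 0) \<le>
      expectation (\<lambda>\<omega>. pull_test f (inverse (a n) *\<^sub>R H \<omega>))"
    proof (intro integral_mono integrable_pull f)
      show "integrable P (\<lambda>\<omega>. if norm (H \<omega>) > t * a n then 1 else (0::real))"
        by (intro integrable_const_bound[of _ 1]) auto
      fix \<omega>
      show "(if norm (H \<omega>) > t * a n then 1 else 0) \<le> pull_test f (inverse (a n) *\<^sub>R H \<omega>)"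
        using f(4)[of "inverse (a n) *\<^sub>R H \<omega>"] f(2)[of "inverse (a n) *\<^sub>R H \<omega>"] elim(2)
        by (auto simp: field_simps)
    qed
    then have "real n * F (t * a n) \<le> real n * expectation (\<lambda>\<omega>. pull_test f (inverse (a n) *\<^sub>R H \<omega>))"
      unfolding F_eq_expectation by (intro mult_left_mono) auto
    then show ?case using elim by simp
  qed
qed

lemma F_antimono: "x \<le> y \<Longrightarrow> F y \<le> F x"
  by (rule norm_tail_antimono) auto

lemma F_pos: "F x > 0"
proof -
  have "\<forall>\<^sub>F n in sequentially. real n * F (1 * a n) > 0"
    using order_tendstoD(1)[OF tail_at_scale[of 1], of 0] c_pos by simp
  moreover have "\<forall>\<^sub>F n in sequentially. a n \<ge> x"
    using a_lim by (auto simp: filterlim_at_top)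
  ultimately have "\<forall>\<^sub>F n in sequentially. F x > 0"
  proof eventually_elim
    case (elim n)
    then have "F (a n) > 0" using F_nonneg[of "a n"] by (auto simp: zero_less_mult_iff)
    then show ?case using F_antimono[OF elim(2)] by simp
  qed
  then show ?thesis by simp
qed

text \<open>
  An asymptotic inverse of the scaling sequence: \<open>a (idx x)\<close> is asymptotically equal to \<open>x\<close>. The
  sequence \<open>a\<close> is only known to tend to infinity, so the index is read off from the tail of \<open>H\<close>
  instead of being obtained by inverting \<open>a\<close>.
\<close>

definition idx :: "real \<Rightarrow> nat" where "idx x = nat \<lfloor>c / F x\<rfloor>"

lemma F_tendsto_0: "(F \<longlongrightarrow> 0) at_top"
  by (rule norm_tail_tendsto_0) auto

lemma idx_bounds: "c / F x - 1 < real (idx x)" "real (idx x) \<le> c / F x"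
proof -
  have "c / F x \<ge> 0" using c_pos F_pos[of x] by simp
  then have "real (idx x) = of_int \<lfloor>c / F x\<rfloor>" by (simp add: idx_def)
  then show "c / F x - 1 < real (idx x)" "real (idx x) \<le> c / F x" by linarith+
qed

lemma filterlim_idx: "filterlim idx sequentially at_top"
proof -
  have "F x \<noteq> 0" for x using F_pos[of x] by simp
  then have "filterlim F (at_right 0) at_top"
    using F_tendsto_0 F_pos by (auto simp: filterlim_at)
  from filterlim_compose[OF filterlim_inverse_at_top_right this]
  have "filterlim (\<lambda>x. c * inverse (F x)) at_top at_top"
    using c_pos by (intro filterlim_tendsto_pos_mult_at_top[OF tendsto_const])
  then have "filterlim (\<lambda>x. - 1 + c * inverse (F x)) at_top at_top"
    by (rule filterlim_tendsto_add_at_top[OF tendsto_const])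
  then have "filterlim (\<lambda>x. real (idx x)) at_top at_top"
    by (rule filterlim_at_top_mono)
       (use idx_bounds(1) in \<open>auto intro!: always_eventually less_imp_le simp: divide_inverse\<close>)
  then show ?thesis by (simp add: filterlim_sequentially_iff_filterlim_real)
qed

lemma idx_tail: "((\<lambda>x. real (idx x) * F x) \<longlongrightarrow> c) at_top"
proof (rule tendsto_sandwich)
  show "((\<lambda>x. c - F x) \<longlongrightarrow> c) at_top" using tendsto_diff[OF tendsto_const F_tendsto_0, of c] by simp
  show "((\<lambda>x. c) \<longlongrightarrow> c) at_top" by simp
  show "\<forall>\<^sub>F x in at_top. c - F x \<le> real (idx x) * F x"
    "\<forall>\<^sub>F x in at_top. real (idx x) * F x \<le> c"
    using idx_bounds F_pos
    by (auto intro!: always_eventually simp: field_simps) (smt (verit) mult.commute)+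
qed

lemma tail_at_idx:
  assumes "t > 0"
  shows "((\<lambda>x. real (idx x) * F (t * a (idx x))) \<longlongrightarrow> c * t powr (- \<alpha>)) at_top"
  using filterlim_compose[OF tail_at_scale[OF assms] filterlim_idx] .

lemma a_idx_pos: "\<forall>\<^sub>F x in at_top. a (idx x) > 0"
  using eventually_compose_filterlim[OF a_pos filterlim_idx] .

text \<open>
  If \<open>x\<close> were at least \<open>l * a (idx x)\<close>, then \<open>idx x * F x\<close> would be asymptotically at most
  \<open>c * l powr (- \<alpha>) < c\<close>, whereas its limit is \<open>c\<close>.
\<close>

lemma compare_above:
  assumes "l > 1"
  shows "\<forall>\<^sub>F x in at_top. x < l * a (idx x)"
proof -
  \<comment> \<open>a level that separates the two limits\<close>
  define m where "m = (c * l powr (- \<alpha>) + c) / 2"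
  have "l powr (- \<alpha>) < 1" using assms alpha_pos by (simp add: powr_less_one)
  then have "c * l powr (- \<alpha>) < c" using c_pos by simp
  then have m: "c * l powr (- \<alpha>) < m" "m < c" by (auto simp: m_def)
  have "l > 0" using assms by simp
  from order_tendstoD(2)[OF tail_at_idx[OF this] m(1)] order_tendstoD(1)[OF idx_tail m(2)]
  show ?thesis
  proof eventually_elim
    case (elim x)
    then have "real (idx x) * F (l * a (idx x)) < real (idx x) * F x" by linarith
    then show ?case using F_antimono[of "l * a (idx x)" x]
      by (meson mult_left_mono not_le of_nat_0_le_iff)
  qed
qed

lemma compare_below:
  assumes "0 < l" "l < 1"
  shows "\<forall>\<^sub>F x in at_top. l * a (idx x) < x"
proof -
  define m where "m = (c * l powr (- \<alpha>) + c) / 2"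
  have "1 powr (- \<alpha>) < l powr (- \<alpha>)" using assms alpha_pos by (intro powr_less_mono2_neg) auto
  then have "c < c * l powr (- \<alpha>)" using c_pos by simp
  then have m: "m < c * l powr (- \<alpha>)" "c < m" by (auto simp: m_def)
  from order_tendstoD(1)[OF tail_at_idx[OF assms(1)] m(1)] order_tendstoD(2)[OF idx_tail m(2)]
  show ?thesis
  proof eventually_elim
    case (elim x)
    then have "real (idx x) * F x < real (idx x) * F (l * a (idx x))" by linarith
    then show ?case using F_antimono[of x "l * a (idx x)"]
      by (meson mult_left_mono not_le of_nat_0_le_iff)
  qed
qed

lemma ratio_tendsto_1: "((\<lambda>x. a (idx x) / x) \<longlongrightarrow> 1) at_top"
proof (rule order_tendstoI)
  fix l :: real assume l: "l < 1"
  define l' where "l' = max l (1/2)"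
  have "1 / l' > 1" using l by (auto simp: l'_def max_def)
  from compare_above[OF this] eventually_gt_at_top[of 0]
  show "\<forall>\<^sub>F x in at_top. l < a (idx x) / x"
  proof eventually_elim
    case (elim x)
    have "l' > 0" by (simp add: l'_def)
    then have "l' < a (idx x) / x" using elim by (simp add: field_simps)
    then show ?case by (simp add: l'_def)
  qed
next
  fix l :: real assume l: "1 < l"
  then have "0 < 1 / l" "1 / l < 1" by auto
  from compare_below[OF this] eventually_gt_at_top[of 0]
  show "\<forall>\<^sub>F x in at_top. a (idx x) / x < l"
    by eventually_elim (use l in \<open>auto simp: field_simps\<close>)
qed

lemma idx_tail_scaled:
  assumes s: "s > 0"
  shows "((\<lambda>x. real (idx x) * F (s * x)) \<longlongrightarrow> c * s powr (- \<alpha>)) at_top"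
proof (rule order_tendstoI)
  fix l assume "l < c * s powr (- \<alpha>)"
  then obtain t where t: "t > s" "l < c * t powr (- \<alpha>)" using powr_between(1) s by blast
  have "t / s > 1" "t > 0" using s t by auto
  from compare_above[OF this(1)] order_tendstoD(1)[OF tail_at_idx[OF this(2)] t(2)]
  show "\<forall>\<^sub>F x in at_top. l < real (idx x) * F (s * x)"
  proof eventually_elim
    case (elim x)
    have "s * x \<le> t * a (idx x)" using elim s by (simp add: field_simps)
    from F_antimono[OF this] have "real (idx x) * F (t * a (idx x)) \<le> real (idx x) * F (s * x)"
      by (intro mult_left_mono) auto
    then show ?case using elim by simp
  qed
next
  fix l assume "l > c * s powr (- \<alpha>)"
  then obtain t where t: "t > 0" "t < s" "l > c * t powr (- \<alpha>)" using powr_between(2) s by blast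
  have "0 < t / s" "t / s < 1" using s t by auto
  from compare_below[OF this] order_tendstoD(2)[OF tail_at_idx[OF t(1)] t(3)]
  show "\<forall>\<^sub>F x in at_top. real (idx x) * F (s * x) < l"
  proof eventually_elim
    case (elim x)
    have "t * a (idx x) \<le> s * x" using elim s by (simp add: field_simps)
    from F_antimono[OF this] have "real (idx x) * F (s * x) \<le> real (idx x) * F (t * a (idx x))"
      by (intro mult_left_mono) auto
    then show ?case using elim by simp
  qed
qed

lemma eventually_idx_pos: "\<forall>\<^sub>F x in at_top. real (idx x) > 0"
  using filterlim_idx by (auto simp: filterlim_at_top dest!: spec[of _ 1] elim: eventually_mono)

lemma F_regvar:
  assumes "s > 0"
  shows "((\<lambda>x. F (s * x) / F x) \<longlongrightarrow> s powr (- \<alpha>)) at_top"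
proof -
  have "((\<lambda>x. (real (idx x) * F (s * x)) / (real (idx x) * F x)) \<longlongrightarrow> c * s powr (- \<alpha>) / c) at_top"
    using c_pos by (intro tendsto_divide idx_tail_scaled assms idx_tail) auto
  moreover have "\<forall>\<^sub>F x in at_top. (real (idx x) * F (s * x)) / (real (idx x) * F x) = F (s * x) / F x"
    using eventually_idx_pos by eventually_elim simp
  ultimately show ?thesis using c_pos by (simp add: filterlim_cong)
qed

text \<open>
  Along \<open>a (idx x)\<close> this is the hypothesis, and \<open>idx x * F x\<close> tends to \<open>c\<close>. Replacing
  \<open>a (idx x)\<close> by \<open>x\<close> rescales by a factor that tends to 1, which displaces the argument
  uniformly little in the compactification; the error is supported on the event that \<open>\<parallel>H\<parallel>\<close> is of
  order at least \<open>x\<close>, whose probability is of order \<open>1 / idx x\<close>.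
\<close>

lemma vague_along_reals:
  assumes f: "vague_test f"
  shows "((\<lambda>x. expectation (\<lambda>\<omega>. pull_test f (inverse x *\<^sub>R H \<omega>)) / F x)
    \<longlongrightarrow> integral\<^sup>L \<mu> (pull_test f) / c) at_top"
proof -
  obtain K \<delta> where K: "K > 0" "\<delta> > 0" "\<And>x. \<bar>pull_test f x\<bar> \<le> K"
    "\<And>x. norm x \<le> \<delta> \<Longrightarrow> pull_test f x = 0"
    "\<And>e. e > 0 \<Longrightarrow> \<exists>d>0. \<forall>x y. dist (ext_embed x) (ext_embed y) \<le> d \<longrightarrow>
        \<bar>pull_test f x - pull_test f y\<bar> \<le> e"
    by (rule vague_test_properties[OF f], rule that)
  define E where "E x = expectation (\<lambda>\<omega>. pull_test f (inverse x *\<^sub>R H \<omega>))" for x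
  \<comment> \<open>an eventual upper bound for \<open>idx x * F (\<delta> / 2 * a (idx x))\<close>\<close>
  define B where "B = c * (\<delta> / 2) powr (- \<alpha>) + 1"
  have B: "B > 0" using c_pos by (simp add: B_def add_nonneg_pos)
  have diff: "((\<lambda>x. real (idx x) * E x - real (idx x) * E (a (idx x))) \<longlongrightarrow> 0) at_top"
  proof (rule tendstoI)
    fix e :: real assume e: "e > 0"
    define e' where "e' = e / (2 * B)"
    have e': "e' > 0" using e B by (simp add: e'_def)
    obtain d where d: "d > 0" "\<And>x y. dist (ext_embed x) (ext_embed y) \<le> d \<Longrightarrow>
        \<bar>pull_test f x - pull_test f y\<bar> \<le> e'" using K(5)[OF e'] by blast
    have "\<forall>\<^sub>F x in at_top. dist (a (idx x) / x) 1 < d"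
      using ratio_tendsto_1 d(1) by (auto simp: tendsto_iff)
    moreover have "\<forall>\<^sub>F x in at_top. a (idx x) / x < 2"
      using order_tendstoD(2)[OF ratio_tendsto_1, of 2] by simp
    moreover have "\<forall>\<^sub>F x in at_top. real (idx x) * F (\<delta> / 2 * a (idx x)) < B"
      using order_tendstoD(2)[OF tail_at_idx[of "\<delta> / 2"], of B] K(2) by (simp add: B_def)
    ultimately show "\<forall>\<^sub>F x in at_top. dist (real (idx x) * E x - real (idx x) * E (a (idx x))) 0 < e"
      using eventually_gt_at_top[of 0] a_idx_pos
    proof eventually_elim
      case (elim x)
      define A where "A = a (idx x)"
      have A: "A > 0" "A / x < 2" "x > 0" "\<bar>A / x - 1\<bar> \<le> d" using elim by (auto simp: A_def dist_real_def)
      have pt: "\<bar>pull_test f (inverse x *\<^sub>R h) - pull_test f (inverse A *\<^sub>R h)\<bar>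
          \<le> (if norm h > \<delta> / 2 * A then e' else 0)" for h :: 'a
      proof (cases "norm h > \<delta> / 2 * A")
        case True
        have "inverse x *\<^sub>R h = (A / x) *\<^sub>R (inverse A *\<^sub>R h)" using A by (simp add: divide_inverse)
        then have "dist (ext_embed (inverse x *\<^sub>R h)) (ext_embed (inverse A *\<^sub>R h)) \<le> \<bar>A / x - 1\<bar>"
          using dist_ext_embed_scaleR_le[of "A / x" "inverse A *\<^sub>R h"] A by (simp only:) simp
        then show ?thesis using True d(2) A(4) by auto
      next
        case False
        then have h: "norm h \<le> \<delta> / 2 * A" by simp
        have "norm (inverse A *\<^sub>R h) \<le> \<delta> / 2" using h A by (simp add: field_simps)
        moreover have "norm (inverse x *\<^sub>R h) \<le> \<delta>"
        proof -
          have "\<delta> / 2 * A \<le> \<delta> / 2 * (2 * x)" using A K(2) by (intro mult_left_mono) (auto simp: field_simps)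
          then show ?thesis using h A by (simp add: field_simps)
        qed
        ultimately show ?thesis using K(2,4) False by simp
      qed
      have "E x - E A = expectation (\<lambda>\<omega>. pull_test f (inverse x *\<^sub>R H \<omega>) - pull_test f (inverse A *\<^sub>R H \<omega>))"
        unfolding E_def by (subst Bochner_Integration.integral_diff) (auto intro: integrable_pull f)
      then have "\<bar>E x - E A\<bar> \<le> expectation (\<lambda>\<omega>. \<bar>pull_test f (inverse x *\<^sub>R H \<omega>) - pull_test f (inverse A *\<^sub>R H \<omega>)\<bar>)"
        by simp
      also have "\<dots> \<le> expectation (\<lambda>\<omega>. e' * (if norm (H \<omega>) > \<delta> / 2 * A then 1 else 0))"
      proof (rule integral_mono)
        show "integrable P (\<lambda>\<omega>. e' * (if norm (H \<omega>) > \<delta> / 2 * A then 1 else 0))"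
          using e' by (intro integrable_const_bound[of _ e']) auto
        show "\<bar>pull_test f (inverse x *\<^sub>R H \<omega>) - pull_test f (inverse A *\<^sub>R H \<omega>)\<bar>
          \<le> e' * (if norm (H \<omega>) > \<delta> / 2 * A then 1 else 0)" for \<omega>
          using pt[of "H \<omega>"] by auto
      qed (auto intro!: integrable_pull f)
      also have "\<dots> = e' * F (\<delta> / 2 * A)" by (simp add: F_eq_expectation)
      finally have "real (idx x) * \<bar>E x - E A\<bar> \<le> e' * (real (idx x) * F (\<delta> / 2 * A))"
        using mult_left_mono[of "\<bar>E x - E A\<bar>" "e' * F (\<delta> / 2 * A)" "real (idx x)"]
        by (simp add: mult.left_commute)
      also have "\<dots> \<le> e' * B" using elim e' by (intro mult_left_mono) (auto simp: A_def)
      also have "\<dots> < e" using e B by (simp add: e'_def)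
      finally show ?case
        by (simp add: A_def dist_real_def right_diff_distrib[symmetric] abs_mult)
    qed
  qed
  have "((\<lambda>x. real (idx x) * E (a (idx x))) \<longlongrightarrow> integral\<^sup>L \<mu> (pull_test f)) at_top"
    using filterlim_compose[OF vague[OF f] filterlim_idx] by (simp add: E_def)
  from tendsto_add[OF diff this]
  have "((\<lambda>x. real (idx x) * E x) \<longlongrightarrow> integral\<^sup>L \<mu> (pull_test f)) at_top" by simp
  then have "((\<lambda>x. (real (idx x) * E x) / (real (idx x) * F x)) \<longlongrightarrow> integral\<^sup>L \<mu> (pull_test f) / c) at_top"
    using c_pos by (intro tendsto_divide idx_tail) auto
  moreover have "\<forall>\<^sub>F x in at_top. (real (idx x) * E x) / (real (idx x) * F x) = E x / F x"
    using eventually_idx_pos by eventually_elim simp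
  ultimately show ?thesis by (simp add: filterlim_cong E_def)
qed

lemma tail_is_regvar: "regvar_vector P H \<alpha>"
  using F_regvar F_pos alpha_pos by unfold_locales auto

end

section \<open>An exponential inequality for bounded summands\<close>

text \<open>
  For negative \<open>z\<close> the quadratic lower bound for \<open>exp (- z)\<close> suffices, since
  \<open>(1 - u + u\<^sup>2) * (1 + u + u\<^sup>2 / 2) \<ge> 1\<close> for \<open>u = - z\<close>.
\<close>

lemma exp_le_quadratic:
  assumes "(z::real) \<le> 1"
  shows "exp z \<le> 1 + z + z\<^sup>2"
proof (cases "z \<ge> 0")
  case False
  define u where "u = - z"
  have u: "u \<ge> 0" using False by (simp add: u_def)
  have pos: "1 + u + u\<^sup>2 / 2 > 0" using u by (simp add: add_pos_nonneg)
  have "exp z = 1 / exp u" by (simp add: u_def exp_minus inverse_eq_divide)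
  also have "\<dots> \<le> 1 / (1 + u + u\<^sup>2 / 2)"
    using exp_lower_Taylor_quadratic[OF u] pos by (intro divide_left_mono) auto
  also have "\<dots> \<le> 1 - u + u\<^sup>2"
  proof -
    have "(1 - u + u\<^sup>2) * (1 + u + u\<^sup>2 / 2) = 1 + (u\<^sup>2 + u ^ 3 + u ^ 4) / 2"
      by (simp add: field_simps power_numeral_reduce)
    moreover have "u\<^sup>2 + u ^ 3 + u ^ 4 \<ge> 0" using u by simp
    ultimately show ?thesis using pos by (simp add: divide_le_eq)
  qed
  finally show ?thesis by (simp add: u_def)
qed (use assms exp_bound in auto)

text \<open>
  The exponential factor is attached only to the term of order \<open>t\<close>. This separation is what
  makes the resulting tail bound effective near the Gaussian scale: the variance enters without
  a large factor, and the large factor comes with a higher moment.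
\<close>

lemma exp_le_quadratic_plus_powr:
  assumes "(t::real) \<ge> 0"
  shows "exp z \<le> 1 + z + z\<^sup>2 + \<bar>z\<bar> powr t * exp \<bar>z\<bar>"
proof (cases "z \<le> 1")
  case True
  have "0 \<le> \<bar>z\<bar> powr t * exp \<bar>z\<bar>" by simp
  then show ?thesis using exp_le_quadratic[OF True] by linarith
next
  case False
  have "1 \<le> \<bar>z\<bar> powr t" using False assms by (simp add: ge_one_powr_ge_zero)
  then have "exp z \<le> \<bar>z\<bar> powr t * exp \<bar>z\<bar>" using False mult_right_mono[of 1 "\<bar>z\<bar> powr t" "exp z"] by simp
  moreover have "0 \<le> 1 + z + z\<^sup>2" using False by simp
  ultimately show ?thesis by linarith
qed

lemma (in prob_space) mgf_bound:
  fixes W :: "'a \<Rightarrow> real"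
  assumes [measurable]: "W \<in> borel_measurable M"
    and bdd: "\<And>\<omega>. \<bar>W \<omega>\<bar> \<le> y" and st: "s \<ge> 0" "t \<ge> 0"
    and mom: "expectation W \<le> m" "expectation (\<lambda>\<omega>. (W \<omega>)\<^sup>2) \<le> V"
      "expectation (\<lambda>\<omega>. \<bar>W \<omega>\<bar> powr t) \<le> T"
  shows "expectation (\<lambda>\<omega>. exp (s * W \<omega>)) \<le> exp (s * m + s\<^sup>2 * V + s powr t * exp (s * y) * T)"
proof -
  have int: "integrable M W" "integrable M (\<lambda>\<omega>. (W \<omega>)\<^sup>2)" "integrable M (\<lambda>\<omega>. \<bar>W \<omega>\<bar> powr t)"
  proof -
    show "integrable M W" using bdd by (intro integrable_const_bound[of _ y]) auto
    have "(W \<omega>)\<^sup>2 \<le> y\<^sup>2" for \<omega> using bdd[of \<omega>] by (metis abs_le_square_iff abs_ge_zero abs_of_nonneg order_trans)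
    then show "integrable M (\<lambda>\<omega>. (W \<omega>)\<^sup>2)" by (intro integrable_const_bound[of _ "y\<^sup>2"]) auto
    have "\<bar>W \<omega>\<bar> powr t \<le> y powr t" for \<omega> using bdd[of \<omega>] st by (intro powr_mono2) auto
    then show "integrable M (\<lambda>\<omega>. \<bar>W \<omega>\<bar> powr t)" by (intro integrable_const_bound[of _ "y powr t"]) auto
  qed
  have "expectation (\<lambda>\<omega>. exp (s * W \<omega>)) \<le>
      expectation (\<lambda>\<omega>. 1 + s * W \<omega> + s\<^sup>2 * (W \<omega>)\<^sup>2 + (s powr t * exp (s * y)) * \<bar>W \<omega>\<bar> powr t)"
  proof (rule integral_mono)
    show "integrable M (\<lambda>\<omega>. exp (s * W \<omega>))"
    proof (rule integrable_const_bound[of _ "exp (s * y)"])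
      show "AE \<omega> in M. norm (exp (s * W \<omega>)) \<le> exp (s * y)"
        using bdd st by (auto intro!: AE_I2 mult_left_mono intro: abs_le_D1)
    qed measurable
    fix \<omega>
    have "exp (s * W \<omega>) \<le> 1 + s * W \<omega> + (s * W \<omega>)\<^sup>2 + \<bar>s * W \<omega>\<bar> powr t * exp \<bar>s * W \<omega>\<bar>"
      by (rule exp_le_quadratic_plus_powr) (use st in auto)
    also have "\<bar>s * W \<omega>\<bar> powr t * exp \<bar>s * W \<omega>\<bar> \<le> (s powr t * exp (s * y)) * \<bar>W \<omega>\<bar> powr t"
    proof -
      have "exp \<bar>s * W \<omega>\<bar> \<le> exp (s * y)" using bdd[of \<omega>] st by (simp add: abs_mult mult_left_mono)
      then have "\<bar>s * W \<omega>\<bar> powr t * exp \<bar>s * W \<omega>\<bar> \<le> \<bar>s * W \<omega>\<bar> powr t * exp (s * y)"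
        by (intro mult_left_mono) auto
      then show ?thesis using st by (simp add: abs_mult powr_mult mult_ac)
    qed
    finally show "exp (s * W \<omega>) \<le> 1 + s * W \<omega> + s\<^sup>2 * (W \<omega>)\<^sup>2 + (s powr t * exp (s * y)) * \<bar>W \<omega>\<bar> powr t"
      by (simp add: power_mult_distrib)
  qed (use int in auto)
  also have "\<dots> = 1 + (s * expectation W + s\<^sup>2 * expectation (\<lambda>\<omega>. (W \<omega>)\<^sup>2)
      + (s powr t * exp (s * y)) * expectation (\<lambda>\<omega>. \<bar>W \<omega>\<bar> powr t))"
    using int by (simp add: prob_space)
  also have "\<dots> \<le> 1 + (s * m + s\<^sup>2 * V + (s powr t * exp (s * y)) * T)"
    using mom st by (intro add_mono mult_left_mono) auto
  also have "\<dots> \<le> exp (s * m + s\<^sup>2 * V + s powr t * exp (s * y) * T)"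
    by (rule exp_ge_add_one_self)
  finally show ?thesis .
qed

text \<open>
  An inequality of Fuk-Nagaev type: the exponential Markov inequality, with \<open>mgf_bound\<close> for each
  of the independent factors. The parameter \<open>s\<close> is left free.
\<close>

lemma (in prob_space) indep_sum_tail_bound:
  fixes W :: "'i \<Rightarrow> 'a \<Rightarrow> real"
  assumes "finite I" and indep: "indep_vars (\<lambda>_. borel) W I"
    and bdd: "\<And>j \<omega>. j \<in> I \<Longrightarrow> \<bar>W j \<omega>\<bar> \<le> y" and st: "s > 0" "t \<ge> 0"
    and mom: "\<And>j. j \<in> I \<Longrightarrow> expectation (W j) \<le> m"
      "\<And>j. j \<in> I \<Longrightarrow> expectation (\<lambda>\<omega>. (W j \<omega>)\<^sup>2) \<le> V"
      "\<And>j. j \<in> I \<Longrightarrow> expectation (\<lambda>\<omega>. \<bar>W j \<omega>\<bar> powr t) \<le> T"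
  shows "prob {\<omega> \<in> space M. (\<Sum>j\<in>I. W j \<omega>) \<ge> x} \<le>
    exp (- s * x + real (card I) * (s * m + s\<^sup>2 * V + s powr t * exp (s * y) * T))"
proof -
  define Q where "Q = s * m + s\<^sup>2 * V + s powr t * exp (s * y) * T"
  have W [measurable]: "W j \<in> borel_measurable M" if "j \<in> I" for j
    using indep that by (auto simp: indep_vars_def)
  have ind: "indep_vars (\<lambda>_. borel) (\<lambda>j \<omega>. exp (s * W j \<omega>)) I"
    by (rule indep_vars_compose2[OF indep]) auto
  have int: "integrable M (\<lambda>\<omega>. exp (s * W j \<omega>))" if j: "j \<in> I" for j
  proof (rule integrable_const_bound[of _ "exp (s * y)"])
    show "AE \<omega> in M. norm (exp (s * W j \<omega>)) \<le> exp (s * y)"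
      using bdd[OF j] st by (auto intro!: AE_I2 mult_left_mono intro: abs_le_D1)
  qed (use W[OF j] in measurable)
  have eq: "exp (s * (\<Sum>j\<in>I. W j \<omega>)) = (\<Prod>j\<in>I. exp (s * W j \<omega>))" for \<omega>
    using \<open>finite I\<close> by (simp add: sum_distrib_left exp_sum)
  have "expectation (\<lambda>\<omega>. exp (s * (\<Sum>j\<in>I. W j \<omega>))) = (\<Prod>j\<in>I. expectation (\<lambda>\<omega>. exp (s * W j \<omega>)))"
    unfolding eq by (rule indep_vars_lebesgue_integral[OF \<open>finite I\<close> ind int])
  also have "\<dots> \<le> (\<Prod>j\<in>I. exp Q)"
    unfolding Q_def by (intro prod_mono conjI mgf_bound) (use bdd st mom W in auto)
  also have "\<dots> = exp (real (card I) * Q)" by (simp add: exp_of_nat_mult)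
  finally have E: "expectation (\<lambda>\<omega>. exp (s * (\<Sum>j\<in>I. W j \<omega>))) \<le> exp (real (card I) * Q)" .
  have i: "integrable M (\<lambda>\<omega>. exp (s * (\<Sum>j\<in>I. W j \<omega>)))"
    unfolding eq by (rule indep_vars_integrable[OF \<open>finite I\<close> ind int])
  have ind1: "(\<lambda>\<omega>. indicator (space M) \<omega> *\<^sub>R g \<omega>) = (\<lambda>\<omega>. if \<omega> \<in> space M then g \<omega> else 0)" for g :: "'a \<Rightarrow> real"
    by (auto simp: indicator_def)
  have si: "set_integrable M (space M) (\<lambda>\<omega>. exp (s * (\<Sum>j\<in>I. W j \<omega>)))"
    using i unfolding set_integrable_def ind1 by (rule Bochner_Integration.integrable_cong[THEN iffD1, rotated -1]) auto
  have "prob {\<omega> \<in> space M. (\<Sum>j\<in>I. W j \<omega>) \<ge> x} \<le>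
      exp (- s * x) * (\<integral>\<omega>\<in>space M. exp (s * (\<Sum>j\<in>I. W j \<omega>)) \<partial>M)"
    by (rule Chernoff_ineq_ge[OF st(1) si]) auto
  also have "(\<integral>\<omega>\<in>space M. exp (s * (\<Sum>j\<in>I. W j \<omega>)) \<partial>M) = expectation (\<lambda>\<omega>. exp (s * (\<Sum>j\<in>I. W j \<omega>)))"
    unfolding set_lebesgue_integral_def ind1 by (rule Bochner_Integration.integral_cong) auto
  also have "exp (- s * x) * \<dots> \<le> exp (- s * x) * exp (real (card I) * Q)"
    using E by (intro mult_left_mono) auto
  also have "\<dots> = exp (- s * x + real (card I) * Q)" by (simp only: exp_add)
  finally show ?thesis unfolding Q_def .
qed

text \<open>
  Powers of a null sequence beat powers of its logarithm.
\<close>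

lemma powr_mult_ln_powr_tendsto_0:
  fixes p :: "nat \<Rightarrow> real"
  assumes p: "p \<longlonglongrightarrow> 0" and pos: "\<forall>\<^sub>F n in sequentially. p n > 0" and "\<delta> > 0" "t > 0"
  shows "(\<lambda>n. p n powr \<delta> * ln (1 / p n) powr t) \<longlonglongrightarrow> 0"
proof (rule tendsto_sandwich[of "\<lambda>_. 0"])
  \<comment> \<open>half of the power \<open>\<delta>\<close> is spent on the logarithm\<close>
  define \<kappa> where "\<kappa> = \<delta> / (2 * t)"
  have k: "\<kappa> > 0" "\<kappa> * t = \<delta> / 2" using assms by (auto simp: \<kappa>_def)
  have "(\<lambda>n. (1 / \<kappa>) powr t * p n powr (\<delta> / 2)) \<longlonglongrightarrow> (1 / \<kappa>) powr t * 0 powr (\<delta> / 2)"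
    using assms pos by (intro tendsto_mult tendsto_const tendsto_powr') (auto elim: eventually_mono)
  then show "(\<lambda>n. (1 / \<kappa>) powr t * p n powr (\<delta> / 2)) \<longlonglongrightarrow> 0" using assms by simp
  have "\<forall>\<^sub>F n in sequentially. p n < 1" using order_tendstoD(2)[OF p, of 1] by simp
  with pos show "\<forall>\<^sub>F n in sequentially. p n powr \<delta> * ln (1 / p n) powr t \<le> (1 / \<kappa>) powr t * p n powr (\<delta> / 2)"
  proof eventually_elim
    case (elim n)
    have "ln (1 / p n) \<le> (1 / p n) powr \<kappa> / \<kappa>"
      using elim k by (intro ln_powr_bound) auto
    also have "\<dots> = (1 / \<kappa>) * p n powr (- \<kappa>)" using elim by (simp add: powr_minus powr_divide field_simps)
    finally have "ln (1 / p n) powr t \<le> ((1 / \<kappa>) * p n powr (- \<kappa>)) powr t"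
      using elim assms by (intro powr_mono2) auto
    also have "\<dots> = (1 / \<kappa>) powr t * p n powr (- \<delta> / 2)"
      using k elim by (subst powr_mult) (auto simp: powr_powr)
    finally have "p n powr \<delta> * ln (1 / p n) powr t \<le> p n powr \<delta> * ((1 / \<kappa>) powr t * p n powr (- \<delta> / 2))"
      by (intro mult_left_mono) auto
    also have "\<dots> = (1 / \<kappa>) powr t * p n powr (\<delta> / 2)"
      by (simp add: powr_add[symmetric] mult.left_commute)
    finally show ?case .
  qed
qed (auto intro: always_eventually)

lemma ln_mult_neg_powr_tendsto_0:
  fixes lam :: "nat \<Rightarrow> real"
  assumes lam: "filterlim lam at_top sequentially" and "\<kappa> > 0"
  shows "(\<lambda>n. lam n powr (- \<kappa>) * ln (lam n)) \<longlonglongrightarrow> 0"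
proof -
  have lam_1: "\<forall>\<^sub>F n in sequentially. lam n > 1" using lam by (auto simp: filterlim_at_top_dense)
  have "(\<lambda>n. inverse (lam n)) \<longlonglongrightarrow> 0"
    by (rule tendsto_inverse_0_at_top[OF lam])
  moreover have "\<forall>\<^sub>F n in sequentially. inverse (lam n) > 0" using lam_1 by eventually_elim simp
  ultimately have "(\<lambda>n. inverse (lam n) powr \<kappa> * ln (1 / inverse (lam n)) powr 1) \<longlonglongrightarrow> 0"
    using assms(2) by (intro powr_mult_ln_powr_tendsto_0) auto
  moreover have "\<forall>\<^sub>F n in sequentially. inverse (lam n) powr \<kappa> * ln (1 / inverse (lam n)) powr 1 = lam n powr (- \<kappa>) * ln (lam n)"
    using lam_1
  proof eventually_elim
    case (elim n)
    have "ln (1 / inverse (lam n)) = ln (lam n)" by (simp add: divide_inverse)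
    then show ?case using elim by (simp add: powr_minus inverse_powr)
  qed
  ultimately show ?thesis by (simp add: filterlim_cong)
qed

lemma neg_powr_tendsto_0:
  fixes lam :: "nat \<Rightarrow> real"
  assumes lam: "filterlim lam at_top sequentially" and "\<kappa> > 0"
  shows "(\<lambda>n. lam n powr (- \<kappa>)) \<longlonglongrightarrow> 0"
  using assms by (intro tendsto_neg_powr) auto

section \<open>Sums of truncated independent vectors\<close>

definition norm_cut :: "real \<Rightarrow> 'a::euclidean_space \<Rightarrow> 'a" where
  "norm_cut y h = (if norm h \<le> y then h else 0)"

lemma measurable_norm_cut [measurable]: "norm_cut y \<in> borel_measurable borel"
  unfolding norm_cut_def[abs_def] by measurable

lemma norm_cut_uminus: "norm_cut y (- h) = - norm_cut y h"
  by (simp add: norm_cut_def)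

lemma abs_inner_Basis_le: "e \<in> Basis \<Longrightarrow> \<bar>h \<bullet> e\<bar> \<le> norm h"
  using Cauchy_Schwarz_ineq2[of h e] by simp

text \<open>
  Symmetry for \<open>\<alpha> = 1\<close> and centring for \<open>\<alpha> > 1\<close> keep the truncated means small.
\<close>

locale iid_regvar_vectors = regvar_vector P H \<alpha>
  for P :: "'w measure" and H :: "'w \<Rightarrow> 'a::euclidean_space" and \<alpha> :: real +
  fixes Hs :: "nat \<Rightarrow> 'w \<Rightarrow> 'a"
  assumes indep: "indep_vars (\<lambda>_. borel) Hs {1..}"
    and copies: "j \<ge> 1 \<Longrightarrow> distr P borel (Hs j) = distr P borel H"
    and symmetric: "\<alpha> = 1 \<Longrightarrow> distr P borel (\<lambda>\<omega>. - H \<omega>) = distr P borel H"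
    and centred: "\<alpha> > 1 \<Longrightarrow> integral\<^sup>L P H = 0"
begin

lemma Hs_meas: "j \<ge> 1 \<Longrightarrow> Hs j \<in> borel_measurable P"
  using indep by (auto simp: indep_vars_def)

lemma copies_expectation:
  fixes \<phi> :: "'a \<Rightarrow> real"
  assumes "\<phi> \<in> borel_measurable borel" "j \<ge> 1"
  shows "expectation (\<lambda>\<omega>. \<phi> (Hs j \<omega>)) = expectation (\<lambda>\<omega>. \<phi> (H \<omega>))"
  using integral_distr[OF Hs_meas[OF assms(2)] assms(1)] integral_distr[OF H_meas assms(1)]
    copies[OF assms(2)] by simp

lemma integrable_cut_inner: "integrable P (\<lambda>\<omega>. norm_cut y (H \<omega>) \<bullet> e)"
proof (rule integrable_const_bound[of _ "\<bar>y\<bar> * norm e"])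
  have "\<bar>norm_cut y (H \<omega>) \<bullet> e\<bar> \<le> \<bar>y\<bar> * norm e" for \<omega>
  proof -
    have "norm (norm_cut y (H \<omega>)) \<le> \<bar>y\<bar>" by (auto simp: norm_cut_def)
    then have "norm (norm_cut y (H \<omega>)) * norm e \<le> \<bar>y\<bar> * norm e" by (rule mult_right_mono) simp
    then show ?thesis using Cauchy_Schwarz_ineq2[of "norm_cut y (H \<omega>)" e] by linarith
  qed
  then show "AE \<omega> in P. norm (norm_cut y (H \<omega>) \<bullet> e) \<le> \<bar>y\<bar> * norm e" by auto
qed measurable

text \<open>
  For \<open>\<alpha> < 1\<close> the truncated first absolute moment already satisfies the bound; for \<open>\<alpha> = 1\<close> the
  mean vanishes by symmetry; for \<open>\<alpha> > 1\<close> the mean of the truncated vector is, by centring, the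
  negative of the mean of the part that was cut off.
\<close>

lemma cut_mean_bound:
  "\<exists>C\<ge>0. \<forall>\<^sub>F y in at_top. \<forall>e\<in>Basis. \<bar>expectation (\<lambda>\<omega>. norm_cut y (H \<omega>) \<bullet> e)\<bar> \<le> C * (y * F y)"
proof -
  consider "\<alpha> < 1" | "\<alpha> = 1" | "\<alpha> > 1" by linarith
  then show ?thesis
  proof cases
    case 1
    obtain C where C: "C \<ge> 0" "\<forall>\<^sub>F y in at_top. low_moment 1 y \<le> C * (y powr 1 * F y)"
      using low_moment_bound[OF 1] by blast
    from C(2) eventually_gt_at_top[of 0]
    have "\<forall>\<^sub>F y in at_top. \<forall>e\<in>Basis. \<bar>expectation (\<lambda>\<omega>. norm_cut y (H \<omega>) \<bullet> e)\<bar> \<le> C * (y * F y)"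
    proof eventually_elim
      case (elim y)
      show ?case
      proof
        fix e :: 'a assume e: "e \<in> Basis"
        have "\<bar>expectation (\<lambda>\<omega>. norm_cut y (H \<omega>) \<bullet> e)\<bar> \<le> expectation (\<lambda>\<omega>. \<bar>norm_cut y (H \<omega>) \<bullet> e\<bar>)"
          by simp
        also have "\<dots> \<le> low_moment 1 y" unfolding low_moment_def
          by (intro integral_mono integrable_abs integrable_cut_inner integrable_low)
             (auto simp: norm_cut_def abs_inner_Basis_le[OF e])
        finally show "\<bar>expectation (\<lambda>\<omega>. norm_cut y (H \<omega>) \<bullet> e)\<bar> \<le> C * (y * F y)" using elim by simp
      qed
    qed
    then show ?thesis using C by blast
  next
    case 2
    have "expectation (\<lambda>\<omega>. norm_cut y (H \<omega>) \<bullet> e) = 0" for y e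
    proof -
      have m: "(\<lambda>h. norm_cut y h \<bullet> e) \<in> borel_measurable borel" by measurable
      have "expectation (\<lambda>\<omega>. norm_cut y (H \<omega>) \<bullet> e) = expectation (\<lambda>\<omega>. norm_cut y (- H \<omega>) \<bullet> e)"
        using integral_distr[OF H_meas m] integral_distr[OF borel_measurable_uminus[OF H_meas] m] symmetric[OF 2]
        by simp
      then show ?thesis by (simp add: norm_cut_uminus)
    qed
    then show ?thesis by (intro exI[of _ 0]) auto
  next
    case 3
    obtain C where C: "C \<ge> 0" "\<forall>\<^sub>F y in at_top.
        integrable P (\<lambda>\<omega>. if norm (H \<omega>) > y then norm (H \<omega>) powr 1 else 0) \<and>
        high_moment 1 y \<le> C * (y powr 1 * F y)"
      using high_moment_bound[of 1] 3 by auto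
    have intH: "integrable P H"
      using integrable_moment[of 1] 3 by (auto intro: integrable_norm_cancel)
    from C(2) eventually_gt_at_top[of 0]
    have "\<forall>\<^sub>F y in at_top. \<forall>e\<in>Basis. \<bar>expectation (\<lambda>\<omega>. norm_cut y (H \<omega>) \<bullet> e)\<bar> \<le> C * (y * F y)"
    proof eventually_elim
      case (elim y)
      show ?case
      proof
        fix e :: 'a assume e: "e \<in> Basis"
        have "expectation (\<lambda>\<omega>. H \<omega> \<bullet> e) = 0" using centred[OF 3] intH by simp
        moreover have "expectation (\<lambda>\<omega>. H \<omega> \<bullet> e - norm_cut y (H \<omega>) \<bullet> e) =
            expectation (\<lambda>\<omega>. H \<omega> \<bullet> e) - expectation (\<lambda>\<omega>. norm_cut y (H \<omega>) \<bullet> e)"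
          by (intro Bochner_Integration.integral_diff integrable_cut_inner integrable_inner_left intH)
        ultimately have "\<bar>expectation (\<lambda>\<omega>. norm_cut y (H \<omega>) \<bullet> e)\<bar> = \<bar>expectation (\<lambda>\<omega>. H \<omega> \<bullet> e - norm_cut y (H \<omega>) \<bullet> e)\<bar>"
          by simp
        also have "\<dots> \<le> expectation (\<lambda>\<omega>. \<bar>H \<omega> \<bullet> e - norm_cut y (H \<omega>) \<bullet> e\<bar>)"
          by simp
        also have "\<dots> \<le> high_moment 1 y" unfolding high_moment_def using elim
          by (intro integral_mono integrable_abs Bochner_Integration.integrable_diff
              integrable_cut_inner integrable_inner_left intH)
             (auto simp: norm_cut_def abs_inner_Basis_le[OF e])
        finally show "\<bar>expectation (\<lambda>\<omega>. norm_cut y (H \<omega>) \<bullet> e)\<bar> \<le> C * (y * F y)" using elim by simp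
      qed
    qed
    then show ?thesis using C by blast
  qed
qed

lemma tail_ratio_along:
  assumes "filterlim lam at_top sequentially" "s > 0"
  shows "(\<lambda>n. F (s * lam n) / F (lam n)) \<longlonglongrightarrow> s powr (- \<alpha>)"
  using filterlim_compose[OF tail_regvar[OF assms(2)] assms(1)] .

text \<open>
  The cut-off level \<open>y\<close> enters the exponential, whereas the moments are bounded by those at a
  larger level \<open>z\<close>. This lets the cut-off be lowered later without touching the moment
  estimates.
\<close>

lemma coordinate_tail_bound:
  assumes n: "n \<ge> 1" and e: "e \<in> Basis" and \<sigma>: "\<sigma> \<in> {1, -1::real}"
    and y: "0 \<le> y" "y \<le> z" and st: "s > 0" "t > 0"
    and m: "\<bar>expectation (\<lambda>\<omega>. norm_cut y (H \<omega>) \<bullet> e)\<bar> \<le> m"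
  shows "prob {\<omega> \<in> space P. (\<Sum>j=1..n. \<sigma> * (norm_cut y (Hs j \<omega>) \<bullet> e)) \<ge> x} \<le>
    exp (- s * x + real n * (s * m + s\<^sup>2 * low_moment 2 z + s powr t * exp (s * y) * low_moment t z))"
proof -
  have ind: "indep_vars (\<lambda>_. borel) (\<lambda>j \<omega>. \<sigma> * (norm_cut y (Hs j \<omega>) \<bullet> e)) {1..n}"
    by (rule indep_vars_compose2[OF indep_vars_subset[OF indep]]) auto
  have abs: "\<bar>\<sigma> * (norm_cut y h \<bullet> e)\<bar> \<le> (if norm h \<le> y then norm h else 0)" for h
    using \<sigma> abs_inner_Basis_le[OF e, of h] by (auto simp: norm_cut_def abs_mult)
  have mean: "expectation (\<lambda>\<omega>. \<sigma> * (norm_cut y (Hs j \<omega>) \<bullet> e)) \<le> m" if "j \<ge> 1" for j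
    using copies_expectation[of "\<lambda>h. \<sigma> * (norm_cut y h \<bullet> e)", OF _ that] m \<sigma> by auto
  have moment: "expectation (\<lambda>\<omega>. \<bar>\<sigma> * (norm_cut y (Hs j \<omega>) \<bullet> e)\<bar> powr b) \<le> low_moment b z"
    if "j \<ge> 1" "b > 0" for j b
  proof -
    have "expectation (\<lambda>\<omega>. \<bar>\<sigma> * (norm_cut y (Hs j \<omega>) \<bullet> e)\<bar> powr b) = expectation (\<lambda>\<omega>. \<bar>\<sigma> * (norm_cut y (H \<omega>) \<bullet> e)\<bar> powr b)"
      by (rule copies_expectation[of "\<lambda>h. \<bar>\<sigma> * (norm_cut y h \<bullet> e)\<bar> powr b", OF _ that(1)]) measurable
    also have "\<dots> \<le> low_moment b z" unfolding low_moment_def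
    proof (intro integral_mono integrable_low)
      have le: "\<bar>\<sigma> * (norm_cut y h \<bullet> e)\<bar> powr b \<le> (if norm h \<le> z then norm h powr b else 0)" for h
      proof -
        have "\<bar>\<sigma> * (norm_cut y h \<bullet> e)\<bar> powr b \<le> (if norm h \<le> y then norm h else 0) powr b"
          using abs that by (intro powr_mono2) auto
        also have "\<dots> \<le> (if norm h \<le> z then norm h powr b else 0)" using y by auto
        finally show ?thesis .
      qed
      then show "\<bar>\<sigma> * (norm_cut y (H \<omega>) \<bullet> e)\<bar> powr b \<le> (if norm (H \<omega>) \<le> z then norm (H \<omega>) powr b else 0)" for \<omega>
        by blast
      show "integrable P (\<lambda>\<omega>. \<bar>\<sigma> * (norm_cut y (H \<omega>) \<bullet> e)\<bar> powr b)"
        by (rule Bochner_Integration.integrable_bound[OF integrable_low[of b z]])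
           (use le that in auto)
    qed (use that in auto)
    finally show ?thesis .
  qed
  have sq: "expectation (\<lambda>\<omega>. (\<sigma> * (norm_cut y (Hs j \<omega>) \<bullet> e))\<^sup>2) \<le> low_moment 2 z" if "j \<ge> 1" for j
    using moment[OF that, of 2] by simp
  have "\<bar>\<sigma> * (norm_cut y h \<bullet> e)\<bar> \<le> y" for h using abs[of h] y by (auto split: if_splits)
  from indep_sum_tail_bound[OF _ ind this st(1) less_imp_le[OF st(2)] mean sq moment[OF _ st(2)], of x]
  show ?thesis by simp
qed

text \<open>
  The parameter of the exponential inequality is \<open>s = A * ln (1 / p n) / lam n\<close>. Then the main
  term of the exponent is \<open>- A * \<epsilon>' * ln (1 / p n)\<close> for a coordinate threshold \<open>\<epsilon>' * lam n\<close>, the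
  mean and variance terms are negligible fractions of it, and the factor \<open>exp (s * y)\<close> equals
  \<open>p n powr (- (A * \<eta>))\<close>, which the moment of order \<open>t\<close> absorbs if \<open>A * \<eta> < \<tau>\<close>. This is why \<open>\<eta>\<close>
  has to be small in comparison with \<open>\<epsilon>\<close>.
\<close>

lemma cut_sum_deviation:
  fixes lam :: "nat \<Rightarrow> real"
  assumes lam: "filterlim lam at_top sequentially"
    and p_def: "\<And>n. p n = real n * F (lam n)" and p: "p \<longlonglongrightarrow> 0"
    and t: "t > 0" "\<tau> > 0" "C \<ge> 0"
    and V: "(\<lambda>n. real n * low_moment 2 (lam n) * ln (1 / p n) / (lam n)\<^sup>2) \<longlonglongrightarrow> 0"
    and T: "\<forall>\<^sub>F n in sequentially. real n * low_moment t (lam n) * lam n powr (- t) \<le> C * p n powr \<tau>"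
    and eps: "\<epsilon> > 0"
  shows "\<exists>\<eta>0>0. \<forall>\<eta>. 0 < \<eta> \<and> \<eta> \<le> \<eta>0 \<longrightarrow>
    (\<lambda>n. prob {\<omega> \<in> space P. norm (\<Sum>j=1..n. norm_cut (\<eta> * lam n) (Hs j \<omega>)) > \<epsilon> * lam n} / p n) \<longlonglongrightarrow> 0"
proof -
  define d where "d = real DIM('a)"
  have d: "d \<ge> 1" by (simp add: d_def Suc_leI)
  define \<epsilon>' where "\<epsilon>' = \<epsilon> / d"
  have eps': "\<epsilon>' > 0" using eps d by (simp add: \<epsilon>'_def)
  \<comment> \<open>4 leaves an exponent of 2 for \<open>p n\<close> after the mean and the variance
    have each used up one unit\<close>
  define A where "A = 4 / \<epsilon>'"
  have A: "A > 0" "A * \<epsilon>' = 4" using eps' by (auto simp: A_def)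
  define \<eta>0 where "\<eta>0 = min 1 (\<tau> / (2 * A))"
  have eta0: "\<eta>0 > 0" using A t by (simp add: \<eta>0_def)
  have main: "(\<lambda>n. prob {\<omega> \<in> space P. norm (\<Sum>j=1..n. norm_cut (\<eta> * lam n) (Hs j \<omega>)) > \<epsilon> * lam n} / p n) \<longlonglongrightarrow> 0"
    if \<eta>: "0 < \<eta>" "\<eta> \<le> \<eta>0" for \<eta>
  proof -
    have eta1: "\<eta> \<le> 1" and Aeta: "\<tau> - A * \<eta> > 0"
    proof -
      show "\<eta> \<le> 1" using \<eta> by (simp add: \<eta>0_def)
      have "\<eta> \<le> \<tau> / (2 * A)" using \<eta> by (simp add: \<eta>0_def)
      then have "A * \<eta> \<le> \<tau> / 2" using A by (simp add: field_simps)
      then show "\<tau> - A * \<eta> > 0" using t by simp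
    qed
    obtain Cm where Cm: "Cm \<ge> 0" "\<forall>\<^sub>F y in at_top. \<forall>e\<in>Basis. \<bar>expectation (\<lambda>\<omega>. norm_cut y (H \<omega>) \<bullet> e)\<bar> \<le> Cm * (y * F y)"
      using cut_mean_bound by blast
    have lam_eta: "filterlim (\<lambda>n. \<eta> * lam n) at_top sequentially"
      by (rule filterlim_tendsto_pos_mult_at_top[OF tendsto_const \<eta>(1) lam])
    define m where "m n = Cm * (\<eta> * lam n * F (\<eta> * lam n))" for n
    define l where "l n = ln (1 / p n)" for n
    have lam_pos: "\<forall>\<^sub>F n in sequentially. lam n > 0" using lam by (auto simp: filterlim_at_top_dense)
    have p_pos: "\<forall>\<^sub>F n in sequentially. p n > 0"
      using eventually_gt_at_top[of 0] by eventually_elim (simp add: p_def tail_pos)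
    have p_1: "\<forall>\<^sub>F n in sequentially. p n < 1" using order_tendstoD(2)[OF p, of 1] by simp
    have E0: "\<forall>\<^sub>F n in sequentially. \<forall>e\<in>Basis. \<bar>expectation (\<lambda>\<omega>. norm_cut (\<eta> * lam n) (H \<omega>) \<bullet> e)\<bar> \<le> m n"
      using eventually_compose_filterlim[OF Cm(2) lam_eta] by (simp add: m_def)
    have E1: "\<forall>\<^sub>F n in sequentially. real n * m n / lam n < \<epsilon>' / 4"
    proof -
      have "(\<lambda>n. Cm * \<eta> * (F (\<eta> * lam n) / F (lam n)) * p n) \<longlonglongrightarrow> Cm * \<eta> * \<eta> powr (- \<alpha>) * 0"
        by (intro tendsto_mult tendsto_const tail_ratio_along lam \<eta> p)
      then have "\<forall>\<^sub>F n in sequentially. Cm * \<eta> * (F (\<eta> * lam n) / F (lam n)) * p n < \<epsilon>' / 4"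
        using eps' by (intro order_tendstoD(2)) auto
      with lam_pos show ?thesis
      proof eventually_elim
        case (elim n)
        have "real n * m n / lam n = Cm * \<eta> * (F (\<eta> * lam n) / F (lam n)) * p n"
          using elim(1) tail_pos[of "lam n"] by (simp add: m_def p_def field_simps)
        then show ?case using elim by simp
      qed
    qed
    have E2: "\<forall>\<^sub>F n in sequentially. A * (real n * low_moment 2 (lam n) * l n / (lam n)\<^sup>2) < \<epsilon>' / 4"
      using tendsto_mult[OF tendsto_const V, of A] eps' unfolding l_def by (intro order_tendstoD(2)) auto
    have E3: "\<forall>\<^sub>F n in sequentially. C * A powr t * (p n powr (\<tau> - A * \<eta>) * l n powr t) < 1"
      using tendsto_mult[OF tendsto_const powr_mult_ln_powr_tendsto_0[OF p p_pos Aeta t(1)], of "C * A powr t"]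
      unfolding l_def by (intro order_tendstoD(2)) auto
    have coord: "\<forall>\<^sub>F n in sequentially. \<forall>e\<in>Basis. \<forall>\<sigma>\<in>{1,-1}.
        prob {\<omega> \<in> space P. (\<Sum>j=1..n. \<sigma> * (norm_cut (\<eta> * lam n) (Hs j \<omega>) \<bullet> e)) \<ge> \<epsilon>' * lam n} \<le> exp 1 * (p n)\<^sup>2"
      using E0 E1 E2 E3 T lam_pos p_pos p_1 eventually_ge_at_top[of 1]
    proof eventually_elim
      case (elim n)
      have l: "l n > 0" using elim by (simp add: l_def)
      define s where "s = A * l n / lam n"
      have s: "s > 0" using A l elim by (simp add: s_def)
      have ex: "- s * (\<epsilon>' * lam n) + real n * (s * m n + s\<^sup>2 * low_moment 2 (lam n)
            + s powr t * exp (s * (\<eta> * lam n)) * low_moment t (lam n)) \<le> 1 - 2 * l n"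
      proof -
        have a: "s * (\<epsilon>' * lam n) = 4 * l n"
        proof -
          have "s * (\<epsilon>' * lam n) = (A * \<epsilon>') * l n" using elim by (simp add: s_def)
          then show ?thesis using A by simp
        qed
        have b: "real n * (s * m n) \<le> l n"
        proof -
          have "real n * (s * m n) = A * l n * (real n * m n / lam n)" by (simp add: s_def)
          also have "\<dots> \<le> A * l n * (\<epsilon>' / 4)" using A l elim by (intro mult_left_mono) auto
          also have "\<dots> = (A * \<epsilon>') * l n / 4" by simp
          also have "\<dots> = l n" using A by simp
          finally show ?thesis .
        qed
        have c: "real n * (s\<^sup>2 * low_moment 2 (lam n)) \<le> l n"
        proof -
          have "real n * (s\<^sup>2 * low_moment 2 (lam n)) = A * l n * (A * (real n * low_moment 2 (lam n) * l n / (lam n)\<^sup>2))"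
            by (simp add: s_def power2_eq_square)
          also have "\<dots> \<le> A * l n * (\<epsilon>' / 4)" using A l elim by (intro mult_left_mono) auto
          also have "\<dots> = (A * \<epsilon>') * l n / 4" by simp
          also have "\<dots> = l n" using A by simp
          finally show ?thesis .
        qed
        have dd: "real n * (s powr t * exp (s * (\<eta> * lam n)) * low_moment t (lam n)) \<le> 1"
        proof -
          have s1: "s powr t = A powr t * l n powr t * lam n powr (- t)"
            using A l elim by (simp add: s_def powr_divide powr_mult powr_minus_divide)
          have s2: "exp (s * (\<eta> * lam n)) = p n powr (- (A * \<eta>))"
            using elim by (simp add: s_def powr_def l_def ln_div)
          have "real n * (s powr t * exp (s * (\<eta> * lam n)) * low_moment t (lam n)) =
            (A powr t * l n powr t * p n powr (- (A * \<eta>))) * (real n * low_moment t (lam n) * lam n powr (- t))"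
            unfolding s1 s2 by simp
          also have "\<dots> \<le> (A powr t * l n powr t * p n powr (- (A * \<eta>))) * (C * p n powr \<tau>)"
            using elim by (intro mult_left_mono) auto
          also have "\<dots> = C * A powr t * ((p n powr (- (A * \<eta>)) * p n powr \<tau>) * l n powr t)" by simp
          also have "p n powr (- (A * \<eta>)) * p n powr \<tau> = p n powr (\<tau> - A * \<eta>)"
            by (simp add: powr_add[symmetric])
          finally show ?thesis using elim by simp
        qed
        show ?thesis using a b c dd by (simp add: distrib_left)
      qed
      show ?case
      proof (intro ballI)
        fix e :: 'a and \<sigma> :: real assume e: "e \<in> Basis" "\<sigma> \<in> {1, -1}"
        have "prob {\<omega> \<in> space P. (\<Sum>j=1..n. \<sigma> * (norm_cut (\<eta> * lam n) (Hs j \<omega>) \<bullet> e)) \<ge> \<epsilon>' * lam n} \<le>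
          exp (- s * (\<epsilon>' * lam n) + real n * (s * m n + s\<^sup>2 * low_moment 2 (lam n)
            + s powr t * exp (s * (\<eta> * lam n)) * low_moment t (lam n)))"
          using elim e \<eta> eta1 t s
          by (intro coordinate_tail_bound) (auto simp: mult_le_cancel_right1)
        also have "\<dots> \<le> exp (1 - 2 * l n)" using ex by simp
        also have "\<dots> = exp 1 * (p n)\<^sup>2"
        proof -
          have "exp (1 - 2 * l n) = exp 1 * exp (ln (p n)) ^ 2"
            using elim by (simp add: l_def ln_div exp_add exp_double)
          then show ?thesis using elim by simp
        qed
        finally show "prob {\<omega> \<in> space P. (\<Sum>j=1..n. \<sigma> * (norm_cut (\<eta> * lam n) (Hs j \<omega>) \<bullet> e)) \<ge> \<epsilon>' * lam n} \<le> exp 1 * (p n)\<^sup>2" .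
      qed
    qed
    have upper: "\<forall>\<^sub>F n in sequentially.
        prob {\<omega> \<in> space P. norm (\<Sum>j=1..n. norm_cut (\<eta> * lam n) (Hs j \<omega>)) > \<epsilon> * lam n} / p n \<le> 2 * d * exp 1 * p n"
      using coord lam_pos p_pos
    proof eventually_elim
      case (elim n)
      define Z where "Z \<omega> = (\<Sum>j=1..n. norm_cut (\<eta> * lam n) (Hs j \<omega>))" for \<omega>
      define D where "D = (\<lambda>(e, \<sigma>). {\<omega> \<in> space P. (\<Sum>j=1..n. \<sigma> * (norm_cut (\<eta> * lam n) (Hs j \<omega>) \<bullet> e)) \<ge> \<epsilon>' * lam n})"
      have D_eq: "D (e, \<sigma>) = {\<omega> \<in> space P. \<sigma> * (Z \<omega> \<bullet> e) \<ge> \<epsilon>' * lam n}" for e \<sigma>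
        by (simp add: D_def Z_def inner_sum_left sum_distrib_left)
      have [measurable]: "Z \<in> borel_measurable P" unfolding Z_def
        by (intro borel_measurable_sum measurable_compose[OF Hs_meas measurable_norm_cut]) auto
      have D_ev: "D i \<in> events" for i by (cases i) (simp add: D_eq)
      have "{\<omega> \<in> space P. norm (Z \<omega>) > \<epsilon> * lam n} \<subseteq> (\<Union>i\<in>Basis \<times> {1,-1}. D i)"
      proof
        fix \<omega> assume \<omega>: "\<omega> \<in> {\<omega> \<in> space P. norm (Z \<omega>) > \<epsilon> * lam n}"
        have "\<exists>e\<in>Basis. \<bar>Z \<omega> \<bullet> e\<bar> \<ge> \<epsilon>' * lam n"
        proof (rule ccontr)
          assume "\<not> ?thesis"
          then have "\<And>e. e \<in> Basis \<Longrightarrow> \<bar>Z \<omega> \<bullet> e\<bar> \<le> \<epsilon>' * lam n" by force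
          then have "(\<Sum>e\<in>Basis. \<bar>Z \<omega> \<bullet> e\<bar>) \<le> of_nat DIM('a) * (\<epsilon>' * lam n)"
            by (rule sum_bounded_above)
          then have "norm (Z \<omega>) \<le> d * (\<epsilon>' * lam n)" using norm_le_l1[of "Z \<omega>"] by (simp add: d_def)
          also have "\<dots> = \<epsilon> * lam n" using d by (simp add: \<epsilon>'_def)
          finally show False using \<omega> by simp
        qed
        then obtain e where e: "e \<in> Basis" "\<bar>Z \<omega> \<bullet> e\<bar> \<ge> \<epsilon>' * lam n" by blast
        then have "\<omega> \<in> D (e, 1) \<or> \<omega> \<in> D (e, -1)" using \<omega> by (auto simp: D_eq)
        then show "\<omega> \<in> (\<Union>i\<in>Basis \<times> {1,-1}. D i)" using e by blast
      qed
      then have "prob {\<omega> \<in> space P. norm (Z \<omega>) > \<epsilon> * lam n} \<le> prob (\<Union>i\<in>Basis \<times> {1,-1}. D i)"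
        using D_ev by (intro finite_measure_mono sets.finite_UN) auto
      also have "\<dots> \<le> (\<Sum>i\<in>Basis \<times> {1,-1}. prob (D i))"
        using D_ev by (intro finite_measure_subadditive_finite) auto
      also have "\<dots> \<le> (\<Sum>i\<in>(Basis :: 'a set) \<times> {1,-1::real}. exp 1 * (p n)\<^sup>2)"
        using elim(1) by (intro sum_mono) (auto simp: D_def)
      also have "\<dots> = (2 * d * exp 1 * p n) * p n"
        by (simp add: d_def card_cartesian_product power2_eq_square)
      finally show ?case using elim(3) by (simp add: Z_def divide_le_eq)
    qed
    show ?thesis
    proof (rule tendsto_sandwich[OF _ upper tendsto_const])
      show "(\<lambda>n. 2 * d * exp 1 * p n) \<longlonglongrightarrow> 0" using tendsto_mult[OF tendsto_const p] by simp
      show "\<forall>\<^sub>F n in sequentially. 0 \<le> prob {\<omega> \<in> space P. norm (\<Sum>j=1..n. norm_cut (\<eta> * lam n) (Hs j \<omega>)) > \<epsilon> * lam n} / p n"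
        using p_pos by eventually_elim simp
    qed
  qed
  then show ?thesis using eta0 by blast
qed

end

section \<open>The principle of one big jump\<close>

text \<open>
  Three mutually exclusive situations are compared: no large term, exactly one, or at least two.
  With at most one large term, the sum is that term plus the truncated sum, which is a small
  displacement unless the last indicator is 1. The double sum counts ordered pairs of large
  terms, so it equals \<open>N * (N - 1)\<close> for \<open>N\<close> large terms, and this dominates \<open>(1 + N) / 2\<close> when
  \<open>N \<ge> 2\<close>.
\<close>

lemma single_jump_pointwise:
  fixes G :: "'a::euclidean_space \<Rightarrow> real" and h :: "'i \<Rightarrow> 'a"
  assumes I: "finite I" and K: "\<And>x. \<bar>G x\<bar> \<le> K" and zero: "\<And>x. norm x \<le> D \<Longrightarrow> G x = 0"
    and near: "\<And>x y. norm (x - y) \<le> E \<Longrightarrow> \<bar>G x - G y\<bar> \<le> w"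
    and small: "0 \<le> E" "E \<le> D / 2" "0 \<le> y" "y \<le> D / 2"
  shows "\<bar>G (\<Sum>i\<in>I. h i) - (\<Sum>i\<in>I. G (h i))\<bar> \<le>
      w * (\<Sum>i\<in>I. if norm (h i) > D / 2 then 1 else 0)
      + 2 * K * (\<Sum>i\<in>I. \<Sum>j\<in>I - {i}. (if norm (h i) > y then 1 else 0) * (if norm (h j) > y then 1 else 0))
      + 2 * K * (if norm (\<Sum>i\<in>I. norm_cut y (h i)) > E then 1 else 0)"
    (is "?lhs \<le> w * ?A + 2 * K * ?B + 2 * K * ?C")
proof -
  have K0: "K \<ge> 0" using K[of 0] by linarith
  have w0: "w \<ge> 0" using near[of 0 0] small by simp
  have A0: "?A \<ge> 0" by (intro sum_nonneg) auto
  have C0: "?C \<ge> 0" by simp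
  have B0: "?B \<ge> 0" by (intro sum_nonneg) auto
  define J where "J = {i\<in>I. norm (h i) > y}"
  have J: "finite J" "J \<subseteq> I" using I by (auto simp: J_def)
  have notJ: "G (h i) = 0" "norm_cut y (h i) = h i" if "i \<in> I - J" for i
    using that small by (auto simp: J_def norm_cut_def intro!: zero)
  have cutJ: "norm_cut y (h i) = 0" if "i \<in> J" for i using that by (auto simp: J_def norm_cut_def)
  have sumG: "(\<Sum>i\<in>I. G (h i)) = (\<Sum>i\<in>J. G (h i))"
    using I J notJ by (intro sum.mono_neutral_right) auto
  have sumh: "(\<Sum>i\<in>I. h i) = (\<Sum>i\<in>J. h i) + (\<Sum>i\<in>I. norm_cut y (h i))"
  proof -
    have "(\<Sum>i\<in>I. norm_cut y (h i)) = (\<Sum>i\<in>I - J. norm_cut y (h i))"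
      using I J cutJ by (intro sum.mono_neutral_right) auto
    also have "\<dots> = (\<Sum>i\<in>I - J. h i)" using notJ by (intro sum.cong) auto
    finally show ?thesis using sum.subset_diff[OF J(2) I, of h] by (simp add: add.commute)
  qed
  have B_eq: "?B = real (card J) * (real (card J) - 1)"
  proof -
    \<comment> \<open>\<open>u i * u i = u i\<close>, so the sum over ordered pairs is \<open>(sum u I)\<^sup>2 - sum u I\<close>\<close>
    define u where "u i = (if norm (h i) > y then 1 else 0 :: real)" for i
    have S: "sum u I = real (card J)" using I by (simp add: u_def J_def sum.If_cases Int_def)
    have "?B = (\<Sum>i\<in>I. \<Sum>j\<in>I - {i}. u i * u j)" by (simp add: u_def)
    also have "\<dots> = (\<Sum>i\<in>I. u i * (sum u I - u i))"
      using I by (intro sum.cong refl) (simp add: sum_distrib_left[symmetric] sum_diff1)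
    also have "\<dots> = (\<Sum>i\<in>I. u i * sum u I - u i)"
      by (intro sum.cong refl) (auto simp: u_def)
    also have "\<dots> = sum u I * sum u I - sum u I" by (simp add: sum_subtractf sum_distrib_right)
    finally show ?thesis by (simp add: S algebra_simps)
  qed
  consider "card J = 0" | "card J = 1" | "card J \<ge> 2" by linarith
  then show ?thesis
  proof cases
    case 1
    then have "J = {}" using J by simp
    then have eq: "?lhs = \<bar>G (\<Sum>i\<in>I. norm_cut y (h i))\<bar>" using sumG sumh by simp
    show ?thesis
    proof (cases "norm (\<Sum>i\<in>I. norm_cut y (h i)) > E")
      case True
      then have "?lhs \<le> 2 * K * ?C" using K[of "\<Sum>i\<in>I. norm_cut y (h i)"] K0 eq by simp
      moreover have "0 \<le> w * ?A" "0 \<le> 2 * K * ?B" using A0 B0 w0 K0 by auto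
      ultimately show ?thesis by linarith
    next
      case False
      then have "?lhs = 0" unfolding eq using small by (simp add: zero)
      moreover have "0 \<le> w * ?A" "0 \<le> 2 * K * ?B" "0 \<le> 2 * K * ?C" using A0 B0 C0 w0 K0 by auto
      ultimately show ?thesis by linarith
    qed
  next
    case 2
    then obtain k where k: "J = {k}" by (auto simp: card_1_singleton_iff)
    define R where "R = (\<Sum>i\<in>I. norm_cut y (h i))"
    have eq: "?lhs = \<bar>G (h k + R) - G (h k)\<bar>" using sumG sumh k by (simp add: R_def)
    show ?thesis
    proof (cases "norm R > E")
      case True
      then have "?lhs \<le> 2 * K * ?C" using K[of "h k + R"] K[of "h k"] eq by (simp add: R_def)
      moreover have "0 \<le> w * ?A" "0 \<le> 2 * K * ?B" using A0 B0 w0 K0 by auto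
      ultimately show ?thesis by linarith
    next
      case R: False
      have "?lhs \<le> w * ?A"
      proof (cases "norm (h k) > D / 2")
        case True
        have "(if norm (h k) > D / 2 then 1 else 0) \<le> ?A"
          using k J I by (intro member_le_sum) auto
        then have "1 \<le> ?A" using True by simp
        moreover have "?lhs \<le> w" unfolding eq using R by (intro near) simp
        ultimately show ?thesis using w0 mult_left_mono[of 1 ?A w] by simp
      next
        case False
        have "norm (h k + R) \<le> D" using False R small norm_triangle_ineq[of "h k" R] by linarith
        moreover have "norm (h k) \<le> D" using False small by linarith
        ultimately show ?thesis unfolding eq using zero A0 w0 by simp
      qed
      moreover have "0 \<le> 2 * K * ?B" "0 \<le> 2 * K * ?C" using B0 C0 K0 by auto
      ultimately show ?thesis by linarith
    qed
  next
    case 3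
    define N where "N = real (card J)"
    have N: "N \<ge> 2" using 3 by (simp add: N_def)
    have "\<bar>\<Sum>i\<in>J. G (h i)\<bar> \<le> (\<Sum>i\<in>J. K)" by (rule order_trans[OF sum_abs sum_mono]) (rule K)
    then have "?lhs \<le> K + N * K" using K[of "\<Sum>i\<in>I. h i"] by (simp add: sumG N_def)
    also have "\<dots> = K * (1 + N)" by (simp add: algebra_simps)
    also have "\<dots> \<le> K * (2 * (N * (N - 1)))"
    proof (rule mult_left_mono[OF _ K0])
      have "N * 1 \<le> N * (N - 1)" using N by (intro mult_left_mono) auto
      then show "1 + N \<le> 2 * (N * (N - 1))" using N by linarith
    qed
    also have "\<dots> = 2 * K * ?B" unfolding B_eq by (simp add: N_def)
    finally have "?lhs \<le> 2 * K * ?B" .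
    moreover have "0 \<le> w * ?A" "0 \<le> 2 * K * ?C" using A0 C0 w0 K0 by auto
    ultimately show ?thesis by linarith
  qed
qed

context iid_regvar_vectors
begin

lemma copies_tail: "j \<ge> 1 \<Longrightarrow> expectation (\<lambda>\<omega>. if norm (Hs j \<omega>) > x then 1 else 0) = F x"
  using copies_expectation[of "\<lambda>h. if norm h > x then 1 else 0"]
  by (simp add: tail_eq_expectation)

lemma pair_tail:
  assumes "i \<ge> 1" "j \<ge> 1" "i \<noteq> j"
  shows "expectation (\<lambda>\<omega>. (if norm (Hs i \<omega>) > x then 1 else 0) * (if norm (Hs j \<omega>) > x then 1 else 0)) = (F x)\<^sup>2"
    and "integrable P (\<lambda>\<omega>. (if norm (Hs i \<omega>) > x then 1 else 0) * (if norm (Hs j \<omega>) > x then 1 else (0::real)))"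
proof -
  define u where "u k \<omega> = (if norm (Hs k \<omega>) > x then 1 else 0 :: real)" for k \<omega>
  have ind: "indep_vars (\<lambda>_. borel) u {i, j}"
    unfolding u_def[abs_def] using assms
    by (intro indep_vars_compose2[OF indep_vars_subset[OF indep]]) auto
  have int: "integrable P (u k)" if "k \<in> {i, j}" for k
  proof -
    have [measurable]: "Hs k \<in> borel_measurable P" using that assms Hs_meas by auto
    show ?thesis unfolding u_def[abs_def] by (intro integrable_const_bound[of _ 1]) auto
  qed
  have "expectation (\<lambda>\<omega>. \<Prod>k\<in>{i,j}. u k \<omega>) = (\<Prod>k\<in>{i,j}. expectation (u k))"
    by (rule indep_vars_lebesgue_integral[OF _ ind int]) auto
  then show "expectation (\<lambda>\<omega>. (if norm (Hs i \<omega>) > x then 1 else 0) * (if norm (Hs j \<omega>) > x then 1 else 0)) = (F x)\<^sup>2"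
    using assms copies_tail[of i x] copies_tail[of j x] by (simp add: u_def[abs_def] power2_eq_square)
  have "integrable P (\<lambda>\<omega>. \<Prod>k\<in>{i,j}. u k \<omega>)"
    by (rule indep_vars_integrable[OF _ ind int]) auto
  then show "integrable P (\<lambda>\<omega>. (if norm (Hs i \<omega>) > x then 1 else 0) * (if norm (Hs j \<omega>) > x then 1 else (0::real)))"
    using assms by (simp add: u_def)
qed

lemma one_big_jump_bound:
  fixes G :: "'a \<Rightarrow> real"
  assumes [measurable]: "G \<in> borel_measurable borel"
    and K: "\<And>x. \<bar>G x\<bar> \<le> K" and zero: "\<And>x. norm x \<le> D \<Longrightarrow> G x = 0"
    and near: "\<And>x y. norm (x - y) \<le> E \<Longrightarrow> \<bar>G x - G y\<bar> \<le> w"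
    and small: "0 \<le> E" "E \<le> D / 2" "0 \<le> y" "y \<le> D / 2"
  shows "\<bar>expectation (\<lambda>\<omega>. G (\<Sum>j=1..n. Hs j \<omega>)) - real n * expectation (\<lambda>\<omega>. G (H \<omega>))\<bar> \<le>
    w * (real n * F (D / 2)) + 2 * K * (real n * F y)\<^sup>2
      + 2 * K * prob {\<omega> \<in> space P. norm (\<Sum>j=1..n. norm_cut y (Hs j \<omega>)) > E}"
proof -
  have K0: "K \<ge> 0" using K[of 0] by linarith
  have w0: "w \<ge> 0" using near[of 0 0] small by simp
  have Z: "(\<lambda>\<omega>. \<Sum>j=1..n. Hs j \<omega>) \<in> borel_measurable P"
    by (intro borel_measurable_sum Hs_meas) auto
  have Zc [measurable]: "(\<lambda>\<omega>. \<Sum>j=1..n. norm_cut y (Hs j \<omega>)) \<in> borel_measurable P"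
    by (intro borel_measurable_sum measurable_compose[OF Hs_meas measurable_norm_cut]) auto
  have iS: "integrable P (\<lambda>\<omega>. G (\<Sum>j=1..n. Hs j \<omega>))"
    using K measurable_compose[OF Z assms(1)] by (intro integrable_const_bound[of _ K]) auto
  have iG: "integrable P (\<lambda>\<omega>. G (Hs j \<omega>))" if "j \<ge> 1" for j
    using K measurable_compose[OF Hs_meas[OF that] assms(1)] by (intro integrable_const_bound[of _ K]) auto
  have iT: "integrable P (\<lambda>\<omega>. if norm (Hs j \<omega>) > x then 1 else (0::real))" if "j \<ge> 1" for j x
  proof -
    note [measurable] = Hs_meas[OF that]
    show ?thesis by (intro integrable_const_bound[of _ 1]) auto
  qed
  have iC: "integrable P (\<lambda>\<omega>. if norm (\<Sum>j=1..n. norm_cut y (Hs j \<omega>)) > E then 1 else (0::real))"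
  proof (rule integrable_const_bound[of _ 1])
    show "AE \<omega> in P. norm (if norm (\<Sum>j=1..n. norm_cut y (Hs j \<omega>)) > E then 1 else (0::real)) \<le> 1" by simp
  qed measurable
  have "expectation (\<lambda>\<omega>. G (\<Sum>j=1..n. Hs j \<omega>) - (\<Sum>j=1..n. G (Hs j \<omega>))) =
      expectation (\<lambda>\<omega>. G (\<Sum>j=1..n. Hs j \<omega>)) - expectation (\<lambda>\<omega>. \<Sum>j=1..n. G (Hs j \<omega>))"
    by (rule Bochner_Integration.integral_diff[OF iS]) (auto intro!: Bochner_Integration.integrable_sum iG)
  moreover have "expectation (\<lambda>\<omega>. \<Sum>j=1..n. G (Hs j \<omega>)) = (\<Sum>j=1..n. expectation (\<lambda>\<omega>. G (Hs j \<omega>)))"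
    by (rule Bochner_Integration.integral_sum) (auto intro: iG)
  moreover have "(\<Sum>j=1..n. expectation (\<lambda>\<omega>. G (Hs j \<omega>))) = (\<Sum>j=1..n. expectation (\<lambda>\<omega>. G (H \<omega>)))"
    by (intro sum.cong refl copies_expectation) auto
  ultimately have "\<bar>expectation (\<lambda>\<omega>. G (\<Sum>j=1..n. Hs j \<omega>)) - real n * expectation (\<lambda>\<omega>. G (H \<omega>))\<bar>
      = \<bar>expectation (\<lambda>\<omega>. G (\<Sum>j=1..n. Hs j \<omega>) - (\<Sum>j=1..n. G (Hs j \<omega>)))\<bar>"
    by simp
  also have "\<dots> \<le> expectation (\<lambda>\<omega>. \<bar>G (\<Sum>j=1..n. Hs j \<omega>) - (\<Sum>j=1..n. G (Hs j \<omega>))\<bar>)"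
    by simp
  also have "\<dots> \<le> expectation (\<lambda>\<omega>. w * (\<Sum>i=1..n. if norm (Hs i \<omega>) > D / 2 then 1 else 0)
      + 2 * K * (\<Sum>i=1..n. \<Sum>j\<in>{1..n} - {i}. (if norm (Hs i \<omega>) > y then 1 else 0) * (if norm (Hs j \<omega>) > y then 1 else 0))
      + 2 * K * (if norm (\<Sum>i=1..n. norm_cut y (Hs i \<omega>)) > E then 1 else 0))"
  proof (rule integral_mono)
    show "integrable P (\<lambda>\<omega>. \<bar>G (\<Sum>j=1..n. Hs j \<omega>) - (\<Sum>j=1..n. G (Hs j \<omega>))\<bar>)"
      using iS iG by (intro integrable_abs Bochner_Integration.integrable_diff Bochner_Integration.integrable_sum) auto
    show "integrable P (\<lambda>\<omega>. w * (\<Sum>i=1..n. if norm (Hs i \<omega>) > D / 2 then 1 else 0)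
      + 2 * K * (\<Sum>i=1..n. \<Sum>j\<in>{1..n} - {i}. (if norm (Hs i \<omega>) > y then 1 else 0) * (if norm (Hs j \<omega>) > y then 1 else 0))
      + 2 * K * (if norm (\<Sum>i=1..n. norm_cut y (Hs i \<omega>)) > E then 1 else 0))"
      by (intro Bochner_Integration.integrable_add integrable_mult_right Bochner_Integration.integrable_sum
          iT iC pair_tail(2)) auto
  qed (rule single_jump_pointwise[OF finite_atLeastAtMost K zero near small])
  also have "\<dots> = w * (\<Sum>i=1..n. F (D / 2)) + 2 * K * (\<Sum>i=1..n. \<Sum>j\<in>{1..n} - {i}. (F y)\<^sup>2)
      + 2 * K * expectation (\<lambda>\<omega>. if norm (\<Sum>i=1..n. norm_cut y (Hs i \<omega>)) > E then 1 else 0)"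
  proof -
    have a: "expectation (\<lambda>\<omega>. \<Sum>i=1..n. if norm (Hs i \<omega>) > z then 1 else 0) = (\<Sum>i=1..n. F z)" for z
    proof -
      have "expectation (\<lambda>\<omega>. \<Sum>i=1..n. if norm (Hs i \<omega>) > z then 1 else (0::real)) =
          (\<Sum>i=1..n. expectation (\<lambda>\<omega>. if norm (Hs i \<omega>) > z then 1 else 0))"
        by (rule Bochner_Integration.integral_sum) (auto intro: iT)
      also have "\<dots> = (\<Sum>i=1..n. F z)" by (intro sum.cong refl copies_tail) auto
      finally show ?thesis .
    qed
    have b: "expectation (\<lambda>\<omega>. \<Sum>i=1..n. \<Sum>j\<in>{1..n} - {i}. (if norm (Hs i \<omega>) > y then 1 else 0) * (if norm (Hs j \<omega>) > y then 1 else 0))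
        = (\<Sum>i=1..n. \<Sum>j\<in>{1..n} - {i}. (F y)\<^sup>2)"
    proof -
      have "expectation (\<lambda>\<omega>. \<Sum>j\<in>{1..n} - {i}. (if norm (Hs i \<omega>) > y then 1 else 0) * (if norm (Hs j \<omega>) > y then 1 else 0))
        = (\<Sum>j\<in>{1..n} - {i}. (F y)\<^sup>2)" if i: "i \<in> {1..n}" for i
      proof -
        have "expectation (\<lambda>\<omega>. \<Sum>j\<in>{1..n} - {i}. (if norm (Hs i \<omega>) > y then 1 else 0) * (if norm (Hs j \<omega>) > y then 1 else (0::real)))
          = (\<Sum>j\<in>{1..n} - {i}. expectation (\<lambda>\<omega>. (if norm (Hs i \<omega>) > y then 1 else 0) * (if norm (Hs j \<omega>) > y then 1 else 0)))"
          using i by (intro Bochner_Integration.integral_sum pair_tail(2)) auto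
        also have "\<dots> = (\<Sum>j\<in>{1..n} - {i}. (F y)\<^sup>2)"
          using i by (intro sum.cong refl pair_tail(1)) auto
        finally show ?thesis .
      qed
      moreover have "integrable P (\<lambda>\<omega>. \<Sum>j\<in>{1..n} - {i}. (if norm (Hs i \<omega>) > y then 1 else 0) * (if norm (Hs j \<omega>) > y then 1 else (0::real)))"
        if "i \<in> {1..n}" for i
        using that by (intro Bochner_Integration.integrable_sum pair_tail(2)) auto
      ultimately show ?thesis by (subst Bochner_Integration.integral_sum) (auto intro!: sum.cong)
    qed
    have ia: "integrable P (\<lambda>\<omega>. \<Sum>i=1..n. if norm (Hs i \<omega>) > D / 2 then 1 else (0::real))"
      by (intro Bochner_Integration.integrable_sum iT) auto
    have ib: "integrable P (\<lambda>\<omega>. \<Sum>i=1..n. \<Sum>j\<in>{1..n} - {i}. (if norm (Hs i \<omega>) > y then 1 else 0) * (if norm (Hs j \<omega>) > y then 1 else (0::real)))"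
      by (intro Bochner_Integration.integrable_sum pair_tail(2)) auto
    have lin: "expectation (\<lambda>\<omega>. w * u \<omega> + 2 * K * v \<omega> + 2 * K * z \<omega>) =
        w * expectation u + 2 * K * expectation v + 2 * K * expectation z"
      if "integrable P u" "integrable P v" "integrable P z" for u v z :: "'w \<Rightarrow> real"
      using that by simp
    show ?thesis unfolding lin[OF ia ib iC] a b ..
  qed
  also have "\<dots> \<le> w * (real n * F (D / 2)) + 2 * K * (real n * F y)\<^sup>2
      + 2 * K * prob {\<omega> \<in> space P. norm (\<Sum>j=1..n. norm_cut y (Hs j \<omega>)) > E}"
  proof (intro add_mono mult_left_mono)
    have "(\<Sum>i=1..n. \<Sum>j\<in>{1..n} - {i}. (F y)\<^sup>2) \<le> (\<Sum>i=1..n. \<Sum>j\<in>{1..n}. (F y)\<^sup>2)"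
      by (intro sum_mono sum_mono2) auto
    also have "\<dots> = (real n * F y)\<^sup>2" by (simp add: power2_eq_square)
    finally show "(\<Sum>i=1..n. \<Sum>j\<in>{1..n} - {i}. (F y)\<^sup>2) \<le> (real n * F y)\<^sup>2" .
    show "expectation (\<lambda>\<omega>. if norm (\<Sum>i=1..n. norm_cut y (Hs i \<omega>)) > E then 1 else 0)
      \<le> prob {\<omega> \<in> space P. norm (\<Sum>j=1..n. norm_cut y (Hs j \<omega>)) > E}"
      using norm_tail_eq_expectation[OF Zc, of E] by (simp add: norm_tail_def)
  qed (use K0 w0 in auto)
  finally show ?thesis .
qed

text \<open>
  Of the three errors in \<open>one_big_jump_bound\<close>, divided by \<open>p n\<close>, the first is bounded by \<open>w\<close>
  times a constant that depends only on the support of the test function, the second is of order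
  \<open>p n\<close>, and the third tends to 0 by assumption. The choices are made in the order \<open>w\<close>, \<open>\<epsilon>\<close>,
  \<open>\<eta>\<close>.
\<close>

lemma one_big_jump:
  fixes lam :: "nat \<Rightarrow> real"
  assumes f: "vague_test f" and lam: "filterlim lam at_top sequentially"
    and p_def: "\<And>n. p n = real n * F (lam n)" and p: "p \<longlonglongrightarrow> 0"
    and dev: "\<And>\<epsilon>. \<epsilon> > 0 \<Longrightarrow> \<exists>\<eta>0>0. \<forall>\<eta>. 0 < \<eta> \<and> \<eta> \<le> \<eta>0 \<longrightarrow>
      (\<lambda>n. prob {\<omega> \<in> space P. norm (\<Sum>j=1..n. norm_cut (\<eta> * lam n) (Hs j \<omega>)) > \<epsilon> * lam n} / p n) \<longlonglongrightarrow> 0"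
  shows "(\<lambda>n. (expectation (\<lambda>\<omega>. pull_test f (inverse (lam n) *\<^sub>R (\<Sum>j=1..n. Hs j \<omega>)))
      - real n * expectation (\<lambda>\<omega>. pull_test f (inverse (lam n) *\<^sub>R H \<omega>))) / p n) \<longlonglongrightarrow> 0"
proof (rule tendstoI)
  fix e :: real assume e: "e > 0"
  obtain K \<delta> where K: "K > 0" "\<delta> > 0" "\<And>x. \<bar>pull_test f x\<bar> \<le> K"
    "\<And>x. norm x \<le> \<delta> \<Longrightarrow> pull_test f x = 0"
    "\<And>e. e > 0 \<Longrightarrow> \<exists>d>0. \<forall>x y. dist (ext_embed x) (ext_embed y) \<le> d \<longrightarrow>
        \<bar>pull_test f x - pull_test f y\<bar> \<le> e"
    by (rule vague_test_properties[OF f], rule that)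
  note [measurable] = measurable_pull_test[OF f]
  define Q where "Q = (\<delta> / 2) powr (- \<alpha>) + 1"
  have Q: "Q > 0" by (simp add: Q_def add_nonneg_pos)
  define w where "w = e / (4 * Q)"
  have w: "w > 0" using e Q by (simp add: w_def)
  obtain d where d: "d > 0" "\<And>x y. dist (ext_embed x) (ext_embed y) \<le> d \<Longrightarrow>
      \<bar>pull_test f x - pull_test f y\<bar> \<le> w" using K(5)[OF w] by blast
  \<comment> \<open>the second bound accounts for the Lipschitz constant 2 of \<open>ext_embed\<close>\<close>
  define \<epsilon> where "\<epsilon> = min (\<delta> / 2) (d / 2)"
  have eps: "\<epsilon> > 0" "\<epsilon> \<le> \<delta> / 2" "2 * \<epsilon> \<le> d" using K d by (auto simp: \<epsilon>_def)
  obtain \<eta>0 where eta0: "\<eta>0 > 0" "\<And>\<eta>. 0 < \<eta> \<Longrightarrow> \<eta> \<le> \<eta>0 \<Longrightarrow>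
      (\<lambda>n. prob {\<omega> \<in> space P. norm (\<Sum>j=1..n. norm_cut (\<eta> * lam n) (Hs j \<omega>)) > \<epsilon> * lam n} / p n) \<longlonglongrightarrow> 0"
    using dev[OF eps(1)] by blast
  define \<eta> where "\<eta> = min \<eta>0 (\<delta> / 2)"
  have eta: "\<eta> > 0" "\<eta> \<le> \<eta>0" "\<eta> \<le> \<delta> / 2" using eta0 K by (auto simp: \<eta>_def)
  define pr where "pr n = prob {\<omega> \<in> space P. norm (\<Sum>j=1..n. norm_cut (\<eta> * lam n) (Hs j \<omega>)) > \<epsilon> * lam n}" for n
  have lim1: "\<forall>\<^sub>F n in sequentially. F (\<delta> / 2 * lam n) / F (lam n) < Q"
    using tail_ratio_along[OF lam, of "\<delta> / 2"] K(2) by (intro order_tendstoD(2)) (auto simp: Q_def)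
  have "(\<lambda>n. 2 * K * (F (\<eta> * lam n) / F (lam n))\<^sup>2 * p n) \<longlonglongrightarrow> 2 * K * (\<eta> powr (- \<alpha>))\<^sup>2 * 0"
    by (intro tendsto_mult tendsto_const tendsto_power tail_ratio_along lam eta p)
  then have lim2: "\<forall>\<^sub>F n in sequentially. 2 * K * (F (\<eta> * lam n) / F (lam n))\<^sup>2 * p n < e / 4"
    using e by (intro order_tendstoD(2)) auto
  have "(\<lambda>n. 2 * K * (pr n / p n)) \<longlonglongrightarrow> 2 * K * 0"
    unfolding pr_def by (intro tendsto_mult tendsto_const eta0 eta)
  then have lim3: "\<forall>\<^sub>F n in sequentially. 2 * K * (pr n / p n) < e / 4"
    using e by (intro order_tendstoD(2)) auto
  have lam_pos: "\<forall>\<^sub>F n in sequentially. lam n > 0" using lam by (auto simp: filterlim_at_top_dense)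
  show "\<forall>\<^sub>F n in sequentially. dist ((expectation (\<lambda>\<omega>. pull_test f (inverse (lam n) *\<^sub>R (\<Sum>j=1..n. Hs j \<omega>)))
      - real n * expectation (\<lambda>\<omega>. pull_test f (inverse (lam n) *\<^sub>R H \<omega>))) / p n) 0 < e"
    using lim1 lim2 lim3 lam_pos eventually_gt_at_top[of 0]
  proof eventually_elim
    case (elim n)
    define G where "G x = pull_test f (inverse (lam n) *\<^sub>R x)" for x :: 'a
    have ln: "lam n > 0" "n > 0" using elim by auto
    have pn: "p n > 0" using ln tail_pos by (simp add: p_def)
    have "\<bar>expectation (\<lambda>\<omega>. G (\<Sum>j=1..n. Hs j \<omega>)) - real n * expectation (\<lambda>\<omega>. G (H \<omega>))\<bar> \<le>
      w * (real n * F (\<delta> * lam n / 2)) + 2 * K * (real n * F (\<eta> * lam n))\<^sup>2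
      + 2 * K * prob {\<omega> \<in> space P. norm (\<Sum>j=1..n. norm_cut (\<eta> * lam n) (Hs j \<omega>)) > \<epsilon> * lam n}"
    proof (rule one_big_jump_bound)
      show "G \<in> borel_measurable borel" unfolding G_def by measurable
      show "\<bar>G x\<bar> \<le> K" for x using K by (simp add: G_def)
      show "G x = 0" if "norm x \<le> \<delta> * lam n" for x
        using that ln unfolding G_def by (intro K(4)) (auto simp: field_simps)
      show "\<bar>G x - G y\<bar> \<le> w" if "norm (x - y) \<le> \<epsilon> * lam n" for x y
      proof -
        have "dist (inverse (lam n) *\<^sub>R x) (inverse (lam n) *\<^sub>R y) = norm (x - y) / lam n"
          using ln by (simp add: dist_norm scaleR_diff_right[symmetric] divide_inverse mult.commute)
        also have "\<dots> \<le> \<epsilon>" using that ln by (simp add: divide_le_eq)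
        finally have "dist (ext_embed (inverse (lam n) *\<^sub>R x)) (ext_embed (inverse (lam n) *\<^sub>R y)) \<le> d"
          using dist_ext_embed_le[of "inverse (lam n) *\<^sub>R x" "inverse (lam n) *\<^sub>R y"] eps by linarith
        then show ?thesis unfolding G_def by (rule d(2))
      qed
      show "\<epsilon> * lam n \<le> \<delta> * lam n / 2" "\<eta> * lam n \<le> \<delta> * lam n / 2"
        using mult_right_mono[OF eps(2), of "lam n"] mult_right_mono[OF eta(3), of "lam n"] ln by auto
    qed (use eps eta ln in auto)
    then have "\<bar>expectation (\<lambda>\<omega>. G (\<Sum>j=1..n. Hs j \<omega>)) - real n * expectation (\<lambda>\<omega>. G (H \<omega>))\<bar> / p n \<le>
      (w * (real n * F (\<delta> / 2 * lam n)) + 2 * K * (real n * F (\<eta> * lam n))\<^sup>2 + 2 * K * pr n) / p n"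
      using pn by (intro divide_right_mono) (auto simp: pr_def)
    also have "\<dots> = w * (F (\<delta> / 2 * lam n) / F (lam n)) + 2 * K * (F (\<eta> * lam n) / F (lam n))\<^sup>2 * p n + 2 * K * (pr n / p n)"
    proof -
      have "real n \<noteq> 0" "F (lam n) \<noteq> 0" using ln tail_pos[of "lam n"] by auto
      then show ?thesis by (simp add: p_def add_divide_distrib power2_eq_square)
    qed
    also have "\<dots> < w * Q + e / 4 + e / 4"
      using elim w by (intro add_strict_mono mult_strict_left_mono) auto
    also have "\<dots> < e" using e Q by (simp add: w_def)
    finally show ?case using pn by (simp add: G_def dist_real_def)
  qed
qed

end

section \<open>Admissible normalising sequences\<close>

context regvar_vector
begin

text \<open>
  The requirements of \<open>cut_sum_deviation\<close>. The exponent \<open>t\<close> is 2 for \<open>\<alpha> \<le> 2\<close>, where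
  \<open>n * low_moment 2 (lam n) / (lam n)\<^sup>2\<close> is itself bounded by a power of \<open>n * F (lam n)\<close>; for
  \<open>\<alpha> > 2\<close> the variance is finite but gives no power gain near the scale \<open>sqrt (n * ln n)\<close>, and
  \<open>t\<close> is taken strictly between 2 and \<open>\<alpha>\<close>.
\<close>

definition admissible_scale :: "(nat \<Rightarrow> real) \<Rightarrow> bool" where
  "admissible_scale lam \<longleftrightarrow>
     filterlim lam at_top sequentially \<and>
     (\<lambda>n. real n * F (lam n)) \<longlonglongrightarrow> 0 \<and>
     (\<lambda>n. real n * low_moment 2 (lam n) * ln (1 / (real n * F (lam n))) / (lam n)\<^sup>2) \<longlonglongrightarrow> 0 \<and>
     (\<exists>t>0. \<exists>\<tau>>0. \<exists>C\<ge>0. \<forall>\<^sub>F n in sequentially.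
        real n * low_moment t (lam n) * lam n powr (- t) \<le> C * (real n * F (lam n)) powr \<tau>)"

lemma low_moment_nonneg: "low_moment \<beta> x \<ge> 0"
  unfolding low_moment_def by (intro integral_nonneg_AE) auto

text \<open>
  If the quantile is negligible with respect to \<open>lam n\<close>, then \<open>n * F (\<epsilon> * lam n) \<le> 1\<close> eventually
  for every \<open>\<epsilon> > 0\<close>, and regular variation turns this into \<open>n * F (lam n) \<longlonglongrightarrow> 0\<close>. Karamata's bound
  then makes the normalised truncated variance a multiple of \<open>n * F (lam n)\<close> itself.
\<close>

lemma admissible_scale_infinite_variance:
  assumes \<alpha>: "\<alpha> < 2" and pos: "\<And>n. n \<ge> 1 \<Longrightarrow> lam n > 0"
    and quantile: "(\<lambda>n. Inf {x. F x \<le> 1 / real n} / lam n) \<longlonglongrightarrow> 0"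
  shows "admissible_scale lam"
proof -
  define p where "p n = real n * F (lam n)" for n
  have below: "\<forall>\<^sub>F n in sequentially. F (\<epsilon> * lam n) \<le> 1 / real n" if \<epsilon>: "\<epsilon> > 0" for \<epsilon>
    using order_tendstoD(2)[OF quantile \<epsilon>] eventually_ge_at_top[of 1]
  proof eventually_elim
    case (elim n)
    have ne: "{x. F x \<le> 1 / real n} \<noteq> {}"
    proof -
      have "\<forall>\<^sub>F x in at_top. F x < 1 / real n"
        using order_tendstoD(2)[OF norm_tail_tendsto_0[OF H_meas], of "1 / real n"] elim by simp
      then obtain x where "F x < 1 / real n" by (auto simp: eventually_at_top_linorder)
      then show ?thesis by (auto intro: less_imp_le)
    qed
    have "Inf {x. F x \<le> 1 / real n} < \<epsilon> * lam n"
      using elim pos[of n] by (simp add: divide_less_eq)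
    from cInf_lessD[OF ne this] obtain x where x: "F x \<le> 1 / real n" "x < \<epsilon> * lam n" by auto
    have "F (\<epsilon> * lam n) \<le> F x" using x by (intro norm_tail_antimono) auto
    then show ?case using x by simp
  qed
  have lam: "filterlim lam at_top sequentially"
    unfolding filterlim_at_top
  proof
    fix Z
    have "\<forall>\<^sub>F n in sequentially. 1 / real n < F Z"
      using order_tendstoD(2)[OF lim_1_over_n, of "F Z"] tail_pos[of Z] by simp
    with below[of 1, simplified] show "\<forall>\<^sub>F n in sequentially. Z \<le> lam n"
    proof eventually_elim
      case (elim n)
      then have "F (lam n) < F Z" by linarith
      then show ?case using norm_tail_antimono[OF H_meas, of "lam n" Z] by (meson not_le less_imp_le)
    qed
  qed
  have p_pos: "\<forall>\<^sub>F n in sequentially. p n > 0"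
    using eventually_gt_at_top[of 0] by eventually_elim (simp add: p_def tail_pos)
  have p0: "p \<longlonglongrightarrow> 0"
  proof (rule tendstoI)
    fix e :: real assume e: "e > 0"
    \<comment> \<open>chosen so that \<open>F (lam n) / F (\<epsilon> * lam n)\<close> tends to \<open>e / 2\<close>\<close>
    define \<epsilon> where "\<epsilon> = (e / 2) powr (1 / \<alpha>)"
    have eps: "\<epsilon> > 0" "\<epsilon> powr \<alpha> = e / 2" using e alpha_pos by (auto simp: \<epsilon>_def powr_powr)
    have "(\<lambda>n. F (\<epsilon> * lam n) / F (lam n)) \<longlonglongrightarrow> \<epsilon> powr (- \<alpha>)"
      using filterlim_compose[OF tail_regvar[OF eps(1)] lam] .
    moreover have "\<epsilon> powr (- \<alpha>) > 1 / e" using eps e by (simp add: powr_minus_divide field_simps)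
    ultimately have "\<forall>\<^sub>F n in sequentially. F (\<epsilon> * lam n) / F (lam n) > 1 / e"
      by (intro order_tendstoD(1))
    with below[OF eps(1)] eventually_ge_at_top[of 1] show "\<forall>\<^sub>F n in sequentially. dist (p n) 0 < e"
    proof eventually_elim
      case (elim n)
      have "F (lam n) < e * F (\<epsilon> * lam n)" using elim(3) e tail_pos[of "lam n"] by (simp add: field_simps)
      also have "\<dots> \<le> e * (1 / real n)" using elim(1) e by (intro mult_left_mono) auto
      finally have "p n < e" using elim(2) by (simp add: p_def field_simps)
      moreover have "p n \<ge> 0" using tail_pos[of "lam n"] by (simp add: p_def)
      ultimately show ?case by simp
    qed
  qed
  obtain C where C: "C \<ge> 0" "\<forall>\<^sub>F x in at_top. low_moment 2 x \<le> C * (x powr 2 * F x)"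
    using low_moment_bound[OF \<alpha>] by blast
  have lam_pos: "\<forall>\<^sub>F n in sequentially. lam n > 0" using lam by (auto simp: filterlim_at_top_dense)
  have bound: "\<forall>\<^sub>F n in sequentially. real n * low_moment 2 (lam n) / (lam n)\<^sup>2 \<le> C * p n"
    using eventually_compose_filterlim[OF C(2) lam] lam_pos
  proof eventually_elim
    case (elim n)
    have "real n * low_moment 2 (lam n) \<le> real n * (C * ((lam n)\<^sup>2 * F (lam n)))"
      using elim by (intro mult_left_mono) auto
    then show ?case using elim(2) by (simp add: p_def divide_le_eq mult_ac)
  qed
  have p_1: "\<forall>\<^sub>F n in sequentially. p n < 1" using order_tendstoD(2)[OF p0, of 1] by simp
  have "(\<lambda>n. real n * low_moment 2 (lam n) * ln (1 / p n) / (lam n)\<^sup>2) \<longlonglongrightarrow> 0"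
  proof (rule tendsto_sandwich)
    show "\<forall>\<^sub>F n in sequentially. 0 \<le> real n * low_moment 2 (lam n) * ln (1 / p n) / (lam n)\<^sup>2"
      using p_1 p_pos by eventually_elim (simp add: low_moment_nonneg)
    show "\<forall>\<^sub>F n in sequentially. real n * low_moment 2 (lam n) * ln (1 / p n) / (lam n)\<^sup>2
        \<le> C * (p n powr 1 * ln (1 / p n) powr 1)"
      using bound p_1 p_pos
    proof eventually_elim
      case (elim n)
      have "ln (1 / p n) \<ge> 0" using elim by simp
      then show ?case using elim mult_right_mono[OF elim(1), of "ln (1 / p n)"] by (simp add: mult_ac)
    qed
    show "(\<lambda>n. C * (p n powr 1 * ln (1 / p n) powr 1)) \<longlonglongrightarrow> 0"
      using tendsto_mult[OF tendsto_const powr_mult_ln_powr_tendsto_0[OF p0 p_pos, of 1 1]] by simp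
  qed auto
  moreover have "\<forall>\<^sub>F n in sequentially. real n * low_moment 2 (lam n) * lam n powr (- 2) \<le> C * p n powr 1"
    using bound p_pos lam_pos
    by eventually_elim (simp add: powr_minus_divide)
  then have "\<exists>t>0. \<exists>\<tau>>0. \<exists>C\<ge>0. \<forall>\<^sub>F n in sequentially.
        real n * low_moment t (lam n) * lam n powr (- t) \<le> C * p n powr \<tau>"
    using C(1) by (intro exI[of _ 2] exI[of _ 1] exI[of _ C] conjI) auto
  ultimately show ?thesis
    using lam p0 unfolding admissible_scale_def p_def by blast
qed

text \<open>
  Since \<open>F\<close> decays at most polynomially, \<open>ln (1 / (n * F (lam n)))\<close> is at most a multiple of
  \<open>ln (lam n)\<close>, so the requirements can be checked in powers of \<open>lam n\<close>.
\<close>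

lemma admissible_scale_power:
  assumes lam: "filterlim lam at_top sequentially"
    and p0: "(\<lambda>n. real n * F (lam n)) \<longlonglongrightarrow> 0"
    and var: "(\<lambda>n. real n * low_moment 2 (lam n) * ln (lam n) / (lam n)\<^sup>2) \<longlonglongrightarrow> 0"
    and t: "t > 0" "\<kappa> > 0" "C \<ge> 0"
    and mom: "\<forall>\<^sub>F n in sequentially. real n * low_moment t (lam n) * lam n powr (- t) \<le> C * lam n powr (- \<kappa>)"
  shows "admissible_scale lam"
proof -
  define p where "p n = real n * F (lam n)" for n
  define b where "b = \<alpha> + 2"
  have b: "b > 0" using alpha_pos by (simp add: b_def)
  have p_pos: "\<forall>\<^sub>F n in sequentially. p n > 0"
    using eventually_gt_at_top[of 0] by eventually_elim (simp add: p_def tail_pos)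
  have p_1: "\<forall>\<^sub>F n in sequentially. p n < 1" using order_tendstoD(2)[OF p0, of 1] by (simp add: p_def)
  have lam_1: "\<forall>\<^sub>F n in sequentially. lam n > 1" using lam by (auto simp: filterlim_at_top_dense)
  \<comment> \<open>one spare power of \<open>lam n\<close> absorbs the constant \<open>D\<close>\<close>
  obtain D where D: "D > 0" "\<forall>\<^sub>F x in at_top. D * x powr (- (\<alpha> + 1)) \<le> F x"
    using tail_lower_bound[of "\<alpha> + 1"] by auto
  have lam_D: "\<forall>\<^sub>F n in sequentially. lam n \<ge> 1 / D" using lam by (auto simp: filterlim_at_top)
  have lower: "\<forall>\<^sub>F n in sequentially. lam n powr (- b) \<le> p n"
    using eventually_compose_filterlim[OF D(2) lam] lam_D lam_1 eventually_ge_at_top[of 1]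
  proof eventually_elim
    case (elim n)
    have "lam n powr (- b) = (1 / lam n) * lam n powr (- (\<alpha> + 1))"
    proof -
      have "lam n powr (- b) = lam n powr (- 1) * lam n powr (- (\<alpha> + 1))"
        unfolding powr_add[symmetric] by (rule arg_cong[where f = "(powr) (lam n)"]) (simp add: b_def)
      moreover have "lam n powr (- 1) = 1 / lam n"
        using elim(3) powr_minus_divide[of "lam n" 1] by simp
      ultimately show ?thesis by simp
    qed
    also have "\<dots> \<le> D * lam n powr (- (\<alpha> + 1))"
      using elim D(1) by (intro mult_right_mono) (auto simp: field_simps)
    also have "\<dots> \<le> F (lam n)" using elim by simp
    also have "\<dots> \<le> p n" using elim(4) tail_pos[of "lam n"] by (simp add: p_def mult_le_cancel_right1)
    finally show ?case .
  qed
  have "(\<lambda>n. real n * low_moment 2 (lam n) * ln (1 / p n) / (lam n)\<^sup>2) \<longlonglongrightarrow> 0"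
  proof (rule tendsto_sandwich)
    show "\<forall>\<^sub>F n in sequentially. 0 \<le> real n * low_moment 2 (lam n) * ln (1 / p n) / (lam n)\<^sup>2"
      using p_1 p_pos by eventually_elim (simp add: low_moment_nonneg)
    show "\<forall>\<^sub>F n in sequentially. real n * low_moment 2 (lam n) * ln (1 / p n) / (lam n)\<^sup>2
        \<le> b * (real n * low_moment 2 (lam n) * ln (lam n) / (lam n)\<^sup>2)"
      using lower p_pos lam_1
    proof eventually_elim
      case (elim n)
      have "ln (lam n powr (- b)) \<le> ln (p n)" using elim by (intro ln_mono) auto
      then have "ln (1 / p n) \<le> b * ln (lam n)" using elim by (simp add: ln_div ln_powr)
      then have "(real n * low_moment 2 (lam n) / (lam n)\<^sup>2) * ln (1 / p n) \<le>
          (real n * low_moment 2 (lam n) / (lam n)\<^sup>2) * (b * ln (lam n))"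
        by (intro mult_left_mono) (auto simp: low_moment_nonneg)
      then show ?case by (simp add: mult_ac)
    qed
    show "(\<lambda>n. b * (real n * low_moment 2 (lam n) * ln (lam n) / (lam n)\<^sup>2)) \<longlonglongrightarrow> 0"
      using tendsto_mult[OF tendsto_const var, of b] by simp
  qed auto
  moreover have "\<forall>\<^sub>F n in sequentially. real n * low_moment t (lam n) * lam n powr (- t) \<le> C * p n powr (\<kappa> / b)"
    using mom lower lam_1
  proof eventually_elim
    case (elim n)
    have "lam n powr (- \<kappa>) = (lam n powr (- b)) powr (\<kappa> / b)" using b by (simp add: powr_powr)
    also have "\<dots> \<le> p n powr (\<kappa> / b)" using elim b t by (intro powr_mono2) auto
    finally have "C * lam n powr (- \<kappa>) \<le> C * p n powr (\<kappa> / b)" using t by (intro mult_left_mono)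
    then show ?case using elim by linarith
  qed
  moreover have "\<kappa> / b > 0" using b t by simp
  ultimately show ?thesis
    using lam p0 t unfolding admissible_scale_def p_def by blast
qed

text \<open>
  The number \<open>\<xi>\<close> is chosen so that \<open>n \<le> lam n powr (2 - 2 * \<xi>)\<close>. Half of this surplus,
  \<open>lam n powr \<xi>\<close>, pays for the possibly infinite variance through the finite moment of order
  \<open>2 - \<xi>\<close>; the other half is the power gain.
\<close>

lemma admissible_scale_alpha_2:
  assumes \<alpha>: "\<alpha> = 2" and \<gamma>: "\<gamma> > 0" and pos: "\<And>n. n \<ge> 1 \<Longrightarrow> lam n > 0"
    and scale: "(\<lambda>n. sqrt (real n powr (1 + \<gamma>)) / lam n) \<longlonglongrightarrow> 0"
  shows "admissible_scale lam"
proof -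
  define \<xi> where "\<xi> = \<gamma> / (1 + \<gamma>)"
  have xi: "0 < \<xi>" "\<xi> < 1" "2 / (1 + \<gamma>) = 2 - 2 * \<xi>" using \<gamma> by (auto simp: \<xi>_def field_simps)
  define K where "K = expectation (\<lambda>\<omega>. norm (H \<omega>) powr (2 - \<xi>))"
  have K: "K \<ge> 0" unfolding K_def by (intro integral_nonneg_AE) auto
  have le: "\<forall>\<^sub>F n in sequentially. sqrt (real n powr (1 + \<gamma>)) \<le> lam n"
    using order_tendstoD(2)[OF scale, of 1, simplified] eventually_ge_at_top[of 1]
  proof eventually_elim
    case (elim n)
    then show ?case using pos[of n] by (simp add: divide_less_eq)
  qed
  have n_le: "\<forall>\<^sub>F n in sequentially. real n \<le> lam n powr (2 - 2 * \<xi>)"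
    using le eventually_ge_at_top[of 1]
  proof eventually_elim
    case (elim n)
    have "real n powr ((1 + \<gamma>) / 2) \<le> lam n"
    proof -
      have "sqrt (real n powr (1 + \<gamma>)) = real n powr ((1 + \<gamma>) / 2)"
        by (simp add: powr_half_sqrt[symmetric] powr_powr)
      then show ?thesis using elim by simp
    qed
    then have "(real n powr ((1 + \<gamma>) / 2)) powr (2 / (1 + \<gamma>)) \<le> lam n powr (2 / (1 + \<gamma>))"
      using \<gamma> by (intro powr_mono2) auto
    moreover have "(real n powr ((1 + \<gamma>) / 2)) powr (2 / (1 + \<gamma>)) = real n"
    proof -
      have "(1 + \<gamma>) / 2 * (2 / (1 + \<gamma>)) = 1" using \<gamma> by simp
      then show ?thesis by (simp only: powr_powr) simp
    qed
    ultimately show ?case using xi(3) by simp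
  qed
  have lam: "filterlim lam at_top sequentially"
  proof (rule filterlim_at_top_mono)
    show "filterlim (\<lambda>n. sqrt (real n)) at_top sequentially"
      by (rule filterlim_compose[OF sqrt_at_top filterlim_real_sequentially])
    show "\<forall>\<^sub>F n in sequentially. sqrt (real n) \<le> lam n"
      using le eventually_ge_at_top[of 1]
    proof eventually_elim
      case (elim n)
      have "real n powr 1 \<le> real n powr (1 + \<gamma>)" using elim \<gamma> by (intro powr_mono) auto
      then have "sqrt (real n) \<le> sqrt (real n powr (1 + \<gamma>))" by simp
      then show ?case using elim by linarith
    qed
  qed
  have lam_1: "\<forall>\<^sub>F n in sequentially. lam n > 1" using lam by (auto simp: filterlim_at_top_dense)
  have p0: "(\<lambda>n. real n * F (lam n)) \<longlonglongrightarrow> 0"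
  proof (rule tendsto_sandwich)
    show "\<forall>\<^sub>F n in sequentially. 0 \<le> real n * F (lam n)"
      using tail_pos by (intro always_eventually allI mult_nonneg_nonneg) (auto intro: less_imp_le)
    show "\<forall>\<^sub>F n in sequentially. real n * F (lam n) \<le> K * lam n powr (- \<xi>)"
      using n_le lam_1
    proof eventually_elim
      case (elim n)
      have "real n * F (lam n) \<le> lam n powr (2 - 2 * \<xi>) * (K * lam n powr (- (2 - \<xi>)))"
        using elim xi \<alpha> tail_markov[of "2 - \<xi>" "lam n"] tail_pos[of "lam n"]
        by (intro mult_mono) (auto simp: K_def intro: less_imp_le)
      also have "\<dots> = K * lam n powr (- \<xi>)" by (simp add: powr_add[symmetric] mult.left_commute)
      finally show ?case .
    qed
    show "(\<lambda>n. K * lam n powr (- \<xi>)) \<longlonglongrightarrow> 0"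
      using tendsto_mult[OF tendsto_const neg_powr_tendsto_0[OF lam xi(1)], of K] by simp
  qed auto
  have mom: "\<forall>\<^sub>F n in sequentially. real n * low_moment 2 (lam n) * lam n powr (- 2) \<le> K * lam n powr (- \<xi>)"
    using n_le lam_1
  proof eventually_elim
    case (elim n)
    have "low_moment 2 (lam n) \<le> lam n powr \<xi> * K"
      using low_moment_interpolate[of "2 - \<xi>" 2 "lam n"] elim xi \<alpha> by (simp add: K_def)
    then have "real n * low_moment 2 (lam n) \<le> lam n powr (2 - 2 * \<xi>) * (lam n powr \<xi> * K)"
      using elim by (intro mult_mono) (auto simp: low_moment_nonneg)
    then have "real n * low_moment 2 (lam n) * lam n powr (- 2) \<le> lam n powr (2 - 2 * \<xi>) * (lam n powr \<xi> * K) * lam n powr (- 2)"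
      by (intro mult_right_mono) auto
    also have "\<dots> = K * (lam n powr (2 - 2 * \<xi>) * lam n powr \<xi> * lam n powr (- 2))" by simp
    also have "\<dots> = K * lam n powr (- \<xi>)" by (simp add: powr_add[symmetric])
    finally show ?case .
  qed
  have var: "(\<lambda>n. real n * low_moment 2 (lam n) * ln (lam n) / (lam n)\<^sup>2) \<longlonglongrightarrow> 0"
  proof (rule tendsto_sandwich)
    show "\<forall>\<^sub>F n in sequentially. 0 \<le> real n * low_moment 2 (lam n) * ln (lam n) / (lam n)\<^sup>2"
      using lam_1 by eventually_elim (simp add: low_moment_nonneg)
    show "\<forall>\<^sub>F n in sequentially. real n * low_moment 2 (lam n) * ln (lam n) / (lam n)\<^sup>2 \<le> K * (lam n powr (- \<xi>) * ln (lam n))"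
      using mom lam_1
    proof eventually_elim
      case (elim n)
      from mult_right_mono[OF elim(1), of "ln (lam n)"] show ?case
        using elim(2) by (simp add: powr_minus_divide mult_ac)
    qed
    show "(\<lambda>n. K * (lam n powr (- \<xi>) * ln (lam n))) \<longlonglongrightarrow> 0"
      using tendsto_mult[OF tendsto_const ln_mult_neg_powr_tendsto_0[OF lam xi(1)], of K] by simp
  qed auto
  show ?thesis by (rule admissible_scale_power[OF lam p0 var _ xi(1) K mom]) simp
qed

text \<open>
  Since \<open>n \<le> (lam n)\<^sup>2\<close>, a moment of order \<open>t > 2\<close> yields the power gain \<open>lam n powr (2 - t)\<close>.
  The variance condition reduces to \<open>n * ln (lam n) / (lam n)\<^sup>2 \<longlonglongrightarrow> 0\<close>: for \<open>lam n \<le> n\<close> this is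
  the assumption on \<open>sqrt (n * ln n)\<close>, and for larger \<open>lam n\<close> it is clear.
\<close>

lemma admissible_scale_finite_variance:
  assumes \<alpha>: "\<alpha> > 2" and pos: "\<And>n. n \<ge> 1 \<Longrightarrow> lam n > 0"
    and scale: "(\<lambda>n. sqrt (real n * ln (real n)) / lam n) \<longlonglongrightarrow> 0"
  shows "admissible_scale lam"
proof -
  define t where "t = (2 + \<alpha>) / 2"
  have t: "2 < t" "t < \<alpha>" using \<alpha> by (auto simp: t_def)
  define K where "K \<beta> = expectation (\<lambda>\<omega>. norm (H \<omega>) powr \<beta>)" for \<beta>
  have K: "K \<beta> \<ge> 0" for \<beta> unfolding K_def by (intro integral_nonneg_AE) auto
  have n_le: "\<forall>\<^sub>F n in sequentially. real n \<le> (lam n)\<^sup>2"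
    using order_tendstoD(2)[OF scale, of 1, simplified] eventually_ge_at_top[of 3]
  proof eventually_elim
    case (elim n)
    have "ln (real n) \<ge> 1"
      using elim(2) exp_le by (subst ln_ge_iff) auto
    then have "real n * 1 \<le> real n * ln (real n)" by (intro mult_left_mono) auto
    moreover have "sqrt (real n * ln (real n)) \<le> lam n"
      using elim pos[of n] by (simp add: divide_less_eq)
    then have "(sqrt (real n * ln (real n)))\<^sup>2 \<le> (lam n)\<^sup>2"
      using \<open>ln (real n) \<ge> 1\<close> by (intro power_mono) auto
    ultimately show ?case using \<open>ln (real n) \<ge> 1\<close> by simp
  qed
  have lam: "filterlim lam at_top sequentially"
    unfolding filterlim_at_top
  proof
    fix Z :: real
    have "\<forall>\<^sub>F n in sequentially. real n \<ge> Z\<^sup>2"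
      using filterlim_real_sequentially by (auto simp: filterlim_at_top)
    with n_le eventually_ge_at_top[of 1] show "\<forall>\<^sub>F n in sequentially. Z \<le> lam n"
    proof eventually_elim
      case (elim n)
      have "Z\<^sup>2 \<le> (lam n)\<^sup>2" using elim by linarith
      then show ?case by (rule power2_le_imp_le) (use pos[of n] elim(2) in simp)
    qed
  qed
  have lam_1: "\<forall>\<^sub>F n in sequentially. lam n > 1" using lam by (auto simp: filterlim_at_top_dense)
  have weight: "\<forall>\<^sub>F n in sequentially. real n * lam n powr (- t) \<le> lam n powr (- (t - 2))"
    using n_le lam_1
  proof eventually_elim
    case (elim n)
    have "real n * lam n powr (- t) \<le> lam n powr 2 * lam n powr (- t)"
      using elim by (intro mult_right_mono) auto
    then show ?case by (simp add: powr_add[symmetric])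
  qed
  have lim: "(\<lambda>n. K \<beta> * lam n powr (- (t - 2))) \<longlonglongrightarrow> 0" for \<beta>
    using tendsto_mult[OF tendsto_const neg_powr_tendsto_0[OF lam, of "t - 2"], of "K \<beta>"] t by simp
  have p0: "(\<lambda>n. real n * F (lam n)) \<longlonglongrightarrow> 0"
  proof (rule tendsto_sandwich[OF _ _ _ lim])
    show "\<forall>\<^sub>F n in sequentially. 0 \<le> real n * F (lam n)"
      using tail_pos by (intro always_eventually allI mult_nonneg_nonneg) (auto intro: less_imp_le)
    show "\<forall>\<^sub>F n in sequentially. real n * F (lam n) \<le> K t * lam n powr (- (t - 2))"
      using weight lam_1
    proof eventually_elim
      case (elim n)
      have "real n * F (lam n) \<le> real n * (K t * lam n powr (- t))"
        using elim t tail_markov[of t "lam n"] by (intro mult_left_mono) (auto simp: K_def)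
      also have "\<dots> = K t * (real n * lam n powr (- t))" by simp
      also have "\<dots> \<le> K t * lam n powr (- (t - 2))" using elim K by (intro mult_left_mono) auto
      finally show ?case .
    qed
  qed auto
  have mom: "\<forall>\<^sub>F n in sequentially. real n * low_moment t (lam n) * lam n powr (- t) \<le> K t * lam n powr (- (t - 2))"
    using weight
  proof eventually_elim
    case (elim n)
    have "low_moment t (lam n) * (real n * lam n powr (- t)) \<le> K t * lam n powr (- (t - 2))"
      using elim low_moment_le_moment[of t "lam n"] t K by (intro mult_mono) (auto simp: K_def)
    then show ?case by (simp add: mult_ac)
  qed
  have nln: "(\<lambda>n. real n * ln (lam n) / (lam n)\<^sup>2) \<longlonglongrightarrow> 0"
  proof (rule tendsto_sandwich)
    show "\<forall>\<^sub>F n in sequentially. 0 \<le> real n * ln (lam n) / (lam n)\<^sup>2"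
      using lam_1 by eventually_elim simp
    show "\<forall>\<^sub>F n in sequentially. real n * ln (lam n) / (lam n)\<^sup>2 \<le>
        (sqrt (real n * ln (real n)) / lam n)\<^sup>2 + lam n powr (- 1) * ln (lam n)"
      using lam_1 eventually_ge_at_top[of 1]
    proof eventually_elim
      case (elim n)
      have sq: "(sqrt (real n * ln (real n)) / lam n)\<^sup>2 = real n * ln (real n) / (lam n)\<^sup>2"
        using elim by (simp add: power_divide)
      have inv: "lam n powr (- 1) * ln (lam n) = lam n * ln (lam n) / (lam n)\<^sup>2"
        using elim by (simp add: powr_minus_divide power2_eq_square)
      show ?case
      proof (cases "lam n \<le> real n")
        case True
        have "real n * ln (lam n) / (lam n)\<^sup>2 \<le> real n * ln (real n) / (lam n)\<^sup>2"
          using True elim by (intro divide_right_mono mult_left_mono) auto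
        moreover have "0 \<le> lam n powr (- 1) * ln (lam n)" using elim by simp
        ultimately show ?thesis unfolding sq by linarith
      next
        case False
        have "real n * ln (lam n) / (lam n)\<^sup>2 \<le> lam n * ln (lam n) / (lam n)\<^sup>2"
          using False elim by (intro divide_right_mono mult_right_mono) auto
        then show ?thesis unfolding inv by (meson add_increasing zero_le_power2)
      qed
    qed
    show "(\<lambda>n. (sqrt (real n * ln (real n)) / lam n)\<^sup>2 + lam n powr (- 1) * ln (lam n)) \<longlonglongrightarrow> 0"
      using tendsto_add[OF tendsto_power[OF scale, of 2] ln_mult_neg_powr_tendsto_0[OF lam, of 1]] by simp
  qed auto
  have var: "(\<lambda>n. real n * low_moment 2 (lam n) * ln (lam n) / (lam n)\<^sup>2) \<longlonglongrightarrow> 0"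
  proof (rule tendsto_sandwich)
    show "\<forall>\<^sub>F n in sequentially. 0 \<le> real n * low_moment 2 (lam n) * ln (lam n) / (lam n)\<^sup>2"
      using lam_1 by eventually_elim (simp add: low_moment_nonneg)
    show "\<forall>\<^sub>F n in sequentially. real n * low_moment 2 (lam n) * ln (lam n) / (lam n)\<^sup>2 \<le> K 2 * (real n * ln (lam n) / (lam n)\<^sup>2)"
      using lam_1
    proof eventually_elim
      case (elim n)
      have "low_moment 2 (lam n) * (real n * ln (lam n) / (lam n)\<^sup>2) \<le> K 2 * (real n * ln (lam n) / (lam n)\<^sup>2)"
        using elim low_moment_le_moment[of 2 "lam n"] \<alpha> by (intro mult_right_mono) (auto simp: K_def)
      then show ?case by (simp add: mult_ac)
    qed
    show "(\<lambda>n. K 2 * (real n * ln (lam n) / (lam n)\<^sup>2)) \<longlonglongrightarrow> 0"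
      using tendsto_mult[OF tendsto_const nln, of "K 2"] by simp
  qed auto
  show ?thesis using t by (intro admissible_scale_power[OF lam p0 var _ _ K mom]) auto
qed

lemma admissible_scale_of_b_scale:
  assumes "\<alpha> = 2 \<Longrightarrow> \<gamma> > 0" "\<And>n. n \<ge> 1 \<Longrightarrow> lam n > 0" "seq_ll (b_scale P H \<alpha> \<gamma>) lam"
  shows "admissible_scale lam"
proof -
  consider "\<alpha> < 2" | "\<alpha> = 2" | "\<alpha> > 2" by linarith
  then show ?thesis
  proof cases
    case 1
    then show ?thesis
      using assms by (intro admissible_scale_infinite_variance) (auto simp: seq_ll_def b_scale_def)
  next
    case 2
    then show ?thesis
      using assms by (intro admissible_scale_alpha_2[of \<gamma>]) (auto simp: seq_ll_def b_scale_def)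
  next
    case 3
    then show ?thesis
      using assms by (intro admissible_scale_finite_variance) (auto simp: seq_ll_def b_scale_def)
  qed
qed

end

section \<open>The large deviation limit\<close>

context iid_regvar_vectors
begin

lemma sum_asymptotics:
  assumes adm: "admissible_scale lam" and f: "vague_test f"
    and single: "((\<lambda>x. expectation (\<lambda>\<omega>. pull_test f (inverse x *\<^sub>R H \<omega>)) / F x) \<longlongrightarrow> l) at_top"
  shows "(\<lambda>n. expectation (\<lambda>\<omega>. pull_test f (inverse (lam n) *\<^sub>R (\<Sum>j=1..n. Hs j \<omega>)))
      / (real n * F (lam n))) \<longlonglongrightarrow> l"
proof -
  obtain t \<tau> C where t: "t > 0" "\<tau> > 0" "C \<ge> 0" "\<forall>\<^sub>F n in sequentially.
        real n * low_moment t (lam n) * lam n powr (- t) \<le> C * (real n * F (lam n)) powr \<tau>"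
    and lam: "filterlim lam at_top sequentially"
    and p: "(\<lambda>n. real n * F (lam n)) \<longlonglongrightarrow> 0"
    and var: "(\<lambda>n. real n * low_moment 2 (lam n) * ln (1 / (real n * F (lam n))) / (lam n)\<^sup>2) \<longlonglongrightarrow> 0"
    using adm unfolding admissible_scale_def by blast
  define E1 where "E1 n = expectation (\<lambda>\<omega>. pull_test f (inverse (lam n) *\<^sub>R (\<Sum>j=1..n. Hs j \<omega>)))" for n
  define E2 where "E2 n = expectation (\<lambda>\<omega>. pull_test f (inverse (lam n) *\<^sub>R H \<omega>))" for n
  have "(\<lambda>n. (E1 n - real n * E2 n) / (real n * F (lam n))) \<longlonglongrightarrow> 0"
    unfolding E1_def E2_def
    by (rule one_big_jump[OF f lam refl p cut_sum_deviation[OF lam refl p t(1-3) var t(4)]])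
  moreover have "(\<lambda>n. E2 n / F (lam n)) \<longlonglongrightarrow> l"
    unfolding E2_def using filterlim_compose[OF single lam] .
  ultimately have "(\<lambda>n. (E1 n - real n * E2 n) / (real n * F (lam n)) + E2 n / F (lam n)) \<longlonglongrightarrow> 0 + l"
    by (rule tendsto_add)
  moreover have "\<forall>\<^sub>F n in sequentially. (E1 n - real n * E2 n) / (real n * F (lam n)) + E2 n / F (lam n)
      = E1 n / (real n * F (lam n))"
    using eventually_gt_at_top[of 0]
  proof eventually_elim
    case (elim n)
    then show ?case using tail_pos[of "lam n"] by (simp add: diff_divide_distrib)
  qed
  ultimately show ?thesis unfolding E1_def by (simp add: filterlim_cong)
qed

lemma tail_ratio_tendsto_0:
  assumes lam: "filterlim lam at_top sequentially" and M: "(\<lambda>n. lam n / M n) \<longlonglongrightarrow> 0"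
    and M_pos: "\<And>n. n \<ge> 1 \<Longrightarrow> M n > 0"
  shows "(\<lambda>n. F (M n) / F (lam n)) \<longlonglongrightarrow> 0"
proof (rule tendstoI)
  fix e :: real assume e: "e > 0"
  \<comment> \<open>chosen so that \<open>F (R * lam n) / F (lam n)\<close> tends to \<open>e / 2\<close>\<close>
  define R where "R = (e / 2) powr (- 1 / \<alpha>)"
  have R: "R > 0" "R powr (- \<alpha>) = e / 2" using e alpha_pos by (auto simp: R_def powr_powr)
  have "\<forall>\<^sub>F n in sequentially. F (R * lam n) / F (lam n) < e"
  proof (rule order_tendstoD(2)[OF tail_ratio_along[OF lam R(1)]])
    show "R powr (- \<alpha>) < e" unfolding R(2) using e by simp
  qed
  moreover have "\<forall>\<^sub>F n in sequentially. lam n / M n < 1 / R"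
    using R by (intro order_tendstoD(2)[OF M]) auto
  ultimately show "\<forall>\<^sub>F n in sequentially. dist (F (M n) / F (lam n)) 0 < e"
    using eventually_ge_at_top[of 1]
  proof eventually_elim
    case (elim n)
    have "R * lam n \<le> M n" using elim(2) M_pos[OF elim(3)] R by (simp add: field_simps)
    then have "F (M n) \<le> F (R * lam n)" by (rule norm_tail_antimono[OF H_meas])
    then have "F (M n) / F (lam n) \<le> F (R * lam n) / F (lam n)"
      using tail_pos[of "lam n"] by (intro divide_right_mono) auto
    moreover have "0 \<le> F (M n) / F (lam n)" using tail_pos by (intro divide_nonneg_pos less_imp_le)
    ultimately show ?case using elim by simp
  qed
qed

text \<open>
  The two sums differ only when some \<open>\<parallel>H\<^sub>j\<parallel>\<close> exceeds \<open>m\<close>, and the sum of indicators counts these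
  indices.
\<close>

lemma truncation_effect:
  fixes G :: "'a \<Rightarrow> real"
  assumes G [measurable]: "G \<in> borel_measurable borel" and K: "\<And>x. \<bar>G x\<bar> \<le> K"
    and L: "\<And>j. L j \<in> borel_measurable P"
  shows "\<bar>expectation (\<lambda>\<omega>. G (\<Sum>j=1..n. soft_trunc m (L j \<omega>) (Hs j \<omega>)))
      - expectation (\<lambda>\<omega>. G (\<Sum>j=1..n. Hs j \<omega>))\<bar> \<le> 2 * K * (real n * F m)"
proof -
  have K0: "K \<ge> 0" using K[of 0] by linarith
  define U where "U \<omega> = (\<Sum>j=1..n. soft_trunc m (L j \<omega>) (Hs j \<omega>))" for \<omega>
  define V where "V \<omega> = (\<Sum>j=1..n. Hs j \<omega>)" for \<omega>
  have U: "U \<in> borel_measurable P" unfolding U_def[abs_def]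
  proof (intro borel_measurable_sum)
    fix j assume "j \<in> {1..n}"
    then have [measurable]: "Hs j \<in> borel_measurable P" using Hs_meas by auto
    note [measurable] = L[of j]
    show "(\<lambda>\<omega>. soft_trunc m (L j \<omega>) (Hs j \<omega>)) \<in> borel_measurable P"
      unfolding soft_trunc_def by measurable
  qed
  have V: "V \<in> borel_measurable P" unfolding V_def[abs_def]
    by (intro borel_measurable_sum Hs_meas) auto
  have iU: "integrable P (\<lambda>\<omega>. G (U \<omega>))"
    using K measurable_compose[OF U G] by (intro integrable_const_bound[of _ K]) auto
  have iV: "integrable P (\<lambda>\<omega>. G (V \<omega>))"
    using K measurable_compose[OF V G] by (intro integrable_const_bound[of _ K]) auto
  have iT: "integrable P (\<lambda>\<omega>. if norm (Hs j \<omega>) > m then 1 else (0::real))" if "j \<in> {1..n}" for j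
  proof -
    have [measurable]: "Hs j \<in> borel_measurable P" using that Hs_meas by auto
    show ?thesis by (intro integrable_const_bound[of _ 1]) auto
  qed
  have "\<bar>expectation (\<lambda>\<omega>. G (U \<omega>)) - expectation (\<lambda>\<omega>. G (V \<omega>))\<bar> = \<bar>expectation (\<lambda>\<omega>. G (U \<omega>) - G (V \<omega>))\<bar>"
    using iU iV by simp
  also have "\<dots> \<le> expectation (\<lambda>\<omega>. \<bar>G (U \<omega>) - G (V \<omega>)\<bar>)" by simp
  also have "\<dots> \<le> expectation (\<lambda>\<omega>. 2 * K * (\<Sum>j=1..n. if norm (Hs j \<omega>) > m then 1 else 0))"
  proof (rule integral_mono)
    show "integrable P (\<lambda>\<omega>. 2 * K * (\<Sum>j=1..n. if norm (Hs j \<omega>) > m then 1 else 0))"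
      by (intro integrable_mult_right Bochner_Integration.integrable_sum iT)
    fix \<omega>
    show "\<bar>G (U \<omega>) - G (V \<omega>)\<bar> \<le> 2 * K * (\<Sum>j=1..n. if norm (Hs j \<omega>) > m then 1 else 0)"
    proof (cases "\<exists>j\<in>{1..n}. norm (Hs j \<omega>) > m")
      case True
      then obtain k where k: "k \<in> {1..n}" "norm (Hs k \<omega>) > m" by blast
      have "(if norm (Hs k \<omega>) > m then 1 else 0) \<le> (\<Sum>j=1..n. if norm (Hs j \<omega>) > m then 1 else (0::real))"
        using k by (intro member_le_sum) auto
      then have "2 * K * 1 \<le> 2 * K * (\<Sum>j=1..n. if norm (Hs j \<omega>) > m then 1 else 0)"
        using k K0 by (intro mult_left_mono) auto
      moreover have "\<bar>G (U \<omega>) - G (V \<omega>)\<bar> \<le> 2 * K * 1" using K[of "U \<omega>"] K[of "V \<omega>"] by linarith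
      ultimately show ?thesis by linarith
    next
      case False
      then have "U \<omega> = V \<omega>" unfolding U_def V_def
        by (intro sum.cong refl) (simp add: soft_trunc_def not_less del: One_nat_def)
      then show ?thesis using K0 by (simp add: sum_nonneg)
    qed
  qed (use iU iV in auto)
  also have "\<dots> = 2 * K * (\<Sum>j=1..n. expectation (\<lambda>\<omega>. if norm (Hs j \<omega>) > m then 1 else 0))"
    using iT by (simp add: Bochner_Integration.integral_sum)
  also have "(\<Sum>j=1..n. expectation (\<lambda>\<omega>. if norm (Hs j \<omega>) > m then 1 else 0)) = (\<Sum>j=1..n. F m)"
    by (intro sum.cong refl copies_tail) auto
  finally show ?thesis by (simp add: U_def V_def)
qed

end

text \<open>
  Finiteness of the mass outside the unit ball is the Radon property for a compact shell;
  positivity holds because, by homogeneity, a measure without mass there would have no mass off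
  the origin.
\<close>

lemma scaled_measure_tail:
  fixes \<mu> :: "'a::euclidean_space measure"
  assumes sets: "sets \<mu> = sets borel" and zero: "emeasure \<mu> (- {0}) \<noteq> 0"
    and radon: "radon_on ext_punctured (ext_measure \<mu>)"
    and scaling: "\<And>c A. c > 0 \<Longrightarrow> A \<in> sets borel \<Longrightarrow>
        emeasure \<mu> ((\<lambda>x. c *\<^sub>R x) ` A) = ennreal (c powr (- \<alpha>)) * emeasure \<mu> A"
  obtains c where "c > 0" "emeasure \<mu> (- cball 0 1) = ennreal c"
    "\<And>t. t > 0 \<Longrightarrow> emeasure \<mu> {x. norm x > t} = ennreal (c * t powr (- \<alpha>))"
proof -
  have m: "ext_embed \<in> measurable \<mu> borel"
    using sets by (subst measurable_cong_sets[OF sets refl]) simp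
  define C where "C = cball 0 1 - ball (0::'a) (1/2)"
  have C: "compact C" "C \<subseteq> ext_punctured" "C \<in> sets borel"
    by (auto simp: C_def ext_punctured_def compact_diff)
  have sub: "- cball 0 1 \<subseteq> ext_embed -` C \<inter> space \<mu>"
  proof
    fix x :: 'a assume "x \<in> - cball 0 1"
    then have x: "norm x > 1" by simp
    then have "1/2 \<le> norm x / (1 + norm x)" "norm x / (1 + norm x) \<le> 1" by (simp_all add: field_simps)
    then show "x \<in> ext_embed -` C \<inter> space \<mu>"
      using sets_eq_imp_space_eq[OF sets] by (simp add: C_def norm_ext_embed)
  qed
  have "emeasure \<mu> (- cball 0 1) \<le> emeasure \<mu> (ext_embed -` C \<inter> space \<mu>)"
    using measurable_sets[OF m C(3)] by (intro emeasure_mono sub)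
  also have "\<dots> = emeasure (ext_measure \<mu>) C"
    unfolding ext_measure_def using m C(3) by (simp add: emeasure_distr)
  also have "\<dots> < \<infinity>" using radon C unfolding radon_on_def by blast
  finally have fin: "emeasure \<mu> (- cball 0 1) < \<infinity>" .
  define c where "c = enn2real (emeasure \<mu> (- cball 0 1))"
  have c: "emeasure \<mu> (- cball 0 1) = ennreal c" "c \<ge> 0" using fin by (auto simp: c_def)
  have tail: "emeasure \<mu> {x. norm x > t} = ennreal (c * t powr (- \<alpha>))" if t: "t > 0" for t
  proof -
    have "{x. norm x > t} = (\<lambda>x. t *\<^sub>R x) ` (- cball (0::'a) 1)"
    proof (intro equalityI subsetI)
      fix x :: 'a assume "x \<in> {x. norm x > t}"
      then have "inverse t *\<^sub>R x \<in> - cball 0 1" "x = t *\<^sub>R (inverse t *\<^sub>R x)"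
        using t by (auto simp: field_simps)
      then show "x \<in> (\<lambda>x. t *\<^sub>R x) ` (- cball (0::'a) 1)" by blast
    qed (use t in auto)
    then have "emeasure \<mu> {x. norm x > t} = ennreal (t powr (- \<alpha>)) * emeasure \<mu> (- cball 0 1)"
      using scaling[OF t, of "- cball 0 1"] by simp
    then show ?thesis using c by (simp add: ennreal_mult' mult.commute)
  qed
  have "c \<noteq> 0"
  proof
    assume c0: "c = 0"
    have "emeasure \<mu> (\<Union>k. {x. norm x > 1 / real (Suc k)}) = 0"
      by (intro emeasure_UN_eq_0) (auto simp: sets tail c0 simp del: of_nat_Suc)
    moreover have "- {0} \<subseteq> (\<Union>k. {x::'a. norm x > 1 / real (Suc k)})"
    proof
      fix x :: 'a assume "x \<in> - {0}"
      then have "norm x > 0" by simp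
      then obtain k where "inverse (real (Suc k)) < norm x" using reals_Archimedean by blast
      then show "x \<in> (\<Union>k. {x. norm x > 1 / real (Suc k)})"
        by (auto simp: inverse_eq_divide simp del: of_nat_Suc)
    qed
    moreover have "(\<Union>k. {x::'a. norm x > 1 / real (Suc k)}) \<in> sets \<mu>"
      unfolding sets by measurable
    ultimately have "emeasure \<mu> (- {0}) \<le> 0" by (metis emeasure_mono)
    then show False using zero by simp
  qed
  then show thesis using that c tail by simp
qed

(* H 0 and L 0 are the generic H and L; H j and L j with j \<ge> 1 are the copies H_j and L_j. *)
theorem theorem2p1:
  fixes P :: "'w measure"
    and H :: "nat \<Rightarrow> 'w \<Rightarrow> 'a::euclidean_space"
    and L :: "nat \<Rightarrow> 'w \<Rightarrow> real"
    and \<mu> :: "'a measure"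
    and \<alpha> \<gamma> :: real
    and a M lam :: "nat \<Rightarrow> real"
    and X :: "nat \<Rightarrow> nat \<Rightarrow> 'w \<Rightarrow> 'a"
    and S :: "nat \<Rightarrow> 'w \<Rightarrow> 'a"
  assumes prob: "prob_space P"
    and H_meas: "\<And>j. H j \<in> borel_measurable P"
    and L_meas: "\<And>j. L j \<in> borel_measurable P"
    \<comment> \<open>the limit measure\<close>
    and mu_sets: "sets \<mu> = sets borel"
    and mu_zero: "emeasure \<mu> {0} = 0"
    and mu_nonnull: "emeasure \<mu> (- {0}) \<noteq> 0"
    and mu_radon: "radon_on ext_punctured (ext_measure \<mu>)"
    and a_lim: "filterlim a at_top sequentially"
    and H_reg: "vague_conv_on ext_punctured
        (\<lambda>n. ext_measure (scale_measure (ennreal (real n))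
               (distr P borel (\<lambda>\<omega>. inverse (a n) *\<^sub>R H 0 \<omega>))))
        (ext_measure \<mu>)"
    and alpha_pos: "\<alpha> > 0"
    and mu_scaling: "\<And>c A. c > 0 \<Longrightarrow> A \<in> sets borel \<Longrightarrow>
        emeasure \<mu> ((\<lambda>x. c *\<^sub>R x) ` A) = ennreal (c powr (- \<alpha>)) * emeasure \<mu> A"
    and alpha_eq_1: "\<alpha> = 1 \<Longrightarrow> distr P borel (\<lambda>\<omega>. - H 0 \<omega>) = distr P borel (H 0)"
    and alpha_gt_1: "\<alpha> > 1 \<Longrightarrow> integrable P (H 0) \<and> integral\<^sup>L P (H 0) = 0"
    \<comment> \<open>independence structure\<close>
    and H_copies: "\<And>j. j \<ge> 1 \<Longrightarrow> distr P borel (H j) = distr P borel (H 0)"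
    and H_indep: "prob_space.indep_vars P (\<lambda>_. borel) H {1..}"
    and L_nonneg: "\<And>j \<omega>. \<omega> \<in> space P \<Longrightarrow> L j \<omega> \<ge> 0"
    and L_copies: "\<And>j. distr P borel (L j) = distr P borel (L 0)"
    and L_indep: "prob_space.indep_vars P (\<lambda>_. borel) L UNIV"
    and LH_indep: "indep_pair P
        (Pi\<^sub>M UNIV (\<lambda>_. borel)) (\<lambda>\<omega> j. L j \<omega>)
        (Pi\<^sub>M UNIV (\<lambda>_. borel)) (\<lambda>\<omega> j. H j \<omega>)"
    \<comment> \<open>the truncated array\<close>
    and M_pos: "\<And>n. n \<ge> 1 \<Longrightarrow> M n > 0"
    and M_lim: "filterlim M at_top sequentially"
    and X_def: "\<And>n j \<omega>. X n j \<omega> = soft_trunc (M n) (L j \<omega>) (H j \<omega>)"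
    and S_def: "\<And>n \<omega>. S n \<omega> = (\<Sum>j=1..n. X n j \<omega>)"
    \<comment> \<open>soft truncation regime\<close>
    and soft: "(\<lambda>n. real n * norm_tail P (H 0) (M n)) \<longlonglongrightarrow> 0"
    and soft_eq_2: "\<alpha> = 2 \<Longrightarrow> \<gamma> > 0 \<and>
        filterlim (\<lambda>n. M n / sqrt (real n powr (1 + \<gamma>))) at_top sequentially"
    and soft_gt_2: "\<alpha> > 2 \<Longrightarrow>
        filterlim (\<lambda>n. M n / sqrt (real n * ln (M n))) at_top sequentially"
    \<comment> \<open>the normalising sequence\<close>
    and lam_pos: "\<And>n. n \<ge> 1 \<Longrightarrow> lam n > 0"
    and b_lam: "seq_ll (b_scale P (H 0) \<alpha> \<gamma>) lam"
    and lam_M: "seq_ll lam M"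
  shows "vague_conv_on ext_punctured
      (\<lambda>n. ext_measure (scale_measure (ennreal (1 / (real n * norm_tail P (H 0) (lam n))))
             (distr P borel (\<lambda>\<omega>. inverse (lam n) *\<^sub>R S n \<omega>))))
      (ext_measure (scale_measure (1 / emeasure \<mu> (- cball 0 1)) \<mu>))"
proof -
  interpret prob_space P by (rule prob)
  obtain c where c: "c > 0" "emeasure \<mu> (- cball 0 1) = ennreal c"
    "\<And>t. t > 0 \<Longrightarrow> emeasure \<mu> {x. norm x > t} = ennreal (c * t powr (- \<alpha>))"
    using scaled_measure_tail[OF mu_sets mu_nonnull mu_radon mu_scaling] by blast
  have H0 [measurable]: "H 0 \<in> borel_measurable P" by (rule H_meas)
  have expect_pull: "integral\<^sup>L (distr P borel (\<lambda>\<omega>. r *\<^sub>R Y \<omega>)) (pull_test f)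
      = expectation (\<lambda>\<omega>. pull_test f (r *\<^sub>R Y \<omega>))"
    if "vague_test f" "Y \<in> borel_measurable P" for r and Y :: "'w \<Rightarrow> 'a" and f
    using that by (intro integral_distr measurable_pull_test) auto
  interpret V: vague_regvar P "H 0" \<mu> \<alpha> c a
  proof
    show "(\<lambda>n. real n * expectation (\<lambda>\<omega>. pull_test f (inverse (a n) *\<^sub>R H 0 \<omega>)))
        \<longlonglongrightarrow> integral\<^sup>L \<mu> (pull_test f)" if "vague_test f" for f :: "'a \<Rightarrow> real"
      using H_reg vague_conv_on_ext_iff[of "\<lambda>n. distr P borel (\<lambda>\<omega>. inverse (a n) *\<^sub>R H 0 \<omega>)" real \<mu> 1]
        mu_sets that by (simp add: expect_pull)
  qed (use c alpha_pos a_lim mu_sets in auto)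
  interpret R: iid_regvar_vectors P "H 0" \<alpha> H
    using V.tail_is_regvar H_indep H_copies alpha_eq_1 alpha_gt_1
    by (intro iid_regvar_vectors.intro) (auto intro!: iid_regvar_vectors_axioms.intro)
  have adm: "R.admissible_scale lam"
    using soft_eq_2 lam_pos b_lam by (intro R.admissible_scale_of_b_scale) auto
  have lam_lim: "filterlim lam at_top sequentially"
    using adm unfolding R.admissible_scale_def by blast
  have S_meas: "S n \<in> borel_measurable P" for n
  proof -
    have "X n j \<in> borel_measurable P" for j
    proof -
      note [measurable] = H_meas[of j] L_meas[of j]
      show ?thesis unfolding X_def[abs_def] soft_trunc_def by measurable
    qed
    then show ?thesis unfolding S_def[abs_def] by (intro borel_measurable_sum)
  qed
  have limit: "(\<lambda>n. 1 / (real n * norm_tail P (H 0) (lam n)) *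
        expectation (\<lambda>\<omega>. pull_test f (inverse (lam n) *\<^sub>R S n \<omega>)))
      \<longlonglongrightarrow> 1 / c * integral\<^sup>L \<mu> (pull_test f)" if f: "vague_test f" for f :: "'a \<Rightarrow> real"
  proof -
    obtain K where K: "\<And>x. \<bar>pull_test f x\<bar> \<le> K"
      by (rule vague_test_properties[OF f]) auto
    note [measurable] = measurable_pull_test[OF f]
    define F where "F = norm_tail P (H 0)"
    define E1 where "E1 n = expectation (\<lambda>\<omega>. pull_test f (inverse (lam n) *\<^sub>R S n \<omega>))" for n
    define E2 where "E2 n = expectation (\<lambda>\<omega>. pull_test f (inverse (lam n) *\<^sub>R (\<Sum>j=1..n. H j \<omega>)))" for n
    have diff: "\<bar>E1 n - E2 n\<bar> \<le> 2 * K * (real n * F (M n))" for n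
      using R.truncation_effect[where G = "\<lambda>x. pull_test f (inverse (lam n) *\<^sub>R x)" and K = K and L = L
          and n = n and m = "M n"] K L_meas
      by (simp add: E1_def E2_def F_def S_def X_def)
    have "(\<lambda>n. (E1 n - E2 n) / (real n * F (lam n))) \<longlonglongrightarrow> 0"
    proof (rule tendsto_rabs_zero_cancel, rule tendsto_sandwich[of "\<lambda>_. 0"])
      show "(\<lambda>n. 2 * K * (F (M n) / F (lam n))) \<longlonglongrightarrow> 0"
        using tendsto_mult[OF tendsto_const R.tail_ratio_tendsto_0[OF lam_lim lam_M[unfolded seq_ll_def] M_pos]]
        by (simp add: F_def)
      show "\<forall>\<^sub>F n in sequentially. \<bar>(E1 n - E2 n) / (real n * F (lam n))\<bar> \<le> 2 * K * (F (M n) / F (lam n))"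
        using eventually_gt_at_top[of 0]
      proof eventually_elim
        case (elim n)
        have p: "real n * F (lam n) > 0" using elim R.tail_pos[of "lam n"] by (simp add: F_def)
        then have "\<bar>(E1 n - E2 n) / (real n * F (lam n))\<bar> = \<bar>E1 n - E2 n\<bar> / (real n * F (lam n))"
          by simp
        also have "\<dots> \<le> 2 * K * (real n * F (M n)) / (real n * F (lam n))"
          using diff p by (intro divide_right_mono) auto
        also have "\<dots> = 2 * K * (F (M n) / F (lam n))" using elim by simp
        finally show ?case .
      qed
    qed auto
    moreover have "(\<lambda>n. E2 n / (real n * F (lam n))) \<longlonglongrightarrow> integral\<^sup>L \<mu> (pull_test f) / c"
      unfolding E2_def F_def by (rule R.sum_asymptotics[OF adm f V.vague_along_reals[OF f]])
    ultimately have "(\<lambda>n. (E1 n - E2 n) / (real n * F (lam n)) + E2 n / (real n * F (lam n)))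
        \<longlonglongrightarrow> 0 + integral\<^sup>L \<mu> (pull_test f) / c" by (rule tendsto_add)
    then show ?thesis by (simp add: E1_def F_def add_divide_distrib[symmetric])
  qed
  have scale: "1 / emeasure \<mu> (- cball 0 1) = ennreal (1 / c)"
    unfolding c(2) using c(1) by (simp add: divide_ennreal[symmetric])
  show ?thesis
    unfolding scale
    by (subst vague_conv_on_ext_iff)
       (use c limit mu_sets S_meas R.tail_pos in \<open>auto simp: expect_pull less_imp_le\<close>)
qed

end
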